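(* Let $N$ be a positive integer and let $L$ be the largest integer whose square divides $N$. Suppose that $L$ is odd and squarefree, and that $\gcd(L,\varphi(N/L))=1$. Let $$f=\prod_{m\in\mathcal{D}_N}\ \prod_{h=0}^{\ell(m)-1}F_{m,h}^{e_{m,h}}\quad\text{for some } e_{m,h}\in\mathbf{Z}.$$ Then $f$ is a modular function on $X_0(N)$ if and only if all the following conditions are satisfied: (1) the order of $f$ at the cusp $\infty$ is an integer; (2) the order of $f$ at the cusp $0$ is an integer; (3) the order of $f$ at the cusp $\left(\begin{smallmatrix}1\\N_0\end{smallmatrix}\right)$ is an integer, where $N_0$ is the odd part of $N$; (4) $\displaystyle\sum_{m\in\mathcal{D}_N}m\,\varphi(m'')\sum_{h=1}^{\ell(m)-1}h\,e_{m,h}\equiv0\pmod L$; (5) for each odd prime divisor $p$ of $N$, $$\sum_{m:\,m''=p^r}\ \sum_{h=0}^{\ell(m)-1}e_{m,h}\equiv0\pmod2,$$ where the first sum runs over all $m\in\mathcal{D}_N$ such that $m''$ is a power of $p$.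
   Context: $X_0(N)$ is the modular curve attached to $\Gamma_0(N)$. $\varphi$ is Euler's totient function, $\zeta_n=e^{2\pi i/n}$, and $q^x=e^{2\pi i x\tau}$ for $\tau$ in the upper half plane. $\mathcal{D}_N$ is the set of positive divisors of $N$ different from $N$. For a positive divisor $m$ of $N$, $\ell=\ell(m)$ is the largest integer whose square divides $N/m$; put $m'=N/m$, $m''=m'/\ell(m)=N/(m\ell(m))$, $N'=N/\ell(m)$. For integers $g,h$ not both congruent to $0$ modulo $N$, $$E_{g,h}(\tau)=q^{B_2(g/N)/2}\prod_{n=1}^\infty\left(1-\zeta_N^h q^{n-1+g/N}\right)\left(1-\zeta_N^{-h}q^{n-g/N}\right),\qquad B_2(x)=x^2-x+\tfrac16 .$$ For each $m\in\mathcal{D}_N$ fix a set $S_{m''}\subset\{1,\dots,m''-1\}$ of representatives of $(\mathbf{Z}/m''\mathbf{Z})^\times/\{\pm1\}$, and for $\alpha\in S_{m''}$ let $\delta\in\{1,\dots,m''-1\}$ be the integer with $\alpha\delta\equiv1\pmod{m''}$. For an integer $h$, if $m''\ne2$ set $$F_{m,h}(\tau)=\prod_{\alpha\in S_{m''}}E_{\alpha m\ell,\ \delta hN'}(N'\tau),$$ and if $m''=2$ set $F_{m,h}(\tau)=E_{m\ell,hN'}(N'\tau)^{1/2}$, where the square root is the one with leading coefficient $1$, namely $q^{-N'/48}\prod_{n\ge1}(1-\zeta_{\ell}^{h}q^{N'(n-1/2)})$ (here $\ell\in\{1,2\}$). Cusps and orders: a cusp of $X_0(N)$ is written $\left(\begin{smallmatrix}a\\c\end{smallmatrix}\right)$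 (the class of $a/c$) with $c$ a positive divisor of $N$ and $a$ an integer prime to $N$; $\infty=\left(\begin{smallmatrix}1\\N\end{smallmatrix}\right)$ and $0=\left(\begin{smallmatrix}1\\1\end{smallmatrix}\right)$. Its width is $N/\gcd(c^2,N)$. For a product $f$ of integral powers of the functions $F_{m,h}$ (each of which is invariant under $\Gamma_0(N)$ up to roots of unity), the order of $f$ at $\left(\begin{smallmatrix}a\\c\end{smallmatrix}\right)$ is the rational number $\frac{N}{\gcd(c^2,N)}A$, where $q^A$ is the leading power in the Fourier expansion of $f(\gamma\tau)$ for any $\gamma=\left(\begin{smallmatrix}a&b\\c&d\end{smallmatrix}\right)\in\mathrm{SL}(2,\mathbf{Z})$. *)

theory Defs
  imports
    "HOL-Complex_Analysis.Complex_Analysis"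
    "HOL-Number_Theory.Number_Theory"
    "HOL-Number_Theory.Modular_Inverse"
    "HOL-Computational_Algebra.Squarefree"
begin

section \<open>Divisor data attached to the level\<close>

definition proper_divisors :: "nat \<Rightarrow> nat set" where
  "proper_divisors N = {m. m dvd N \<and> m \<noteq> N}"

definition max_square_root :: "nat \<Rightarrow> nat" where
  "max_square_root n = Max {d. d\<^sup>2 dvd n}"

definition ell :: "nat \<Rightarrow> nat \<Rightarrow> nat" where
  "ell N m = max_square_root (N div m)"

text \<open>The number written $m''$: for $N > 0$ and $m$ a proper divisor of $N$ it is at least 2.\<close>

definition mpp :: "nat \<Rightarrow> nat \<Rightarrow> nat" where
  "mpp N m = N div (m * ell N m)"

definition odd_part :: "nat \<Rightarrow> nat" where
  "odd_part N = N div 2 ^ multiplicity 2 N"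

definition unit_reps_mod_pm1 :: "nat \<Rightarrow> int set \<Rightarrow> bool" where
  "unit_reps_mod_pm1 n S \<longleftrightarrow>
     S \<subseteq> {1..int n - 1} \<and> (\<forall>\<alpha>\<in>S. coprime \<alpha> (int n)) \<and>
     (\<forall>u. coprime u (int n) \<longrightarrow>
        (\<exists>!\<alpha>. \<alpha> \<in> S \<and> ([u = \<alpha>] (mod int n) \<or> [u = - \<alpha>] (mod int n))))"


section \<open>The functions $E_{g,h}$ and $F_{m,h}$\<close>

definition zeta :: "nat \<Rightarrow> complex" where
  "zeta n = exp (2 * of_real pi * \<i> / of_nat n)"

definition qpow :: "complex \<Rightarrow> real \<Rightarrow> complex" where
  "qpow \<tau> x = exp (2 * of_real pi * \<i> * of_real x * \<tau>)"

definition B2 :: "real \<Rightarrow> real" where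
  "B2 x = x\<^sup>2 - x + 1 / 6"

text \<open>The product index starts at 0, so the usual index is \<open>Suc n\<close>.\<close>

definition E_fun :: "nat \<Rightarrow> int \<Rightarrow> int \<Rightarrow> complex \<Rightarrow> complex" where
  "E_fun N g h \<tau> = qpow \<tau> (B2 (real_of_int g / real N) / 2) *
     (\<Prod>n. (1 - zeta N powi h * qpow \<tau> (real (Suc n) - 1 + real_of_int g / real N)) *
          (1 - zeta N powi (- h) * qpow \<tau> (real (Suc n) - real_of_int g / real N)))"

text \<open>
  The set \<open>S\<close> is the chosen system of representatives modulo $m''$.  For $m'' = 2$ the
  function is the square root of $E_{m\ell,hN'}(N'\tau)$ with leading coefficient 1, given by
  its product; see \<open>F_fun_power2\<close>.
\<close>

definition F_fun :: "nat \<Rightarrow> int set \<Rightarrow> nat \<Rightarrow> int \<Rightarrow> complex \<Rightarrow> complex" where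
  "F_fun N S m h \<tau> =
     (let l = ell N m; N' = N div l in
      if mpp N m = 2
      then qpow \<tau> (- real N' / 48) *
             (\<Prod>n. 1 - zeta l powi h * qpow \<tau> (real N' * (real (Suc n) - 1 / 2)))
      else (\<Prod>\<alpha>\<in>S. E_fun N (\<alpha> * int m * int l)
                        (modular_inverse (int (mpp N m)) \<alpha> * h * int N') (of_nat N' * \<tau>)))"


section \<open>Modular functions and orders at cusps\<close>

definition moebius :: "int \<Rightarrow> int \<Rightarrow> int \<Rightarrow> int \<Rightarrow> complex \<Rightarrow> complex" where
  "moebius a b c d \<tau> = (of_int a * \<tau> + of_int b) / (of_int c * \<tau> + of_int d)"

text \<open>
  Meromorphic functions on the upper half plane are represented by nicely meromorphic functions,
  which vanish at their poles, so that invariance can be stated pointwise.  In the condition at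
  the cusps the local parameter $q^{1/N}$ can be used throughout, since all widths divide $N$.
\<close>

definition modular_function_X0 :: "nat \<Rightarrow> (complex \<Rightarrow> complex) \<Rightarrow> bool" where
  "modular_function_X0 N f \<longleftrightarrow>
     f nicely_meromorphic_on {\<tau>. Im \<tau> > 0} \<and>
     (\<forall>a b c d. a * d - b * c = 1 \<longrightarrow> int N dvd c \<longrightarrow>
        (\<forall>\<tau>. Im \<tau> > 0 \<longrightarrow> f (moebius a b c d \<tau>) = f \<tau>)) \<and>
     (\<forall>a b c d. a * d - b * c = 1 \<longrightarrow>
        (\<exists>G B. G meromorphic_on {0} \<and>
           (\<forall>\<tau>. Im \<tau> > 0 \<longrightarrow> Im \<tau> > B \<longrightarrow>
              f (moebius a b c d \<tau>) = G (qpow \<tau> (1 / real N)))))"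

definition has_leading_power :: "(complex \<Rightarrow> complex) \<Rightarrow> real \<Rightarrow> bool" where
  "has_leading_power g A \<longleftrightarrow>
     (\<exists>M>0. \<exists>c. c 0 \<noteq> 0 \<and>
        (\<forall>\<tau>. Im \<tau> > 0 \<longrightarrow> (\<lambda>n. c n * qpow \<tau> (A + real n / real (M::nat))) sums g \<tau>))"

text \<open>
  The leading power is the same for every matrix with first column $(a, c)$: two such matrices
  differ by a translation on the right.
\<close>

definition cusp_order :: "nat \<Rightarrow> (complex \<Rightarrow> complex) \<Rightarrow> int \<Rightarrow> nat \<Rightarrow> real" where
  "cusp_order N f a c = real N / real (gcd (c\<^sup>2) N) *
     (THE A. \<forall>b d. a * d - b * int c = 1 \<longrightarrow>
        has_leading_power (\<lambda>\<tau>. f (moebius a b (int c) d \<tau>)) A)"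


section \<open>The square root for $m'' = 2$\<close>

lemma norm_qpow: "norm (qpow \<tau> x) = exp (- 2 * pi * x * Im \<tau>)"
  by (simp add: qpow_def norm_exp_eq_Re)

lemma qpow_scale: "qpow (of_nat k * \<tau>) x = qpow \<tau> (real k * x)"
  by (simp add: qpow_def mult_ac)

lemma zeta_powi_scale:
  assumes "l dvd N" "N > 0"
  shows   "zeta N powi (h * int (N div l)) = zeta l powi h"
proof -
  obtain k where k: "N = l * k" using assms(1) by auto
  have "k > 0" "l > 0" using assms(2) k by auto
  have "zeta N ^ (N div l) = zeta l"
    using \<open>k > 0\<close> \<open>l > 0\<close> by (simp add: zeta_def k flip: exp_of_nat_mult)
  thus ?thesis
    by (metis mult.commute power_int_mult power_int_of_nat)
qed

lemma max_square_root_dvd: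
  assumes "n > 0"
  shows   "(max_square_root n)\<^sup>2 dvd n"
proof -
  have "{d. d\<^sup>2 dvd n} \<subseteq> {..n}"
  proof
    fix d assume "d \<in> {d. d\<^sup>2 dvd n}"
    then have "d\<^sup>2 \<le> n"
      using assms by (auto dest: dvd_imp_le)
    moreover have "d \<le> d\<^sup>2"
      by (cases d) (auto simp: power2_eq_square)
    ultimately show "d \<in> {..n}" by simp
  qed
  then have "finite {d. d\<^sup>2 dvd n}"
    by (rule finite_subset) simp
  moreover have "1 \<in> {d. d\<^sup>2 dvd n}" by simp
  ultimately have "Max {d. d\<^sup>2 dvd n} \<in> {d. d\<^sup>2 dvd n}"
    by (intro Max_in) auto
  thus ?thesis by (simp add: max_square_root_def)
qed

lemma zeta_powi_uminus_1_2:
  assumes "l \<in> {1, 2}"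
  shows   "zeta l powi (- h) = zeta l powi h"
proof -
  have "zeta l * zeta l = 1"
  proof -
    have "exp (2 * of_real pi * \<i>) = (1 :: complex)"
      by (auto simp: exp_eq_1 intro: exI[of _ 1])
    moreover have "exp (4 * of_real pi * \<i>) = (1 :: complex)"
      by (auto simp: exp_eq_1 intro: exI[of _ 2])
    ultimately show ?thesis
      using assms by (auto simp: zeta_def mult_ac simp flip: exp_add)
  qed
  then have "inverse (zeta l) = zeta l"
    by (rule inverse_unique)
  then show ?thesis
    by (simp add: power_int_minus flip: power_int_inverse)
qed

lemma convergent_prod_half:
  assumes "Im \<tau> > 0" "k > 0" "norm z = 1"
  shows   "convergent_prod (\<lambda>n. 1 - z * qpow \<tau> (real k * (real (Suc n) - 1 / 2)))"
proof -
  have eq: "norm (- (z * qpow \<tau> (real k * (real (Suc n) - 1 / 2)))) =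
          exp (- pi * k * Im \<tau>) * exp (- 2 * pi * k * Im \<tau>) ^ n" for n
    using assms(3)
    by (simp add: norm_mult norm_qpow algebra_simps flip: exp_of_nat_mult exp_add)
  have "summable (\<lambda>n. norm (- (z * qpow \<tau> (real k * (real (Suc n) - 1 / 2)))))"
    unfolding eq using assms by (intro summable_mult summable_geometric) auto
  then have "abs_convergent_prod (\<lambda>n. 1 + - (z * qpow \<tau> (real k * (real (Suc n) - 1 / 2))))"
    by (intro summable_imp_abs_convergent_prod) simp
  then show ?thesis
    by (intro abs_convergent_prod_imp_convergent_prod) simp
qed

lemma F_fun_power2:
  assumes "N > 0" "m dvd N" "mpp N m = 2" "Im \<tau> > 0"
  shows   "(F_fun N S m h \<tau>)\<^sup>2 =
             E_fun N (int m * int (ell N m)) (h * int (N div ell N m))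
               (of_nat (N div ell N m) * \<tau>)"
proof -
  define l where "l = ell N m"
  define k where "k = N div l"
  obtain j where j: "N = m * j" using assms(2) by auto
  have pos: "m > 0" "j > 0" using assms(1) j by auto
  have "l\<^sup>2 dvd j"
    using max_square_root_dvd[of j] pos by (simp add: l_def ell_def j)
  then obtain i where i: "j = l * l * i" by (auto simp: power2_eq_square)
  have "l > 0" "i > 0" using pos i by auto
  have li: "l * i = 2"
  proof -
    have "N = (m * l) * (l * i)" by (simp add: i j)
    then have "N div (m * l) = l * i" using pos \<open>l > 0\<close> by simp
    then show ?thesis using assms(3) by (simp add: mpp_def flip: l_def)
  qed
  then have l: "l \<in> {1, 2}"
    by (metis dvd_triv_left insertCI prime_nat_iff two_is_prime_nat)
  have N: "N = 2 * m * l" by (simp add: j i flip: li)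
  have k: "k = 2 * m" using \<open>l > 0\<close> by (simp add: k_def N)
  have "k > 0" using k pos by simp
  have half: "real_of_int (int m * int l) / real N = 1 / 2"
    using pos \<open>l > 0\<close> by (simp add: N)
  have ldvd: "l dvd N" by (simp add: N)
  have z: "zeta N powi (h * int k) = zeta l powi h"
    unfolding k_def by (rule zeta_powi_scale[OF ldvd assms(1)])
  have z': "zeta N powi (- (h * int k)) = zeta l powi h"
    using z zeta_powi_uminus_1_2[OF l, of h] by (simp add: power_int_minus)
  define P where "P = (\<lambda>n. 1 - zeta l powi h * qpow \<tau> (real k * (real (Suc n) - 1 / 2)))"
  have "norm (zeta l powi h) = 1"
    by (simp add: norm_power_int zeta_def norm_exp_eq_Re)
  then have conv: "convergent_prod P"
    unfolding P_def using convergent_prod_half[OF assms(4) \<open>k > 0\<close>] by blast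
  have F: "F_fun N S m h \<tau> = qpow \<tau> (- real k / 48) * prodinf P"
    using assms(3) by (simp add: F_fun_def Let_def P_def flip: l_def k_def)
  have "E_fun N (int m * int l) (h * int k) (of_nat k * \<tau>) =
          qpow \<tau> (real k * (B2 (1 / 2) / 2)) * prodinf (\<lambda>n. P n * P n)"
    unfolding E_fun_def half z z' qpow_scale P_def by (simp add: algebra_simps)
  also have "prodinf (\<lambda>n. P n * P n) = (prodinf P)\<^sup>2"
    using prodinf_mult[OF conv conv] by (simp add: power2_eq_square)
  also have "qpow \<tau> (real k * (B2 (1 / 2) / 2)) = (qpow \<tau> (- real k / 48))\<^sup>2"
    by (simp add: qpow_def B2_def power2_eq_square mult_ac flip: exp_add)
  finally show ?thesis
    by (simp add: F power_mult_distrib flip: l_def k_def)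
qed

end

theory Submission
  imports Defs
begin

text \<open>
  The functions $F_{m,h}$ are products of Siegel functions. Let $\theta(z|\tau)$ be the Jacobi product normalised to
  weight 0. By Liouville's theorem $\theta(z/\tau|-1/\tau)$ is $e(z^2/2\tau)\theta(z|\tau)$ up to a factor independent of
  $z$; the values at the three half periods and Euler's identity show that its cube is $i$, so it is constant.
  Hence Siegel functions transform under $\mathrm{SL}(2,\mathbf{Z})$ by an explicit twelfth root of unity.

  For $\gamma = (a, b; Nc, d)$ with $d$ odd, the multiplier of $F_{m,h}$ is therefore
  $e(bd\,u + c(a - 2d - bdNc)\,v + w)\,s$, where $u$ and $v$ depend on $m$ only, $s$ is a sign depending on
  $m''$, $a$, $d$, and $w \in \ell^{-1}\mathbf{Z}$ has a part linear and a part quadratic in $h$. Gauss's lemma shows that $s = 1$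
  unless $m''$ is prime. The quadratic part only matters at the prime 3, where it is absorbed by the order at 0.
  The linear part at a prime $p$ is a multiple of the Fermat quotient of $a$, the factor being the sum in (4).
  So if the orders at $\infty$ and 0 are integers, then $f$ is multiplied by a root of unity of odd order, trivial for all
  $\gamma$ if and only if (4) holds, times a product of quadratic characters, trivial if and only if (5) holds.
  Integrality at $1/N_0$ is implied by invariance under the stabiliser of that cusp.
\<close>

section \<open>The infinite product\<close>

text \<open>The exponent contributed by a single Siegel function has denominators 12, 2n and l. What
  makes it usable is a regrouping into b d times the order at infinity, c (a - 2d - b d N c) times
  the order at 0, a sign, and a fraction with the odd denominator l. This is done for odd d, where
  the eta-type exponent \<open>Phi\<close> is given by one polynomial; matrices with even d are
  reached by one translation.

  The arithmetic hypotheses act through one fact: N is divisible neither by 4 nor by the cube of a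
  prime. Hence l and m'' are squarefree, and a sum of squares over units modulo sign vanishes modulo
  each prime p \<ge> 5 dividing m'', because some unit u has u^2 - 1 prime to p. The primes 2 and 3
  need separate attention.

  The factor with m'' = 2 is known only through its square, so its multiplier is at first known up
  to sign. Only m = N/2 can be concerned, and integrality at infinity forces its exponent to be
  even: 24 times the order of the factor at infinity is odd for this m and even for all
  others.\<close>

definition qp :: "complex \<Rightarrow> complex \<Rightarrow> complex" where
  "qp x q = (\<Prod>n. 1 - x * q ^ n)"

lemma qp_summable:
  assumes "norm q < 1"
  shows "summable (\<lambda>n. norm (x * q ^ n :: complex))"
  using assms by (auto simp: norm_mult norm_power intro!: summable_mult summable_geometric)

lemma qp_convergent:
  assumes "norm q < 1"
  shows "convergent_prod (\<lambda>n. 1 - x * q ^ n :: complex)"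
proof -
  have "abs_convergent_prod (\<lambda>n. 1 + - (x * q ^ n))"
    by (rule summable_imp_abs_convergent_prod) (use qp_summable[OF assms] in simp)
  then show ?thesis
    by (intro abs_convergent_prod_imp_convergent_prod) simp
qed

lemma qp_has_prod: "norm q < 1 \<Longrightarrow> (\<lambda>n. 1 - x * q ^ n) has_prod qp x q"
  unfolding qp_def by (rule convergent_prod_has_prod[OF qp_convergent])

lemma qp_LIMSEQ: "norm q < 1 \<Longrightarrow> (\<lambda>n. \<Prod>i<n. 1 - x * q ^ i) \<longlonglongrightarrow> qp x q"
  using convergent_prod_LIMSEQ[OF qp_convergent] by (simp add: LIMSEQ_lessThan_iff_atMost qp_def)

lemma qp_eq_0_iff: "norm q < 1 \<Longrightarrow> qp x q = 0 \<longleftrightarrow> (\<exists>n. x * q ^ n = 1)"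
  using has_prod_eq_0_iff[OF qp_has_prod[of q x]] by (auto simp: image_iff)

lemma qp_step:
  assumes "norm q < 1"
  shows "qp x q = (1 - x) * qp (x * q) q"
proof -
  have "(\<lambda>n. \<Prod>i<Suc n. 1 - x * q ^ i) \<longlonglongrightarrow> qp x q"
    using qp_LIMSEQ[OF assms] by (rule LIMSEQ_Suc)
  moreover have "(\<lambda>n. (1 - x) * (\<Prod>i<n. 1 - x * q * q ^ i)) \<longlonglongrightarrow> (1 - x) * qp (x * q) q"
    by (intro tendsto_mult_left qp_LIMSEQ assms)
  moreover have "(\<Prod>i<Suc n. 1 - x * q ^ i) = (1 - x) * (\<Prod>i<n. 1 - x * q * q ^ i)" for n
    by (subst prod.lessThan_Suc_shift) (simp add: mult_ac)
  ultimately show ?thesis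
    using LIMSEQ_unique by (metis (no_types, lifting) ext)
qed

lemma qp_mult_uminus:
  assumes "norm q < 1"
  shows "qp x q * qp (- x) q = qp (x\<^sup>2) (q\<^sup>2)"
proof -
  have q2: "norm (q\<^sup>2) < 1" using assms by (simp add: norm_power power_less_one_iff)
  have "(\<lambda>n. (\<Prod>i<n. 1 - x * q ^ i) * (\<Prod>i<n. 1 - - x * q ^ i)) \<longlonglongrightarrow> qp x q * qp (- x) q"
    by (intro tendsto_mult qp_LIMSEQ assms)
  moreover have "(\<Prod>i<n. 1 - x * q ^ i) * (\<Prod>i<n. 1 - - x * q ^ i) = (\<Prod>i<n. 1 - x\<^sup>2 * (q\<^sup>2) ^ i)" for n
    by (simp flip: prod.distrib add: algebra_simps power2_eq_square power_mult_distrib)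
  ultimately show ?thesis
    using LIMSEQ_unique[OF _ qp_LIMSEQ[OF q2]] by simp
qed

lemma qp_split:
  assumes "norm q < 1"
  shows "qp x q = qp x (q\<^sup>2) * qp (x * q) (q\<^sup>2)"
proof -
  have q2: "norm (q\<^sup>2) < 1" using assms by (simp add: norm_power power_less_one_iff)
  have "((\<lambda>n. \<Prod>i<n. 1 - x * q ^ i) \<circ> (\<lambda>n. 2 * n)) \<longlonglongrightarrow> qp x q"
    by (rule LIMSEQ_subseq_LIMSEQ[OF qp_LIMSEQ[OF assms]]) (auto simp: strict_mono_def)
  moreover have "((\<lambda>n. \<Prod>i<n. 1 - x * q ^ i) \<circ> (\<lambda>n. 2 * n)) n =
      (\<Prod>i<n. 1 - x * (q\<^sup>2) ^ i) * (\<Prod>i<n. 1 - x * q * (q\<^sup>2) ^ i)" for n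
    by (induction n) (simp_all add: power_mult flip: power_mult)
  moreover have "(\<lambda>n. (\<Prod>i<n. 1 - x * (q\<^sup>2) ^ i) * (\<Prod>i<n. 1 - x * q * (q\<^sup>2) ^ i))
      \<longlonglongrightarrow> qp x (q\<^sup>2) * qp (x * q) (q\<^sup>2)"
    by (intro tendsto_mult qp_LIMSEQ q2)
  ultimately show ?thesis
    using LIMSEQ_unique by (metis (no_types, lifting) ext)
qed

text \<open>With q = r^2 the last two factors multiply to (q; q^2), because their arguments are r
  and -r. What remains is Euler's (-q; q) (q; q^2) = 1: multiply by (q^2; q^2), which is nonzero,
  and split (q; q) into odd and even powers. The squares of the three factors are, up to elementary
  factors, the values of theta at the half periods.\<close>

lemma qp_Euler:
  assumes "norm r < 1" and "r \<noteq> 0"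
  shows "qp (- (r\<^sup>2)) (r\<^sup>2) * qp r (r\<^sup>2) * qp (- r) (r\<^sup>2) = 1"
proof -
  define q where "q = r\<^sup>2"
  have q: "norm q < 1" unfolding q_def using assms by (simp add: norm_power power_less_one_iff)
  have q2: "norm (q\<^sup>2) < 1" using q by (simp add: norm_power power_less_one_iff)
  have 1: "qp r q * qp (- r) q = qp q (q\<^sup>2)"
    using qp_mult_uminus[OF q, of r] by (simp add: q_def)
  have 2: "qp q q * qp (- q) q = qp (q\<^sup>2) (q\<^sup>2)"
    by (rule qp_mult_uminus[OF q])
  have 3: "qp q q = qp q (q\<^sup>2) * qp (q\<^sup>2) (q\<^sup>2)"
    using qp_split[OF q, of q] by (simp add: power2_eq_square)
  have "qp (q\<^sup>2) (q\<^sup>2) \<noteq> 0"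
  proof
    assume "qp (q\<^sup>2) (q\<^sup>2) = 0"
    then obtain n where "q\<^sup>2 * (q\<^sup>2) ^ n = 1" using qp_eq_0_iff[OF q2] by auto
    then have "norm (q\<^sup>2) ^ Suc n = 1" by (metis norm_one norm_power power_Suc)
    moreover have "norm (q\<^sup>2) ^ Suc n < 1" using q2 assms(2) by (intro power_Suc_less_one) (auto simp: q_def)
    ultimately show False by simp
  qed
  then have "qp (- q) q * qp q (q\<^sup>2) = 1" using 2 3 by (simp add: mult_ac)
  then show ?thesis using 1 unfolding q_def by (metis mult.assoc mult.commute)
qed

text \<open>Both arguments are functions, so that the lemma serves holomorphy in z, in \<tau> and in
  a local parameter at a cusp. On a closed ball the base stays below some r < 1 and the coefficient
  is bounded, so a geometric series dominates.\<close>

lemma qp_holomorphic: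
  assumes f: "f holomorphic_on S" and g: "g holomorphic_on S" and S: "open S"
    and less: "\<And>z. z \<in> S \<Longrightarrow> norm (g z) < 1"
  shows "(\<lambda>z. qp (f z) (g z)) holomorphic_on S"
proof (rule holomorphic_uniform_sequence[OF S])
  show "(\<lambda>z. \<Prod>i<n. 1 - f z * g z ^ i) holomorphic_on S" for n
    by (intro holomorphic_intros f g)
  fix x assume "x \<in> S"
  then obtain d where d: "d > 0" "cball x d \<subseteq> S" using S unfolding open_contains_cball by blast
  let ?K = "cball x d"
  have cf: "continuous_on ?K f" and cg: "continuous_on ?K g"
    by (rule holomorphic_on_imp_continuous_on[OF holomorphic_on_subset[OF f d(2)]],
        rule holomorphic_on_imp_continuous_on[OF holomorphic_on_subset[OF g d(2)]])
  have "compact (f ` ?K)" by (intro compact_continuous_image cf) simp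
  then obtain C where C: "\<And>z. z \<in> ?K \<Longrightarrow> norm (f z) \<le> C"
    by (meson bounded_iff compact_imp_bounded image_eqI)
  have "continuous_on ?K (\<lambda>z. norm (g z))" by (intro continuous_intros cg)
  then obtain y where y: "y \<in> ?K" "\<And>z. z \<in> ?K \<Longrightarrow> norm (g z) \<le> norm (g y)"
    using continuous_attains_sup[of ?K "\<lambda>z. norm (g z)"] d(1) by auto
  define r where "r = norm (g y)"
  have r: "r < 1" "r \<ge> 0" using less y d by (auto simp: r_def)
  have "uniformly_convergent_on ?K (\<lambda>N z. \<Sum>n<N. norm (- (f z * g z ^ n)))"
  proof (rule Weierstrass_m_test')
    fix n z assume "z \<in> ?K"
    then have "norm (f z) * norm (g z) ^ n \<le> C * r ^ n"
      using C y by (intro mult_mono power_mono) (auto simp: r_def intro: order_trans[OF norm_ge_zero C])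
    then show "norm (norm (- (f z * g z ^ n))) \<le> C * r ^ n" by (simp add: norm_mult norm_power)
  next
    show "summable (\<lambda>n. C * r ^ n)" using r by (intro summable_mult summable_geometric) auto
  qed
  then have "uniformly_convergent_on ?K (\<lambda>N z. \<Prod>n<N. 1 + - (f z * g z ^ n))"
    by (intro Infinite_Products.uniformly_convergent_on_prod) (auto intro!: continuous_intros cf cg)
  then obtain h where h: "uniform_limit ?K (\<lambda>N z. \<Prod>n<N. 1 - f z * g z ^ n) h sequentially"
    by (auto simp: uniformly_convergent_on_def)
  have "h z = qp (f z) (g z)" if "z \<in> ?K" for z
    using tendsto_uniform_limitI[OF h that] qp_LIMSEQ[of "g z" "f z"] less that d(2) LIMSEQ_unique by blast
  then have "uniform_limit ?K (\<lambda>N z. \<Prod>n<N. 1 - f z * g z ^ n) (\<lambda>z. qp (f z) (g z)) sequentially"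
    using h by (subst (asm) uniform_limit_cong'[where f = "\<lambda>N z. \<Prod>n<N. 1 - f z * g z ^ n"]) auto
  then show "\<exists>d>0. cball x d \<subseteq> S \<and>
     uniform_limit (cball x d) (\<lambda>n z. \<Prod>i<n. 1 - f z * g z ^ i) (\<lambda>z. qp (f z) (g z)) sequentially"
    using d by blast
qed

section \<open>The normalised theta function\<close>

definition ee :: "complex \<Rightarrow> complex" where
  "ee z = exp (2 * of_real pi * \<i> * z)"

lemma ee_add: "ee (x + y) = ee x * ee y"
  by (simp add: ee_def algebra_simps exp_add)

lemma ee_diff: "ee (x - y) = ee x / ee y"
  by (simp add: ee_def algebra_simps exp_diff)

lemma ee_minus: "ee (- x) = inverse (ee x)"
  by (simp add: ee_def exp_minus)

lemma ee_0 [simp]: "ee 0 = 1" by (simp add: ee_def)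

lemma ee_nz [simp]: "ee x \<noteq> 0" by (simp add: ee_def)

lemma ee_power: "ee x ^ n = ee (of_nat n * x)"
  by (simp add: ee_def mult_ac flip: exp_of_nat_mult)

lemma ee_powi: "ee x powi n = ee (of_int n * x)"
  using exp_power_int[of "2 * of_real pi * \<i> * x" n] by (simp add: ee_def mult_ac)

lemma ee_eq_1_iff: "ee x = 1 \<longleftrightarrow> x \<in> \<int>"
proof -
  have "ee x = 1 \<longleftrightarrow> (\<exists>n::int. x = of_int n)"
  proof -
    have "Re (2 * of_real pi * \<i> * x) = - 2 * pi * Im x" "Im (2 * of_real pi * \<i> * x) = 2 * pi * Re x"
      by simp_all
    then have "ee x = 1 \<longleftrightarrow> Im x = 0 \<and> (\<exists>n::int. Re x = of_int n)"
      unfolding ee_def exp_eq_1 by (auto simp: mult.commute)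
    then show ?thesis by (auto simp: complex_eq_iff)
  qed
  then show ?thesis by (auto simp: Ints_def)
qed

lemma ee_int [simp]: "ee (of_int k) = 1"
  by (simp add: ee_eq_1_iff)

lemma ee_cong: "x - y \<in> \<int> \<Longrightarrow> ee x = ee y"
  using ee_eq_1_iff[of "x - y"] by (simp add: ee_diff)

lemma norm_ee: "norm (ee x) = exp (- 2 * pi * Im x)"
  by (simp add: ee_def norm_exp_eq_Re)

lemma norm_ee_less_1: "Im x > 0 \<Longrightarrow> norm (ee x) < 1"
  by (simp add: norm_ee)

lemma ee_half: "ee (1/2) = -1" and ee_quarter: "ee (1/4) = \<i>"
proof -
  show "ee (1/2) = -1" by (simp add: ee_def)
  have "ee (1/4) = exp (of_real (pi/2) * \<i>)" by (simp add: ee_def algebra_simps)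
  also have "\<dots> = \<i>" using cis_conv_exp[of "pi/2"] by (simp add: mult.commute)
  finally show "ee (1/4) = \<i>" .
qed

lemma ee_holomorphic [holomorphic_intros]: "f holomorphic_on S \<Longrightarrow> (\<lambda>z. ee (f z)) holomorphic_on S"
  unfolding ee_def by (intro holomorphic_intros)

lemma qpow_ee: "qpow \<tau> x = ee (of_real x * \<tau>)"
  by (simp add: qpow_def ee_def mult_ac)

abbreviation uhp :: "complex set" where "uhp \<equiv> {\<tau>. Im \<tau> > 0}"

lemma open_uhp: "open uhp" and connected_uhp: "connected uhp"
  by (auto simp: open_halfspace_Im_gt intro!: convex_connected convex_halfspace_Im_gt)

text \<open>This is \<i> times the Jacobi function theta_1 divided by Dedekind's eta function: the
  factors 1 - q^n cancel, which brings the weight down to 0 and leaves q^(1/12).\<close>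

definition theta :: "complex \<Rightarrow> complex \<Rightarrow> complex" where
  "theta z \<tau> = ee (\<tau> / 12) * (ee (z / 2) - ee (- z / 2)) *
     qp (ee (\<tau> + z)) (ee \<tau>) * qp (ee (\<tau> - z)) (ee \<tau>)"

lemma theta_minus: "theta (- z) \<tau> = - theta z \<tau>"
  by (simp add: theta_def algebra_simps)

lemma theta_add_1: "theta (z + 1) \<tau> = - theta z \<tau>"
proof -
  have "ee ((z + 1) / 2) = - ee (z / 2)"
    using ee_half by (simp add: add_divide_distrib ee_add)
  moreover have "ee (- (z + 1) / 2) = - ee (- z / 2)"
    using calculation by (simp add: ee_minus flip: minus_divide_left del: minus_add_distrib)
  moreover have "ee (\<tau> + (z + 1)) = ee (\<tau> + z)" "ee (\<tau> - (z + 1)) = ee (\<tau> - z)"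
    by (auto intro!: ee_cong)
  ultimately show ?thesis by (simp add: theta_def algebra_simps)
qed

lemma theta_add_tau:
  assumes "Im \<tau> > 0"
  shows "theta (z + \<tau>) \<tau> = - ee (- z - \<tau> / 2) * theta z \<tau>"
proof -
  have q: "norm (ee \<tau>) < 1" by (rule norm_ee_less_1[OF assms])
  define A where "A = qp (ee (\<tau> + z) * ee \<tau>) (ee \<tau>)"
  define B where "B = qp (ee (- z) * ee \<tau>) (ee \<tau>)"
  have 1: "qp (ee (\<tau> + z)) (ee \<tau>) = (1 - ee (\<tau> + z)) * A"
    unfolding A_def by (rule qp_step[OF q])
  have 2: "qp (ee (- z)) (ee \<tau>) = (1 - ee (- z)) * B"
    unfolding B_def by (rule qp_step[OF q])
  have 3: "qp (ee (\<tau> - z)) (ee \<tau>) = B" unfolding B_def by (simp add: ee_diff ee_minus field_simps)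
  have 4: "qp (ee (\<tau> + (z + \<tau>))) (ee \<tau>) = A" unfolding A_def by (simp only: ee_add mult_ac)
  \<comment> \<open>The shift takes the factor 1 - ee (\<tau> + z) out of the first product and adds
    1 - ee (- z) to the second. With x and y square roots of ee z and ee \<tau> the comparison is
    one of rational functions.\<close>
  have 5: "(ee ((z + \<tau>) / 2) - ee (- (z + \<tau>) / 2)) * (1 - ee (- z)) =
      - ee (- z - \<tau> / 2) * (ee (z / 2) - ee (- z / 2)) * (1 - ee (\<tau> + z))"
  proof -
    define x where "x = ee (z/2)" define y where "y = ee (\<tau>/2)"
    have nz: "x \<noteq> 0" "y \<noteq> 0" by (auto simp: x_def y_def)
    have e1: "ee z = x\<^sup>2" "ee \<tau> = y\<^sup>2" by (auto simp: x_def y_def ee_power)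
    have "ee ((z + \<tau>) / 2) = x * y" "ee (- (z + \<tau>) / 2) = 1 / (x * y)"
      "ee (- z) = 1 / x\<^sup>2" "ee (- z - \<tau> / 2) = 1 / (x\<^sup>2 * y)" "ee (- z / 2) = 1 / x"
      "ee (\<tau> + z) = x\<^sup>2 * y\<^sup>2"
      by (simp_all add: e1 add_divide_distrib diff_divide_distrib ee_add ee_diff ee_minus
            flip: x_def y_def) (simp_all add: field_simps)
    note * = this
    show ?thesis unfolding * using nz by (simp add: x_def[symmetric] field_simps power2_eq_square)
  qed
  have "theta (z + \<tau>) \<tau> = ee (\<tau> / 12) * (ee ((z + \<tau>) / 2) - ee (- (z + \<tau>) / 2)) * A * ((1 - ee (- z)) * B)"
    unfolding theta_def 4 by (simp add: 2)
  also have "\<dots> = ee (\<tau> / 12) * A * B * ((ee ((z + \<tau>) / 2) - ee (- (z + \<tau>) / 2)) * (1 - ee (- z)))"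
    by (simp add: mult_ac)
  also have "\<dots> = - ee (- z - \<tau> / 2) * theta z \<tau>"
    unfolding 5 theta_def 1 3 by (simp add: mult_ac)
  finally show ?thesis .
qed

lemma theta_diff_tau:
  assumes "Im \<tau> > 0"
  shows "theta (z - \<tau>) \<tau> = - ee (z - \<tau> / 2) * theta z \<tau>"
proof -
  have "theta (z - \<tau>) \<tau> = - theta (- z + \<tau>) \<tau>" using theta_minus[of "z - \<tau>" \<tau>] by simp
  then show ?thesis using theta_add_tau[OF assms, of "- z"] by (simp add: theta_minus)
qed

lemma theta_tau_add_1: "theta z (\<tau> + 1) = ee (1/12) * theta z \<tau>"
proof -
  have "ee (\<tau> + 1 + z) = ee (\<tau> + z)" "ee (\<tau> + 1 - z) = ee (\<tau> - z)" "ee (\<tau> + 1) = ee \<tau>"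
    by (auto intro!: ee_cong)
  then show ?thesis by (simp add: theta_def add_divide_distrib ee_add mult_ac)
qed

definition lattice :: "complex \<Rightarrow> complex set" where
  "lattice \<tau> = {z. \<exists>m n :: int. z = of_int m + of_int n * \<tau>}"

text \<open>The sine factor accounts for the integers, the two products for the points of Z + n
  \<tau> with n negative and n positive.\<close>

lemma theta_eq_0_iff:
  assumes "Im \<tau> > 0"
  shows "theta z \<tau> = 0 \<longleftrightarrow> z \<in> lattice \<tau>"
proof -
  have q: "norm (ee \<tau>) < 1" by (rule norm_ee_less_1[OF assms])
  have "ee (z / 2) - ee (- z / 2) = 0 \<longleftrightarrow> ee z = 1"
  proof -
    have "ee (z / 2) - ee (- z / 2) = 0 \<longleftrightarrow> ee (z/2) * ee (z/2) = 1"
      by (simp add: ee_minus field_simps)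
    then show ?thesis by (simp flip: ee_add)
  qed
  moreover have "ee (\<tau> + x) * ee \<tau> ^ n = ee (of_nat (Suc n) * \<tau> + x)" for x n
    by (simp add: ee_add ee_power algebra_simps)
  ultimately have "theta z \<tau> = 0 \<longleftrightarrow> z \<in> \<int> \<or> (\<exists>n. of_nat (Suc n) * \<tau> + z \<in> \<int>) \<or> (\<exists>n. of_nat (Suc n) * \<tau> - z \<in> \<int>)"
    using q by (simp add: theta_def qp_eq_0_iff ee_eq_1_iff flip: add_uminus_conv_diff)
  also have "\<dots> \<longleftrightarrow> z \<in> lattice \<tau>"
  proof
    assume "z \<in> \<int> \<or> (\<exists>n. of_nat (Suc n) * \<tau> + z \<in> \<int>) \<or> (\<exists>n. of_nat (Suc n) * \<tau> - z \<in> \<int>)"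
    then consider k where "z = of_int k" | n k where "of_nat (Suc n) * \<tau> + z = of_int k" |
       n k where "of_nat (Suc n) * \<tau> - z = of_int k" by (auto simp: Ints_def)
    then show "z \<in> lattice \<tau>"
    proof cases
      case 1 then show ?thesis unfolding lattice_def by (auto intro: exI[of _ k] exI[of _ 0])
    next
      case 2
      then have "z = of_int k + of_int (- int (Suc n)) * \<tau>" by (simp add: algebra_simps eq_diff_eq)
      then show ?thesis unfolding lattice_def by blast
    next
      case 3
      then have "z = of_int (- k) + of_int (int (Suc n)) * \<tau>" by (simp add: algebra_simps)
      then show ?thesis unfolding lattice_def by blast
    qed
  next
    assume "z \<in> lattice \<tau>"
    then obtain m n :: int where z: "z = of_int m + of_int n * \<tau>" by (auto simp: lattice_def)
    consider "n = 0" | k where "n = - int (Suc k)" | k where "n = int (Suc k)"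
      by (metis int_cases nat.exhaust of_nat_0)
    then show "z \<in> \<int> \<or> (\<exists>n. of_nat (Suc n) * \<tau> + z \<in> \<int>) \<or> (\<exists>n. of_nat (Suc n) * \<tau> - z \<in> \<int>)"
    proof cases
      case 1 then show ?thesis using z by simp
    next
      case 2
      then have "of_nat (Suc k) * \<tau> + z = of_int m"
        using z by (simp add: 2 algebra_simps)
      then show ?thesis using Ints_of_int by metis
    next
      case 3
      then have "of_nat (Suc k) * \<tau> - z = of_int (- m)" using z by (simp add: 3 algebra_simps)
      then show ?thesis using Ints_of_int by metis
    qed
  qed
  finally show ?thesis .
qed

lemma theta_holomorphic:
  assumes "f holomorphic_on S" "g holomorphic_on S" "open S" "\<And>z. z \<in> S \<Longrightarrow> Im (g z) > 0"
  shows "(\<lambda>z. theta (f z) (g z)) holomorphic_on S"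
  unfolding theta_def
  using assms by (intro holomorphic_intros qp_holomorphic) (auto simp: norm_ee_less_1)


text \<open>The zero at 0 is simple: the sine factor has derivative 2 pi \<i> and the other factors
  do not vanish there. This removes the singularity of a quotient by theta at 0 and, by periodicity,
  at every lattice point.\<close>

lemma theta_has_derivative_0:
  assumes "Im \<tau> > 0"
  shows "\<exists>D. D \<noteq> 0 \<and> ((\<lambda>z. theta z \<tau>) has_field_derivative D) (at 0)"
proof -
  have q: "norm (ee \<tau>) < 1" by (rule norm_ee_less_1[OF assms])
  define K where "K = (\<lambda>z. ee (\<tau> / 12) * qp (ee (\<tau> + z)) (ee \<tau>) * qp (ee (\<tau> - z)) (ee \<tau>))"
  have "K holomorphic_on UNIV"
    unfolding K_def using q by (intro holomorphic_intros qp_holomorphic) auto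
  then have K: "(K has_field_derivative deriv K 0) (at 0)"
    using holomorphic_derivI by (metis UNIV_I open_UNIV)
  have A: "((\<lambda>z. ee (z / 2) - ee (- z / 2)) has_field_derivative (2 * of_real pi * \<i>)) (at 0)"
    unfolding ee_def by (auto intro!: derivative_eq_intros)
  have "((\<lambda>z. (ee (z / 2) - ee (- z / 2)) * K z) has_field_derivative (2 * of_real pi * \<i>) * K 0) (at 0)"
    using DERIV_mult[OF A K] by simp
  moreover have "(\<lambda>z. (ee (z / 2) - ee (- z / 2)) * K z) = (\<lambda>z. theta z \<tau>)"
    by (auto simp: K_def theta_def)
  moreover have "K 0 \<noteq> 0"
  proof -
    have "ee \<tau> * ee \<tau> ^ n \<noteq> 1" for n
    proof
      assume "ee \<tau> * ee \<tau> ^ n = 1"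
      then have "norm (ee \<tau>) ^ Suc n = 1" by (metis norm_one norm_power power_Suc)
      moreover have "norm (ee \<tau>) ^ Suc n < 1" using q by (intro power_Suc_less_one) auto
      ultimately show False by simp
    qed
    then show ?thesis using q by (auto simp: K_def qp_eq_0_iff)
  qed
  ultimately show ?thesis
    by (intro exI[of _ "(2 * of_real pi * \<i>) * K 0"]) auto
qed

text \<open>The quotient by theta extends to a bounded entire function.\<close>
lemma theta_unique:
  assumes \<tau>: "Im \<tau> > 0" and N: "N holomorphic_on UNIV"
    and N1: "\<And>z. N (z + 1) = - N z" and Nt: "\<And>z. N (z + \<tau>) = - ee (- z - \<tau> / 2) * N z"
    and N0: "N 0 = 0"
  shows "\<exists>C. \<forall>z. N z = C * theta z \<tau>"
proof -
  let ?th = "\<lambda>z. theta z \<tau>"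
  let ?L = "lattice \<tau>"
  obtain D where D: "D \<noteq> 0" "(?th has_field_derivative D) (at 0)"
    using theta_has_derivative_0[OF \<tau>] by blast
  have th: "?th holomorphic_on UNIV" by (rule theta_holomorphic) (use \<tau> in \<open>auto intro!: holomorphic_intros\<close>)
  have N': "(N has_field_derivative deriv N 0) (at 0)"
    using N holomorphic_derivI by (metis UNIV_I open_UNIV)
  define c0 where "c0 = deriv N 0 / D"
  have 0: "0 \<in> ?L" by (auto simp: lattice_def intro!: exI[of _ 0])
  have lim: "((\<lambda>z. N z / ?th z) \<longlongrightarrow> c0) (at 0)"
    using lhopital_complex_simple[OF N' D(2) N0 _ D(1)] theta_eq_0_iff[OF \<tau>] 0 by (simp add: c0_def)
  define R where "R = (\<lambda>z. if z \<in> ?L then c0 else N z / ?th z)"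
  have L1: "z + 1 \<in> ?L \<longleftrightarrow> z \<in> ?L" and Lt: "z + \<tau> \<in> ?L \<longleftrightarrow> z \<in> ?L" for z
    using theta_eq_0_iff[OF \<tau>] theta_add_1[of z \<tau>] theta_add_tau[OF \<tau>, of z]
    by (metis neg_equal_0_iff_equal, metis ee_nz mult_eq_0_iff neg_equal_0_iff_equal)
  have R1: "R (z + 1) = R z" for z unfolding R_def by (simp add: L1 theta_add_1 N1)
  have Rt: "R (z + \<tau>) = R z" for z unfolding R_def by (simp add: Lt theta_add_tau[OF \<tau>] Nt)
  have Rm: "R (z + of_int m) = R z" for z m
  proof (induction m rule: int_induct[where k = 0])
    case (step1 i) then show ?case using R1[of "z + of_int i"] by (simp add: add.assoc)
  next
    case (step2 i) then show ?case using R1[of "z + of_int (i - 1)"] by (simp add: add.assoc)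
  qed simp
  have Rn: "R (z + of_int n * \<tau>) = R z" for z n
  proof (induction n rule: int_induct[where k = 0])
    case (step1 i) then show ?case using Rt[of "z + of_int i * \<tau>"] by (simp add: algebra_simps)
  next
    case (step2 i) then show ?case using Rt[of "z + of_int (i - 1) * \<tau>"] by (simp add: algebra_simps)
  qed simp
  have per: "R (z + (of_int m + of_int n * \<tau>)) = R z" for z m n
    using Rn[of "z + of_int m" n] Rm[of z m] by (simp add: add.assoc)
  \<comment> \<open>Within this radius 0 is the only lattice point: the imaginary part excludes n
    \<noteq> 0, and then the real part excludes m \<noteq> 0.\<close>
  define r where "r = min 1 (Im \<tau>)"
  have r: "r > 0" using \<tau> by (simp add: r_def)
  have sm: "z = 0" if "z \<in> ?L" "norm z < r" for z
  proof -
    from that(1) obtain m n :: int where z: "z = of_int m + of_int n * \<tau>" unfolding lattice_def by blast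
    have "\<bar>Im z\<bar> < Im \<tau>" using that abs_Im_le_cmod[of z] by (auto simp: r_def)
    then have "\<bar>of_int n\<bar> * Im \<tau> < 1 * Im \<tau>" using \<tau> by (simp add: z abs_mult)
    then have n: "n = 0" using \<tau> by (subst (asm) mult_less_cancel_right) auto
    have "\<bar>Re z\<bar> < 1" using that abs_Re_le_cmod[of z] by (auto simp: r_def)
    then show ?thesis using n z by simp
  qed
  have "R holomorphic_on ball 0 r"
  proof (rule no_isolated_singularity'[where K = "{0}"])
    have "eventually (\<lambda>z. N z / ?th z = R z) (at 0)"
      unfolding eventually_at using r sm by (auto simp: R_def intro!: exI[of _ r])
    then have "(R \<longlongrightarrow> c0) (at 0)" using lim by (rule Lim_transform_eventually[rotated])
    then show "(R \<longlongrightarrow> R z) (at z within ball 0 r)" if "z \<in> {0}" for z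
      using that 0 by (auto simp: R_def intro: tendsto_within_subset)
    have "(\<lambda>z. N z / ?th z) holomorphic_on ball 0 r - {0}"
      using sm theta_eq_0_iff[OF \<tau>] by (intro holomorphic_intros holomorphic_on_subset[OF N]
        holomorphic_on_subset[OF th]) auto
    then show "R holomorphic_on ball 0 r - {0}"
      using sm by (subst holomorphic_cong[OF refl, of _ _ "\<lambda>z. N z / ?th z"]) (auto simp: R_def)
  qed auto
  then have R0: "R field_differentiable at 0"
    using r by (metis centre_in_ball holomorphic_on_imp_differentiable_at open_ball)
  have "R field_differentiable at z" for z
  proof (cases "z \<in> ?L")
    case True
    then obtain m n :: int where z: "z = of_int m + of_int n * \<tau>" by (auto simp: lattice_def)
    have "R w = R (w - z)" for w using per[of "w - z" m n] by (simp add: z)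
    then have "R = R \<circ> (\<lambda>w. w - z)" by (simp add: fun_eq_iff)
    moreover have "(R \<circ> (\<lambda>w. w - z)) field_differentiable at z"
      by (rule field_differentiable_compose) (use R0 in \<open>auto intro!: derivative_intros\<close>)
    ultimately show ?thesis by metis
  next
    case False
    define U where "U = ?th -` (- {0})"
    have U: "open U" unfolding U_def
      using holomorphic_on_imp_continuous_on[OF th] by (intro open_vimage) auto
    have "(\<lambda>z. N z / ?th z) holomorphic_on U"
      by (intro holomorphic_intros holomorphic_on_subset[OF N] holomorphic_on_subset[OF th])
         (auto simp: U_def)
    then have "R holomorphic_on U"
      using theta_eq_0_iff[OF \<tau>]
      by (subst holomorphic_cong[OF refl, of _ _ "\<lambda>z. N z / ?th z"]) (auto simp: R_def U_def)
    moreover have "z \<in> U" using False theta_eq_0_iff[OF \<tau>] by (auto simp: U_def)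
    ultimately show ?thesis using U holomorphic_on_imp_differentiable_at by blast
  qed
  then have Rh: "R holomorphic_on UNIV" by (simp add: holomorphic_on_def)
  \<comment> \<open>Subtracting a multiple of \<tau> brings the imaginary part into [0, Im \<tau>],
    subtracting an integer then brings the real part into [0, 1]. So a rectangle can replace the
    fundamental parallelogram.\<close>
  have "range R \<subseteq> R ` cbox 0 (Complex 1 (Im \<tau>))"
  proof
    fix y assume "y \<in> range R"
    then obtain z where y: "y = R z" by blast
    define n where "n = \<lfloor>Im z / Im \<tau>\<rfloor>"
    define w where "w = z - of_int n * \<tau>"
    define m where "m = \<lfloor>Re w\<rfloor>"
    have "of_int n \<le> Im z / Im \<tau>" "Im z / Im \<tau> \<le> of_int n + 1"
      unfolding n_def by linarith+
    then have "0 \<le> Im w" "Im w \<le> Im \<tau>" using \<tau> by (simp_all add: w_def field_simps)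
    moreover have "of_int m \<le> Re w" "Re w \<le> of_int m + 1"
      unfolding m_def by linarith+
    ultimately have "w - of_int m \<in> cbox 0 (Complex 1 (Im \<tau>))"
      by (auto simp: cbox_def Basis_complex_def)
    moreover have "y = R (w - of_int m)"
      using per[of "w - of_int m" m n] by (simp add: y w_def algebra_simps)
    ultimately show "y \<in> R ` cbox 0 (Complex 1 (Im \<tau>))" by blast
  qed
  moreover have "compact (R ` cbox 0 (Complex 1 (Im \<tau>)))"
    by (intro compact_continuous_image holomorphic_on_imp_continuous_on holomorphic_on_subset[OF Rh]) auto
  ultimately have "bounded (range R)" using compact_imp_bounded bounded_subset by blast
  then obtain C where C: "\<And>z. R z = C"
    using Liouville_theorem[OF Rh] by (auto simp: constant_on_def)
  \<comment> \<open>At lattice points \<open>R\<close> is \<open>c0\<close> by definition and says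
    nothing about \<open>N\<close>; there its vanishing is carried over from 0 by
    quasi-periodicity.\<close>
  have NL: "N z = 0" if "z \<in> ?L" for z
  proof -
    have m: "N (of_int m) = 0" for m :: int
    proof (induction m rule: int_induct[where k = 0])
      case (step1 i) then show ?case using N1[of "of_int i"] by (simp add: add.commute)
    next
      case (step2 i) then show ?case using N1[of "of_int (i - 1)"] by simp
    qed (simp add: N0)
    have "N (of_int m + of_int n * \<tau>) = 0" for m n :: int
    proof (induction n rule: int_induct[where k = 0])
      case (step1 i) then show ?case using Nt[of "of_int m + of_int i * \<tau>"] by (simp add: algebra_simps)
    next
      case (step2 i) then show ?case using Nt[of "of_int m + of_int (i - 1) * \<tau>"] by (simp add: algebra_simps)
    qed (simp add: m)
    then show ?thesis using that by (auto simp: lattice_def)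
  qed
  have "N z = C * ?th z" for z
    using C[of z] NL[of z] theta_eq_0_iff[OF \<tau>, of z] by (auto simp: R_def field_simps split: if_splits)
  then show ?thesis by blast
qed

text \<open>At a half period the arguments ee (\<tau> + z) and ee (\<tau> - z) of the two products
  agree or differ by a factor q. In the latter case the sine factor supplies the missing first term,
  so that a square results. The bases are those of \<open>qp_Euler\<close> for r = ee
  (\<tau>/2).\<close>

lemma theta_half_periods:
  assumes "Im \<tau> > 0"
  shows "theta (1/2) \<tau> = 2 * \<i> * ee (\<tau> / 12) * (qp (- ee \<tau>) (ee \<tau>))\<^sup>2"
    and "theta (\<tau>/2) \<tau> = - ee (- \<tau> / 6) * (qp (ee (\<tau>/2)) (ee \<tau>))\<^sup>2"
    and "theta ((1+\<tau>)/2) \<tau> = \<i> * ee (- \<tau> / 6) * (qp (- ee (\<tau>/2)) (ee \<tau>))\<^sup>2"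
proof -
  have q: "norm (ee \<tau>) < 1" by (rule norm_ee_less_1[OF assms])
  have a: "ee (\<tau> + 1/2) = - ee \<tau>" "ee (\<tau> - 1/2) = - ee \<tau>" by (simp_all add: ee_add ee_diff ee_half)
  have b: "ee (- (1/4)) = - \<i>" by (simp add: ee_minus ee_quarter)
  show "theta (1/2) \<tau> = 2 * \<i> * ee (\<tau> / 12) * (qp (- ee \<tau>) (ee \<tau>))\<^sup>2"
    using a b ee_quarter by (simp add: theta_def power2_eq_square)
  \<comment> \<open>A fourth root of q, since the sine factor at \<tau>/2 already involves ee
    (\<tau>/4).\<close>
  define x where "x = ee (\<tau>/4)"
  have x0: "x \<noteq> 0" by (simp add: x_def)
  have x2: "ee (\<tau>/2) = x\<^sup>2" and x4: "ee \<tau> = x ^ 4" by (simp_all add: x_def ee_power)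
  have tau12: "ee (\<tau> / 12) = ee (- \<tau> / 6) * x"
    by (simp add: x_def flip: ee_add)
  have s: "qp (x\<^sup>2) (ee \<tau>) = (1 - x\<^sup>2) * qp (x ^ 6) (ee \<tau>)"
    "qp (- x\<^sup>2) (ee \<tau>) = (1 + x\<^sup>2) * qp (- (x ^ 6)) (ee \<tau>)"
    using qp_step[OF q, of "x\<^sup>2"] qp_step[OF q, of "- x\<^sup>2"] by (simp_all add: x4 flip: power_add)
  have c: "ee (\<tau> + \<tau>/2) = x ^ 6" "ee (\<tau> - \<tau>/2) = x\<^sup>2"
    unfolding ee_add ee_diff x2 x4 using x0 by (simp_all flip: power_add) (simp add: field_simps flip: power_add)
  have d: "ee (\<tau>/2/2) = x" "ee (- (\<tau>/2)/2) = 1 / x"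
    by (simp_all add: x_def ee_minus inverse_eq_divide)
  have "theta (\<tau>/2) \<tau> = ee (- \<tau> / 6) * x * (x - 1 / x) * qp (x ^ 6) (ee \<tau>) * qp (x\<^sup>2) (ee \<tau>)"
    unfolding theta_def c d tau12 by simp
  also have "x * (x - 1 / x) = - (1 - x\<^sup>2)" using x0 by (simp add: field_simps power2_eq_square)
  then have "ee (- \<tau> / 6) * x * (x - 1 / x) * qp (x ^ 6) (ee \<tau>) * qp (x\<^sup>2) (ee \<tau>) =
      ee (- \<tau> / 6) * (- (1 - x\<^sup>2)) * qp (x ^ 6) (ee \<tau>) * qp (x\<^sup>2) (ee \<tau>)" by (metis mult.assoc)
  also have "\<dots> = - ee (- \<tau> / 6) * (qp (ee (\<tau>/2)) (ee \<tau>))\<^sup>2"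
    unfolding x2 power2_eq_square[of "qp _ _"] by (subst (2) s(1)) (simp add: algebra_simps)
  finally show "theta (\<tau>/2) \<tau> = - ee (- \<tau> / 6) * (qp (ee (\<tau>/2)) (ee \<tau>))\<^sup>2" .
  have e: "ee (\<tau> + (1+\<tau>)/2) = - (x ^ 6)" "ee (\<tau> - (1+\<tau>)/2) = - x\<^sup>2"
  proof -
    have "\<tau> + (1+\<tau>)/2 = (\<tau> + \<tau>/2) + 1/2" "\<tau> - (1+\<tau>)/2 = (\<tau> - \<tau>/2) - 1/2" by (simp_all add: field_simps)
    then show "ee (\<tau> + (1+\<tau>)/2) = - (x ^ 6)" "ee (\<tau> - (1+\<tau>)/2) = - x\<^sup>2"
      by (simp_all only: ee_add[of _ "1/2"] ee_diff[of _ "1/2"] c ee_half) simp_all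
  qed
  have f: "ee ((1+\<tau>)/2/2) = \<i> * x" "ee (- ((1+\<tau>)/2)/2) = - \<i> / x"
  proof -
    have "(1+\<tau>)/2/2 = 1/4 + \<tau>/4" by (simp add: field_simps)
    then show g: "ee ((1+\<tau>)/2/2) = \<i> * x" by (simp only: ee_add ee_quarter x_def)
    have "- ((1+\<tau>)/2)/2 = - ((1+\<tau>)/2/2)" by simp
    then show "ee (- ((1+\<tau>)/2)/2) = - \<i> / x" using g x0 by (simp only: ee_minus) (simp add: field_simps)
  qed
  have "theta ((1+\<tau>)/2) \<tau> = ee (- \<tau> / 6) * x * (\<i> * x - - \<i> / x) * qp (- (x ^ 6)) (ee \<tau>) * qp (- x\<^sup>2) (ee \<tau>)"
    unfolding theta_def e f tau12 by simp
  also have "x * (\<i> * x - - \<i> / x) = \<i> * (1 + x\<^sup>2)" using x0 by (simp add: field_simps power2_eq_square)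
  then have "ee (- \<tau> / 6) * x * (\<i> * x - - \<i> / x) * qp (- (x ^ 6)) (ee \<tau>) * qp (- x\<^sup>2) (ee \<tau>) =
      ee (- \<tau> / 6) * (\<i> * (1 + x\<^sup>2)) * qp (- (x ^ 6)) (ee \<tau>) * qp (- x\<^sup>2) (ee \<tau>)" by (metis mult.assoc)
  also have "\<dots> = \<i> * ee (- \<tau> / 6) * (qp (- ee (\<tau>/2)) (ee \<tau>))\<^sup>2"
    unfolding x2 power2_eq_square[of "qp _ _"] by (subst (2) s(2)) (simp add: algebra_simps)
  finally show "theta ((1+\<tau>)/2) \<tau> = \<i> * ee (- \<tau> / 6) * (qp (- ee (\<tau>/2)) (ee \<tau>))\<^sup>2" .
qed

lemma theta_half_periods_prod:
  assumes "Im \<tau> > 0"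
  shows "theta (1/2) \<tau> * theta (\<tau>/2) \<tau> * theta ((1+\<tau>)/2) \<tau> = 2 * ee (- \<tau> / 4)"
proof -
  have r: "norm (ee (\<tau>/2)) < 1" using assms by (intro norm_ee_less_1) simp
  have r2: "(ee (\<tau>/2))\<^sup>2 = ee \<tau>" by (simp add: ee_power)
  have "(qp (- ee \<tau>) (ee \<tau>) * qp (ee (\<tau>/2)) (ee \<tau>) * qp (- ee (\<tau>/2)) (ee \<tau>)) = 1"
    using qp_Euler[OF r] by (simp add: r2)
  moreover have "ee (\<tau> / 12) * ee (- \<tau> / 6) * ee (- \<tau> / 6) = ee (- \<tau> / 4)"
    by (simp flip: ee_add)
  moreover have "theta (1/2) \<tau> * theta (\<tau>/2) \<tau> * theta ((1+\<tau>)/2) \<tau> =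
     2 * (ee (\<tau> / 12) * ee (- \<tau> / 6) * ee (- \<tau> / 6)) *
     (qp (- ee \<tau>) (ee \<tau>) * qp (ee (\<tau>/2)) (ee \<tau>) * qp (- ee (\<tau>/2)) (ee \<tau>))\<^sup>2"
    unfolding theta_half_periods[OF assms] by (simp add: algebra_simps power_mult_distrib)
  ultimately show ?thesis by simp
qed


lemma Im_uminus_inverse: "Im \<tau> > 0 \<Longrightarrow> Im (- 1 / \<tau>) > 0"
  by (simp add: Im_divide power2_eq_square add_pos_nonneg add_nonneg_pos)

text \<open>Multiplying the transformation at the three half periods gives the third power of the constant.\<close>
lemma theta_S_aux:
  assumes \<tau>: "Im \<tau> > 0"
  shows "\<exists>C. C ^ 3 = \<i> \<and> (\<forall>z. theta (z / \<tau>) (- 1 / \<tau>) = C * ee (z\<^sup>2 / (2 * \<tau>)) * theta z \<tau>)"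
proof -
  define \<tau>' where "\<tau>' = - 1 / \<tau>"
  have \<tau>': "Im \<tau>' > 0" unfolding \<tau>'_def by (rule Im_uminus_inverse[OF \<tau>])
  have t0: "\<tau> \<noteq> 0" using \<tau> by auto
  \<comment> \<open>The inversion exchanges the periods: adding 1 to z subtracts \<tau>' from
    z/\<tau>, and adding \<tau> to z adds 1. The Gaussian factor turns this into the
    quasi-periodicity required by \<open>theta_unique\<close>.\<close>
  define N where "N = (\<lambda>z. ee (- (z\<^sup>2) / (2 * \<tau>)) * theta (z / \<tau>) \<tau>')"
  have "\<exists>C. \<forall>z. N z = C * theta z \<tau>"
  proof (rule theta_unique[OF \<tau>])
    show "N holomorphic_on UNIV"
      unfolding N_def using t0 \<tau>' by (intro holomorphic_intros theta_holomorphic) auto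
    show "N (z + 1) = - N z" for z
    proof -
      have "theta ((z + 1) / \<tau>) \<tau>' = theta (z / \<tau> - \<tau>') \<tau>'"
        using t0 by (simp add: \<tau>'_def field_simps)
      also have "\<dots> = - ee (z / \<tau> - \<tau>' / 2) * theta (z / \<tau>) \<tau>'" by (rule theta_diff_tau[OF \<tau>'])
      finally have 1: "theta ((z + 1) / \<tau>) \<tau>' = - ee (z / \<tau> - \<tau>' / 2) * theta (z / \<tau>) \<tau>'" .
      have "ee (- ((z + 1)\<^sup>2) / (2 * \<tau>)) * ee (z / \<tau> - \<tau>' / 2) = ee (- (z\<^sup>2) / (2 * \<tau>))"
        unfolding ee_add[symmetric] \<tau>'_def using t0
        by (intro arg_cong[of _ _ ee]) (simp add: field_simps power2_eq_square)
      then show ?thesis unfolding N_def 1 by (metis (no_types) minus_mult_left minus_mult_right mult.assoc)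
    qed
    show "N (z + \<tau>) = - ee (- z - \<tau> / 2) * N z" for z
    proof -
      have "theta ((z + \<tau>) / \<tau>) \<tau>' = - theta (z / \<tau>) \<tau>'"
        using t0 theta_add_1[of "z / \<tau>" \<tau>'] by (simp add: add_divide_distrib)
      moreover have "ee (- ((z + \<tau>)\<^sup>2) / (2 * \<tau>)) = ee (- z - \<tau> / 2) * ee (- (z\<^sup>2) / (2 * \<tau>))"
        unfolding ee_add[symmetric] using t0
        by (intro arg_cong[of _ _ ee]) (simp add: field_simps power2_eq_square)
      ultimately show ?thesis by (simp add: N_def)
    qed
    show "N 0 = 0" by (simp add: N_def theta_def)
  qed
  then obtain C where C: "N z = C * theta z \<tau>" for z by blast
  have S: "theta (z / \<tau>) \<tau>' = C * ee (z\<^sup>2 / (2 * \<tau>)) * theta z \<tau>" for z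
    using C[of z] by (simp add: N_def ee_minus field_simps)
  \<comment> \<open>The inversion exchanges the half periods 1/2 and \<tau>/2 and fixes the third
    one modulo the lattice. Multiplying the three equations therefore leaves the triple products at
    \<tau>' and at \<tau>, both known from \<open>theta_half_periods_prod\<close>; the only sign
    comes from \<open>e2\<close>.\<close>
  have e1: "theta (1/2) \<tau>' = C * ee (\<tau> / 8) * theta (\<tau>/2) \<tau>"
    using S[of "\<tau>/2"] t0 by (simp add: power2_eq_square)
  have "theta (1/2/\<tau>) \<tau>' = - theta (\<tau>'/2) \<tau>'"
    using theta_minus[of "\<tau>'/2" \<tau>'] by (simp add: \<tau>'_def mult.commute)
  then have e2: "theta (\<tau>'/2) \<tau>' = - C * ee (1 / (8 * \<tau>)) * theta (1/2) \<tau>"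
    using S[of "1/2"] by (simp add: power2_eq_square) (metis minus_minus)
  have "theta ((1+\<tau>)/2/\<tau>) \<tau>' = theta ((1+\<tau>')/2 - \<tau>') \<tau>'"
    using t0 by (intro arg_cong2[of _ _ _ _ theta]) (simp_all add: \<tau>'_def field_simps)
  also have "\<dots> = - ee (1/2) * theta ((1+\<tau>')/2) \<tau>'"
    unfolding theta_diff_tau[OF \<tau>'] by (simp add: add_divide_distrib)
  also have "\<dots> = theta ((1+\<tau>')/2) \<tau>'" by (simp add: ee_half)
  finally have e3: "theta ((1+\<tau>')/2) \<tau>' = C * ee ((1+\<tau>)\<^sup>2 / (8 * \<tau>)) * theta ((1+\<tau>)/2) \<tau>"
    using S[of "(1+\<tau>)/2"] by (simp add: power_divide)
  have "2 * ee (- \<tau>' / 4) = theta (1/2) \<tau>' * theta (\<tau>'/2) \<tau>' * theta ((1+\<tau>')/2) \<tau>'"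
    by (rule theta_half_periods_prod[OF \<tau>', symmetric])
  also have "\<dots> = - (C ^ 3) * (ee (\<tau> / 8) * ee (1 / (8 * \<tau>)) * ee ((1+\<tau>)\<^sup>2 / (8 * \<tau>))) *
      (theta (1/2) \<tau> * theta (\<tau>/2) \<tau> * theta ((1+\<tau>)/2) \<tau>)"
    unfolding e1 e2 e3 by (simp add: power3_eq_cube mult_ac)
  also have "theta (1/2) \<tau> * theta (\<tau>/2) \<tau> * theta ((1+\<tau>)/2) \<tau> = 2 * ee (- \<tau> / 4)"
    by (rule theta_half_periods_prod[OF \<tau>])
  also have "ee (\<tau> / 8) * ee (1 / (8 * \<tau>)) * ee ((1+\<tau>)\<^sup>2 / (8 * \<tau>)) = ee (1/4) * ee (1 / (4 * \<tau>)) * ee (\<tau> / 4)"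
    unfolding ee_add[symmetric] using t0
    by (intro arg_cong[of _ _ ee]) (simp add: field_simps power2_eq_square)
  also have "ee (- \<tau>' / 4) = ee (1 / (4 * \<tau>))" by (simp add: \<tau>'_def mult.commute)
  finally have "ee (1 / (4 * \<tau>)) = ee (1 / (4 * \<tau>)) * (- (C ^ 3 * \<i>))"
    by (simp add: ee_minus ee_quarter field_simps)
  then have "1 = - (C ^ 3 * \<i>)" using ee_nz[of "1 / (4 * \<tau>)"] by (metis mult_cancel_left2)
  then have "C ^ 3 * \<i> = - 1" by (metis minus_minus)
  then have "C ^ 3 * \<i> * \<i> = - \<i>" by simp
  then have "C ^ 3 = \<i>" by (simp add: mult.assoc)
  then show ?thesis using S unfolding \<tau>'_def by blast
qed

text \<open>\<open>theta_S_aux\<close> leaves a cube root of unity open. The third half period is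
  fixed by the inversion modulo the lattice, so \<open>p\<close> expresses the constant as a
  holomorphic function of \<tau> with finitely many values. At the fixed point \<tau> = \<i> the two
  values of \<open>p\<close> cancel and 1 / ee (1/4) = - \<i> remains.\<close>

theorem theta_S:
  assumes \<tau>: "Im \<tau> > 0"
  shows "theta (z / \<tau>) (- 1 / \<tau>) = - \<i> * ee (z\<^sup>2 / (2 * \<tau>)) * theta z \<tau>"
proof -
  define p where "p = (\<lambda>\<tau>. theta ((1+\<tau>)/2) \<tau>)"
  define C where "C = (\<lambda>\<tau>. p (- 1 / \<tau>) / (ee ((1+\<tau>)\<^sup>2 / (8 * \<tau>)) * p \<tau>))"
  have p0: "p \<tau> \<noteq> 0" if "Im \<tau> > 0" for \<tau>
  proof
    assume "p \<tau> = 0"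
    then have "(1+\<tau>)/2 \<in> lattice \<tau>" using theta_eq_0_iff[OF that] by (simp add: p_def)
    then obtain m n :: int where mn: "(1+\<tau>)/2 = of_int m + of_int n * \<tau>"
      unfolding lattice_def by blast
    have "Im \<tau> / 2 = of_int n * Im \<tau>" using arg_cong[OF mn, of Im] by simp
    then have "(1/2::real) = of_int n" using that by (simp add: field_simps)
    then have "(1::real) = of_int (2 * n)" by simp
    then have "1 = 2 * n" by linarith
    then show False by presburger
  qed
  have CC: "C \<tau> ^ 3 = \<i>" "theta (z / \<tau>) (- 1 / \<tau>) = C \<tau> * ee (z\<^sup>2 / (2 * \<tau>)) * theta z \<tau>"
    if t: "Im \<tau> > 0" for \<tau> z
  proof -
    from theta_S_aux[OF t]
    obtain D where D: "D ^ 3 = \<i>" "\<And>z. theta (z / \<tau>) (- 1 / \<tau>) = D * ee (z\<^sup>2 / (2 * \<tau>)) * theta z \<tau>"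
      by blast
    have t0: "\<tau> \<noteq> 0" using t by auto
    have "theta ((1+\<tau>)/2/\<tau>) (- 1 / \<tau>) = theta ((1+ - 1 / \<tau>)/2 - - 1 / \<tau>) (- 1 / \<tau>)"
      using t0 by (intro arg_cong2[of _ _ _ _ theta]) (simp_all add: field_simps)
    also have "\<dots> = - ee (1/2) * p (- 1 / \<tau>)"
      unfolding theta_diff_tau[OF Im_uminus_inverse[OF t]] p_def by (simp add: add_divide_distrib diff_divide_distrib mult.commute)
    finally have "p (- 1 / \<tau>) = D * ee ((1+\<tau>)\<^sup>2 / (8 * \<tau>)) * p \<tau>"
      using D(2)[of "(1+\<tau>)/2"] by (simp add: ee_half p_def power_divide)
    then have "C \<tau> = D" using p0[OF t] by (simp add: C_def)
    then show "C \<tau> ^ 3 = \<i>" "theta (z / \<tau>) (- 1 / \<tau>) = C \<tau> * ee (z\<^sup>2 / (2 * \<tau>)) * theta z \<tau>"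
      using D by auto
  qed
  have "C holomorphic_on uhp"
    unfolding C_def p_def
    by (intro holomorphic_intros theta_holomorphic)
       (use p0 Im_uminus_inverse in \<open>auto simp: open_uhp p_def\<close>)
  moreover have "finite (C ` uhp)"
  proof (rule finite_subset)
    show "C ` uhp \<subseteq> {z. z ^ 3 = \<i>}" using CC by auto
    show "finite {z::complex. z ^ 3 = \<i>}" by (intro finite_nth_roots) simp
  qed
  ultimately obtain c where c: "\<And>t. Im t > 0 \<Longrightarrow> C t = c"
    using continuous_finite_range_constant[OF connected_uhp holomorphic_on_imp_continuous_on]
    by (auto simp: constant_on_def)
  have "(1 + \<i>)\<^sup>2 / (8 * \<i>) = 1/4" by (simp add: power2_eq_square field_simps)
  moreover have "- 1 / \<i> = \<i>" by simp
  ultimately have "C \<i> = p \<i> / (\<i> * p \<i>)" unfolding C_def by (simp only: ee_quarter)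
  then have "C \<i> = - \<i>" using p0[of \<i>] by simp
  then show ?thesis using CC(2)[OF \<tau>] c[OF \<tau>] c[of \<i>] by simp
qed

section \<open>Siegel functions\<close>

text \<open>The exponential in front cancels the Gaussian factor of \<open>theta_S\<close>. What
  remains under translation and inversion is a constant and a linear action on the row (v, w), so
  the general law is obtained by composing the two.\<close>

definition siegel :: "real \<Rightarrow> real \<Rightarrow> complex \<Rightarrow> complex" where
  "siegel v w \<tau> = ee (of_real v * (of_real v * \<tau> + of_real w) / 2) * theta (of_real v * \<tau> + of_real w) \<tau>"

lemma siegel_minus: "siegel (- v) (- w) \<tau> = - siegel v w \<tau>"
proof -
  define z where "z = of_real v * \<tau> + of_real w"
  have "of_real (- v) * \<tau> + of_real (- w) = - z" by (simp add: z_def)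
  then show ?thesis unfolding siegel_def z_def[symmetric] by (simp add: theta_minus)
qed

lemma siegel_T: "siegel v w (\<tau> + 1) = ee (1/12) * siegel v (v + w) \<tau>"
proof -
  have "of_real v * (\<tau> + 1) + of_real w = of_real v * \<tau> + of_real (v + w)"
    by (simp add: algebra_simps)
  then show ?thesis unfolding siegel_def by (simp only: theta_tau_add_1) simp
qed

lemma siegel_S:
  assumes "Im \<tau> > 0"
  shows "siegel v w (- 1 / \<tau>) = - \<i> * siegel w (- v) \<tau>"
proof -
  have t0: "\<tau> \<noteq> 0" using assms by auto
  define z where "z = of_real w * \<tau> + of_real (- v)"
  have 1: "of_real v * (- 1 / \<tau>) + of_real w = z / \<tau>" using t0 by (simp add: z_def field_simps)
  have "ee (of_real v * (z / \<tau>) / 2) * ee (z\<^sup>2 / (2 * \<tau>)) = ee (of_real w * z / 2)"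
    unfolding ee_add[symmetric] using t0
    by (intro arg_cong[of _ _ ee]) (simp add: z_def field_simps power2_eq_square)
  then show ?thesis unfolding siegel_def 1 theta_S[OF assms] z_def[symmetric]
    by (simp add: mult_ac)
qed

section \<open>The action of the modular group on the upper half plane\<close>

lemma moebius_denom_nz:
  assumes "a * d - b * c = (1::int)" "Im \<tau> > 0"
  shows "of_int c * \<tau> + of_int d \<noteq> 0"
proof
  assume 0: "of_int c * \<tau> + of_int d = (0::complex)"
  have "of_int c * Im \<tau> = 0" using arg_cong[OF 0, of Im] by simp
  then have "c = 0" using assms by simp
  with 0 assms show False by simp
qed

lemma Im_moebius_pos:
  assumes "a * d - b * c = (1::int)" "Im \<tau> > 0"
  shows "Im (moebius a b c d \<tau>) > 0"
proof -
  let ?w = "of_int c * \<tau> + of_int d :: complex"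
  have nz: "?w \<noteq> 0" by (rule moebius_denom_nz[OF assms])
  have "Im (moebius a b c d \<tau>) = (of_int (a * d - b * c) * Im \<tau>) / (norm ?w)\<^sup>2"
    unfolding moebius_def Im_divide cmod_power2[symmetric] by (simp add: algebra_simps)
  then show ?thesis using nz assms by simp
qed

lemma moebius_compose:
  assumes "a' * d' - b' * c' = (1::int)" "Im \<tau> > 0"
  shows "moebius a b c d (moebius a' b' c' d' \<tau>) =
    moebius (a * a' + b * c') (a * b' + b * d') (c * a' + d * c') (c * b' + d * d') \<tau>"
proof -
  define w where "w = (of_int c' * \<tau> + of_int d' :: complex)"
  have nz: "w \<noteq> 0" unfolding w_def by (rule moebius_denom_nz[OF assms])
  define u where "u = (of_int a' * \<tau> + of_int b' :: complex)"
  have "moebius a b c d (moebius a' b' c' d' \<tau>) = (of_int a * (u / w) + of_int b) / (of_int c * (u / w) + of_int d)"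
    by (simp add: moebius_def u_def w_def)
  also have "\<dots> = (of_int a * u + of_int b * w) / (of_int c * u + of_int d * w)"
  proof -
    have "of_int a * (u / w) + of_int b = (of_int a * u + of_int b * w) / w"
      "of_int c * (u / w) + of_int d = (of_int c * u + of_int d * w) / w"
      using nz by (simp_all add: field_simps)
    then show ?thesis using nz by simp
  qed
  also have "\<dots> = moebius (a * a' + b * c') (a * b' + b * d') (c * a' + d * c') (c * b' + d * d') \<tau>"
    by (simp add: moebius_def u_def w_def algebra_simps)
  finally show ?thesis .
qed

lemma moebius_minus: "moebius (- a) (- b) (- c) (- d) \<tau> = moebius a b c d \<tau>"
proof -
  have "of_int (- a) * \<tau> + of_int (- b) = - (of_int a * \<tau> + of_int b)"
    "of_int (- c) * \<tau> + of_int (- d) = - (of_int c * \<tau> + of_int d)" by simp_all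
  then show ?thesis unfolding moebius_def by (metis minus_divide_divide)
qed

lemma moebius_add_int: "moebius a b c d (\<tau> + of_int k) = moebius a (b + k * a) c (d + k * c) \<tau>"
  by (simp add: moebius_def algebra_simps)

lemma moebius_S: "Im \<tau> > 0 \<Longrightarrow> moebius a b c d (- 1 / \<tau>) = moebius b (- a) d (- c) \<tau>"
  using moebius_compose[of 0 0 "-1" 1 \<tau> a b c d] by (simp add: moebius_def)

lemma holomorphic_moebius:
  assumes "a * d - b * c = (1::int)"
  shows "moebius a b c d holomorphic_on uhp"
  unfolding moebius_def using moebius_denom_nz[OF assms] by (intro holomorphic_intros) auto

text \<open>Modulo 12, the exponent of the character of $\mathrm{SL}(2,\mathbf{Z})$ by which the square of Dedekind's eta function
  transforms.\<close>
definition Phi :: "int \<Rightarrow> int \<Rightarrow> int \<Rightarrow> int \<Rightarrow> int" where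
  "Phi a b c d = (if odd d then a * c * (1 - d\<^sup>2) + d * (b - c + 3) - 3
     else b * d * (1 - c\<^sup>2) + c * (a + d - 3))"

lemma three_dvd_cube_diff: "3 dvd c - c ^ 3" for c :: int
proof -
  have "c mod 3 = 0 \<or> c mod 3 = 1 \<or> c mod 3 = 2" by presburger
  then show ?thesis
  proof (elim disjE)
    assume "c mod 3 = 0" then show ?thesis by (auto simp: power3_eq_cube intro!: dvd_diff)
  next
    assume "c mod 3 = 1"
    then have "3 dvd c - 1" by presburger
    then have "3 dvd (c - 1) * (- c * (c + 1))" by (rule dvd_mult2)
    then show ?thesis by (simp add: algebra_simps power3_eq_cube)
  next
    assume "c mod 3 = 2"
    then have "3 dvd c + 1" by presburger
    then have "3 dvd (c + 1) * (- c * (c - 1))" by (rule dvd_mult2)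
    then show ?thesis by (simp add: algebra_simps power3_eq_cube)
  qed
qed

lemma twelve_dvdI: "3 dvd x \<Longrightarrow> 4 dvd x \<Longrightarrow> 12 dvd x" for x :: int
  by presburger

text \<open>Where c and d are both odd, the two formulas differ by -3 (c - 1) (d - 1), a multiple of
  12. So for odd c the second formula may be used whatever the parity of d.\<close>

lemma Phi_odd_c:
  assumes det: "a * d - b * c = 1" and c: "odd c"
  shows "12 dvd Phi a b c d - (b * d * (1 - c\<^sup>2) + c * (a + d - 3))"
proof (cases "odd d")
  case True
  have "a * c * (1 - d\<^sup>2) + d * (b - c + 3) - 3 - (b * d * (1 - c\<^sup>2) + c * (a + d - 3)) =
      - c * d * (a * d - b * c) - 2 * c * d + 3 * d + 3 * c - 3"
    by (simp add: algebra_simps power2_eq_square)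
  also have "\<dots> = - 3 * ((c - 1) * (d - 1))" unfolding det by (simp add: algebra_simps)
  finally have eq: "Phi a b c d - (b * d * (1 - c\<^sup>2) + c * (a + d - 3)) = - 3 * ((c - 1) * (d - 1))"
    using True by (simp add: Phi_def)
  obtain i j where "c = 2 * i + 1" "d = 2 * j + 1" using c True by (auto elim!: oddE)
  then have "- 3 * ((c - 1) * (d - 1)) = 12 * (- (i * j))" by (simp add: algebra_simps)
  then show ?thesis unfolding eq by (metis dvd_triv_left)
qed (simp add: Phi_def)

text \<open>For odd c the translation changes the parity of d, so both values are computed by the
  formula valid for odd c; for even c both d and c + d are odd. In either case c - c^3 supplies the
  factor 3 and parity the factor 4.\<close>

lemma Phi_T:
  assumes det: "a * d - b * c = 1"
  shows "12 dvd Phi a (a + b) c (c + d) - Phi a b c d - 1"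
proof (cases "odd c")
  case True
  have det': "a * (c + d) - (a + b) * c = 1" using det by (simp add: algebra_simps)
  have ad: "a * d = 1 + b * c" using det by simp
  have "((a + b) * (c + d) * (1 - c\<^sup>2) + c * (a + (c + d) - 3)) - (b * d * (1 - c\<^sup>2) + c * (a + d - 3)) - 1
     = (1 - c\<^sup>2) * (a * c + a * d + b * c) + c\<^sup>2 - 1" by (simp add: algebra_simps power2_eq_square)
  also have "\<dots> = (c - c ^ 3) * (a + 2 * b)" unfolding ad
    by (simp add: algebra_simps power2_eq_square power3_eq_cube)
  finally have eq: "((a + b) * (c + d) * (1 - c\<^sup>2) + c * (a + (c + d) - 3)) -
     (b * d * (1 - c\<^sup>2) + c * (a + d - 3)) - 1 = (c - c ^ 3) * (a + 2 * b)" .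
  obtain i where i: "c = 2 * i + 1" using True by (auto elim!: oddE)
  have "c - c ^ 3 = 4 * (- (i * (i + 1) * c))" unfolding i by (simp add: algebra_simps power3_eq_cube)
  then have "4 dvd c - c ^ 3" by (metis dvd_triv_left)
  then have "12 dvd (c - c ^ 3) * (a + 2 * b)"
    by (intro dvd_mult2 twelve_dvdI three_dvd_cube_diff)
  then have "12 dvd (Phi a (a + b) c (c + d) - ((a + b) * (c + d) * (1 - c\<^sup>2) + c * (a + (c + d) - 3)))
      - (Phi a b c d - (b * d * (1 - c\<^sup>2) + c * (a + d - 3))) + (c - c ^ 3) * (a + 2 * b)"
    by (intro dvd_add dvd_diff Phi_odd_c[OF det True] Phi_odd_c[OF det' True])
  then show ?thesis unfolding eq[symmetric] by (simp add: algebra_simps)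
next
  case False
  have ad: "a * d = 1 + b * c" using det by simp
  have "odd (a * d)" using False unfolding ad by simp
  then have a: "odd a" and d: "odd d" by auto
  have "Phi a (a + b) c (c + d) - Phi a b c d - 1 =
      - a * c ^ 3 - 2 * c\<^sup>2 * (a * d) + a * c + b * c - c\<^sup>2 + 3 * c + (a * d) - 1"
    using False d by (simp add: Phi_def algebra_simps power2_eq_square power3_eq_cube)
  also have "\<dots> = (2 * b + a) * (c - c ^ 3) - 3 * (c * (c - 1))"
    unfolding ad by (simp add: algebra_simps power2_eq_square power3_eq_cube)
  finally have eq: "Phi a (a + b) c (c + d) - Phi a b c d - 1 = (2 * b + a) * (c - c ^ 3) - 3 * (c * (c - 1))" .
  obtain k where k: "c = 2 * k" using False by auto
  obtain j where j: "a = 2 * j + 1" using a by (auto elim!: oddE)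
  have "(2 * b + a) * (c - c ^ 3) - 3 * (c * (c - 1)) =
      4 * (b * k - 4 * b * k ^ 3 + j * k + 2 * k - 2 * a * k ^ 3 - 3 * k\<^sup>2)"
    unfolding k j by (simp add: algebra_simps power2_eq_square power3_eq_cube)
  then have 4: "4 dvd (2 * b + a) * (c - c ^ 3) - 3 * (c * (c - 1))" by (metis dvd_triv_left)
  have "3 dvd (2 * b + a) * (c - c ^ 3) - 3 * (c * (c - 1))"
    by (rule dvd_diff[OF dvd_mult[OF three_dvd_cube_diff] dvd_triv_left])
  then show ?thesis unfolding eq using 4 twelve_dvdI by blast
qed

text \<open>The inversion replaces the lower row (c, d) by (d, -c), which exchanges the two formulas
  up to the constant 3 modulo 12.\<close>

lemma Phi_S:
  assumes det: "a * d - b * c = 1"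
  shows "12 dvd Phi b (- a) d (- c) - Phi a b c d + 3"
proof (cases "odd c")
  case True
  have "Phi b (- a) d (- c) = b * d * (1 - c\<^sup>2) + c * (a + d - 3) - 3"
    using True by (simp add: Phi_def algebra_simps)
  moreover have "12 dvd - (Phi a b c d - (b * d * (1 - c\<^sup>2) + c * (a + d - 3)))"
    unfolding dvd_minus_iff by (rule Phi_odd_c[OF det True])
  moreover have "- (Phi a b c d - F) = G - Phi a b c d + 3" if "G = F - 3" for F G
    using that by simp
  ultimately show ?thesis by metis
next
  case False
  have "a * d = 1 + b * c" using det by simp
  then have "odd (a * d)" using False by simp
  then have d: "odd d" by auto
  then obtain j where j: "d = 2 * j + 1" by (auto elim!: oddE)
  have "Phi b (- a) d (- c) - Phi a b c d + 3 = 12 * (- j)"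
    using False d by (simp add: Phi_def algebra_simps j)
  then show ?thesis by (metis dvd_triv_left)
qed

lemma ee_of_int_div_cong: "12 dvd x - y \<Longrightarrow> ee (of_int x / 12) = ee (of_int y / 12)"
proof -
  assume "12 dvd x - y"
  then obtain k where "x = y + 12 * k" by (metis dvd_def add.commute diff_add_cancel)
  then have "of_int x / 12 - of_int y / 12 = (of_int k :: complex)" by (simp add: field_simps)
  then show ?thesis by (intro ee_cong) simp
qed

text \<open>A predicate of the matrix alone, quantified over all characteristics and all \<tau>, so
  that it can be carried through the Euclidean algorithm.\<close>

definition siegel_transforms :: "int \<Rightarrow> int \<Rightarrow> int \<Rightarrow> int \<Rightarrow> bool" where
  "siegel_transforms a b c d \<longleftrightarrow> (\<forall>v w \<tau>. Im \<tau> > 0 \<longrightarrow> siegel v w (moebius a b c d \<tau>) =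
     ee (of_int (Phi a b c d) / 12) * siegel (of_int a * v + of_int c * w) (of_int b * v + of_int d * w) \<tau>)"

text \<open>Stated as an equivalence because the Euclidean step uses negative powers of the
  translation as well; the reverse direction is the formula at \<tau> - 1.\<close>

lemma siegel_transforms_T:
  assumes det: "a * d - b * c = 1"
  shows "siegel_transforms a (a + b) c (c + d) \<longleftrightarrow> siegel_transforms a b c d"
proof -
  have P: "ee (of_int (Phi a (a + b) c (c + d)) / 12) = ee (of_int (Phi a b c d) / 12) * ee (1/12)"
    using ee_of_int_div_cong[of "Phi a (a + b) c (c + d)" "Phi a b c d + 1"] Phi_T[OF det]
    by (simp add: ee_add add_divide_distrib algebra_simps)
  have m: "moebius a (a + b) c (c + d) \<tau> = moebius a b c d (\<tau> + 1)" for \<tau>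
    using moebius_add_int[of a b c d \<tau> 1] by (simp add: add.commute)
  have w: "of_int (a + b) * v + of_int (c + d) * w = (of_int a * v + of_int c * w) + (of_int b * v + of_int d * w)"
    for v w :: real by (simp add: algebra_simps)
  show ?thesis
  proof
    assume *: "siegel_transforms a (a + b) c (c + d)"
    show "siegel_transforms a b c d"
      unfolding siegel_transforms_def
    proof (intro allI impI)
      fix v w \<tau> assume "Im \<tau> > 0"
      then have "Im (\<tau> - 1) > 0" by simp
      then show "siegel v w (moebius a b c d \<tau>) =
        ee (of_int (Phi a b c d) / 12) * siegel (of_int a * v + of_int c * w) (of_int b * v + of_int d * w) \<tau>"
        using *[unfolded siegel_transforms_def, rule_format, of "\<tau> - 1" v w]
          siegel_T[of "of_int a * v + of_int c * w" "of_int b * v + of_int d * w" "\<tau> - 1"]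
        unfolding w by (simp add: P m)
    qed
  next
    assume *: "siegel_transforms a b c d"
    show "siegel_transforms a (a + b) c (c + d)"
      unfolding siegel_transforms_def
    proof (intro allI impI)
      fix v w \<tau> assume "Im \<tau> > 0"
      then have "Im (\<tau> + 1) > 0" by simp
      then show "siegel v w (moebius a (a + b) c (c + d) \<tau>) =
        ee (of_int (Phi a (a + b) c (c + d)) / 12) *
        siegel (of_int a * v + of_int c * w) (of_int (a + b) * v + of_int (c + d) * w) \<tau>"
        using *[unfolded siegel_transforms_def, rule_format, of "\<tau> + 1" v w]
          siegel_T[of "of_int a * v + of_int c * w" "of_int b * v + of_int d * w" "\<tau>"]
        unfolding w by (simp add: P m)
    qed
  qed
qed

lemma siegel_transforms_Tk:
  assumes det: "a * d - b * c = 1"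
  shows "siegel_transforms a (b + k * a) c (d + k * c) \<longleftrightarrow> siegel_transforms a b c d"
proof (induction k rule: int_induct[where k = 0])
  case (step1 i)
  have "a * (d + i * c) - (b + i * a) * c = 1" using det by (simp add: algebra_simps)
  from siegel_transforms_T[OF this] show ?case using step1 by (simp add: algebra_simps)
next
  case (step2 i)
  have "a * (d + (i - 1) * c) - (b + (i - 1) * a) * c = 1" using det by (simp add: algebra_simps)
  from siegel_transforms_T[OF this] show ?case using step2 by (simp add: algebra_simps)
qed simp

lemma siegel_transforms_S:
  assumes det: "a * d - b * c = 1" and *: "siegel_transforms b (- a) d (- c)"
  shows "siegel_transforms a b c d"
  unfolding siegel_transforms_def
proof (intro allI impI)
  fix v w :: real and \<tau> assume \<tau>: "Im \<tau> > 0"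
  have P: "ee (of_int (Phi a b c d) / 12) = ee (of_int (Phi b (- a) d (- c)) / 12) * \<i>"
    using ee_of_int_div_cong[of "Phi b (- a) d (- c) + 3" "Phi a b c d"] Phi_S[OF det]
    by (simp add: ee_add add_divide_distrib ee_quarter algebra_simps)
  let ?V = "of_int a * v + of_int c * w :: real" and ?W = "of_int b * v + of_int d * w :: real"
  have "moebius a b c d \<tau> = moebius b (- a) d (- c) (- 1 / \<tau>)"
    using moebius_S[OF \<tau>, of b "- a" d "- c"] moebius_minus[of a b c d \<tau>] by simp
  then have "siegel v w (moebius a b c d \<tau>) = ee (of_int (Phi b (- a) d (- c)) / 12) * siegel ?W (- ?V) (- 1 / \<tau>)"
    using *[unfolded siegel_transforms_def, rule_format, OF Im_uminus_inverse[OF \<tau>], of v w]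
    by simp
  also have "\<dots> = ee (of_int (Phi b (- a) d (- c)) / 12) * (\<i> * siegel ?V ?W \<tau>)"
    unfolding siegel_S[OF \<tau>] siegel_minus by simp
  finally show "siegel v w (moebius a b c d \<tau>) = ee (of_int (Phi a b c d) / 12) * siegel ?V ?W \<tau>"
    unfolding P by simp
qed

text \<open>The Euclidean algorithm on the lower row: a power of the translation reduces d modulo c,
  the inversion then puts the remainder in the place of c, and |c| drops. For c = 0 a translation
  leaves the identity or its negative; the latter has exponent -6, matching the sign in
  \<open>siegel_minus\<close>.\<close>

theorem siegel_moebius:
  assumes "a * d - b * c = 1"
  shows "siegel_transforms a b c d"
  using assms
proof (induction "nat \<bar>c\<bar>" arbitrary: a b c d rule: less_induct)
  case less
  show ?case
  proof (cases "c = 0")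
    case True
    then have "a * d = 1" using less.prems by simp
    then have ad: "a = 1 \<and> d = 1 \<or> a = -1 \<and> d = -1" by (simp add: zmult_eq_1_iff)
    have 1: "siegel_transforms 1 0 0 1"
      by (auto simp: siegel_transforms_def moebius_def Phi_def)
    have 2: "siegel_transforms (- 1) 0 0 (- 1)"
      using ee_half ee_minus[of "1/2"]
      by (auto simp: siegel_transforms_def moebius_def Phi_def siegel_minus)
    from ad show ?thesis
    proof
      assume "a = 1 \<and> d = 1" then show ?thesis using siegel_transforms_Tk[of 1 1 0 0 b] 1 True by simp
    next
      assume "a = -1 \<and> d = -1" then show ?thesis using siegel_transforms_Tk[of "-1" "-1" 0 0 "-b"] 2 True by simp
    qed
  next
    case False
    define k where "k = - (d div c)"
    have d': "d + k * c = d mod c" using div_mult_mod_eq[of d c] unfolding k_def by (simp add: algebra_simps)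
    have det': "a * (d + k * c) - (b + k * a) * c = 1" using less.prems by (simp add: algebra_simps)
    have "\<bar>d + k * c\<bar> < \<bar>c\<bar>" unfolding d' using False by (rule abs_mod_less)
    then have "siegel_transforms (b + k * a) (- a) (d + k * c) (- c)"
      using det' by (intro less.hyps) (auto simp: algebra_simps)
    then have "siegel_transforms a (b + k * a) c (d + k * c)"
      by (rule siegel_transforms_S[OF det'])
    then show ?thesis using siegel_transforms_Tk[OF less.prems] by blast
  qed
qed

section \<open>The functions $E$ with real characteristics\<close>

text \<open>The function E_{g,h} with v = g/N and w = h/N. It differs from \<open>siegel\<close> by
  a constant factor, which makes it periodic in w and gives it leading coefficient 1 for 0 < v < 1;
  the price is a longer transformation formula.\<close>

definition Ef :: "real \<Rightarrow> real \<Rightarrow> complex \<Rightarrow> complex" where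
  "Ef v w \<tau> = - ee (of_real w / 2) * ee ((of_real v)\<^sup>2 * \<tau> / 2) * theta (of_real v * \<tau> + of_real w) \<tau>"

lemma Ef_siegel: "Ef v w \<tau> = - ee (of_real ((w - v * w) / 2)) * siegel v w \<tau>"
proof -
  have "ee (of_real w / 2) * ee ((of_real v)\<^sup>2 * \<tau> / 2) =
      ee (of_real ((w - v * w) / 2)) * ee (of_real v * (of_real v * \<tau> + of_real w) / 2)"
    unfolding ee_add[symmetric] by (intro arg_cong[of _ _ ee]) (simp add: field_simps power2_eq_square)
  then show ?thesis unfolding Ef_def siegel_def by simp
qed

lemma Ef_add_right: "Ef v (w + of_int k) \<tau> = Ef v w \<tau>"
proof -
  have 1: "Ef v (w + 1) \<tau> = Ef v w \<tau>" for w
  proof -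
    have "of_real v * \<tau> + of_real (w + 1) = (of_real v * \<tau> + of_real w) + 1" by simp
    moreover have "ee (of_real (w + 1) / 2) = - ee (of_real w / 2)"
      using ee_half by (simp add: add_divide_distrib ee_add)
    ultimately show ?thesis unfolding Ef_def by (simp only: theta_add_1) simp
  qed
  show ?thesis
  proof (induction k rule: int_induct[where k = 0])
    case (step1 i) then show ?case using 1[of "w + of_int i"] by (simp add: add.assoc)
  next
    case (step2 i) then show ?case using 1[of "w + of_int (i - 1)"] by (simp add: add.assoc)
  qed simp
qed

lemma Ef_add_left:
  assumes "Im \<tau> > 0"
  shows "Ef (v + of_int k) w \<tau> = ee (of_real (of_int k / 2 - of_int k * w)) * Ef v w \<tau>"
proof -
  have 1: "Ef (v + 1) w \<tau> = ee (of_real (1 / 2 - w)) * Ef v w \<tau>" for v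
  proof -
    have a: "of_real (v + 1) * \<tau> + of_real w = (of_real v * \<tau> + of_real w) + \<tau>" by (simp add: algebra_simps)
    have b: "ee ((of_real (v + 1))\<^sup>2 * \<tau> / 2) * ee (- (of_real v * \<tau> + of_real w) - \<tau> / 2) =
        ee (- of_real w) * ee ((of_real v)\<^sup>2 * \<tau> / 2)"
      unfolding ee_add[symmetric] by (intro arg_cong[of _ _ ee]) (simp add: field_simps power2_eq_square)
    have c: "ee (of_real (1 / 2 - w)) = - ee (- of_real w)"
    proof -
      have "complex_of_real (1 / 2 - w) = 1 / 2 + - of_real w" by simp
      then show ?thesis using ee_half by (simp only: ee_add) simp
    qed
    have "Ef (v + 1) w \<tau> = ee (of_real w / 2) *
        (ee ((of_real (v + 1))\<^sup>2 * \<tau> / 2) * ee (- (of_real v * \<tau> + of_real w) - \<tau> / 2)) *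
        theta (of_real v * \<tau> + of_real w) \<tau>"
      unfolding Ef_def a theta_add_tau[OF assms] by simp
    then show ?thesis unfolding b c Ef_def by simp
  qed
  show ?thesis
  proof (induction k rule: int_induct[where k = 0])
    case (step1 i)
    have "Ef (v + of_int (i + 1)) w \<tau> = ee (of_real (1 / 2 - w)) * Ef (v + of_int i) w \<tau>"
      using 1[of "v + of_int i"] by (simp add: add.assoc)
    then show ?case unfolding step1 mult.assoc[symmetric] ee_add[symmetric]
      by (simp add: algebra_simps add_divide_distrib)
  next
    case (step2 i)
    have "Ef (v + of_int i) w \<tau> = ee (of_real (1 / 2 - w)) * Ef (v + of_int (i - 1)) w \<tau>"
      using 1[of "v + of_int (i - 1)"] by (simp add: add.assoc)
    then have "Ef (v + of_int (i - 1)) w \<tau> = ee (- of_real (1 / 2 - w)) * (ee (of_real (of_int i / 2 - of_int i * w)) * Ef v w \<tau>)"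
      unfolding step2 by (simp add: ee_minus field_simps)
    then show ?case unfolding mult.assoc[symmetric] ee_add[symmetric]
      by (simp add: algebra_simps diff_divide_distrib)
  qed simp
qed

text \<open>Evenness in (v, w), with -v moved back into the unit interval. This is why a product
  over units modulo sign does not depend on the choice of signs.\<close>

lemma Ef_reflect:
  assumes "Im \<tau> > 0"
  shows "Ef (1 - v) (- w) \<tau> = Ef v w \<tau>"
proof -
  define z where "z = of_real v * \<tau> + of_real w"
  have a: "of_real (1 - v) * \<tau> + of_real (- w) = - z + \<tau>" by (simp add: z_def algebra_simps)
  have b: "ee (of_real (- w) / 2) * ee ((of_real (1 - v))\<^sup>2 * \<tau> / 2) * ee (- (- z) - \<tau> / 2) =
      ee (of_real w / 2) * ee ((of_real v)\<^sup>2 * \<tau> / 2)"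
    unfolding ee_add[symmetric] by (intro arg_cong[of _ _ ee]) (simp add: z_def field_simps power2_eq_square)
  have "Ef (1 - v) (- w) \<tau> = - (ee (of_real (- w) / 2) * ee ((of_real (1 - v))\<^sup>2 * \<tau> / 2) * ee (- (- z) - \<tau> / 2)) * theta z \<tau>"
    unfolding Ef_def a theta_add_tau[OF assms] theta_minus by simp
  then show ?thesis unfolding b unfolding Ef_def z_def by simp
qed

lemma theta_qp:
  assumes "Im \<tau> > 0"
  shows "theta z \<tau> = - ee (\<tau> / 12 - z / 2) * qp (ee z) (ee \<tau>) * qp (ee (\<tau> - z)) (ee \<tau>)"
proof -
  have 1: "qp (ee z) (ee \<tau>) = (1 - ee z) * qp (ee (\<tau> + z)) (ee \<tau>)"
    using qp_step[OF norm_ee_less_1[OF assms], of "ee z"] by (simp add: ee_add mult.commute)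
  have "ee (z / 2) - ee (- z / 2) = - ee (- z / 2) * (1 - ee z)"
  proof -
    have "ee (- z / 2) * ee z = ee (z / 2)" unfolding ee_add[symmetric] by simp
    then show ?thesis by (simp add: algebra_simps)
  qed
  then have "ee (\<tau> / 12) * (ee (z / 2) - ee (- z / 2)) = - (ee (\<tau> / 12) * ee (- z / 2)) * (1 - ee z)"
    by (simp add: mult.assoc)
  also have "ee (\<tau> / 12) * ee (- z / 2) = ee (\<tau> / 12 - z / 2)" unfolding ee_add[symmetric] by simp
  finally show ?thesis unfolding theta_def 1 by (simp add: mult_ac)
qed

lemma Ef_qp:
  assumes "Im \<tau> > 0"
  shows "Ef v w \<tau> = ee (of_real (B2 v / 2) * \<tau>) * qp (ee (of_real w) * ee (of_real v * \<tau>)) (ee \<tau>) *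
     qp (ee (- of_real w) * ee (of_real (1 - v) * \<tau>)) (ee \<tau>)"
proof -
  have "ee (of_real w / 2) * ee ((of_real v)\<^sup>2 * \<tau> / 2) * ee (\<tau> / 12 - (of_real v * \<tau> + of_real w) / 2) =
      ee (of_real (B2 v / 2) * \<tau>)"
    unfolding ee_add[symmetric] B2_def
    by (intro arg_cong[of _ _ ee]) (simp add: field_simps power2_eq_square)
  moreover have "ee (of_real v * \<tau> + of_real w) = ee (of_real w) * ee (of_real v * \<tau>)"
    "ee (\<tau> - (of_real v * \<tau> + of_real w)) = ee (- of_real w) * ee (of_real (1 - v) * \<tau>)"
    unfolding ee_add[symmetric] by (simp_all add: algebra_simps)
  note eqs = this
  have "Ef v w \<tau> = (ee (of_real w / 2) * ee ((of_real v)\<^sup>2 * \<tau> / 2) * ee (\<tau> / 12 - (of_real v * \<tau> + of_real w) / 2)) *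
     qp (ee (of_real v * \<tau> + of_real w)) (ee \<tau>) * qp (ee (\<tau> - (of_real v * \<tau> + of_real w))) (ee \<tau>)"
    unfolding Ef_def theta_qp[OF assms] by (simp add: mult_ac)
  with eqs show ?thesis by (simp only: calculation)
qed

lemma zeta_powi: "N > 0 \<Longrightarrow> zeta N powi h = ee (of_real (of_int h / of_nat N))"
proof -
  assume "N > 0"
  have "zeta N = ee (1 / of_nat N)" by (simp add: zeta_def ee_def)
  then show ?thesis by (simp add: ee_powi)
qed

lemma E_fun_eq_Ef:
  assumes "N > 0" "Im \<tau> > 0"
  shows "E_fun N g h \<tau> = Ef (of_int g / of_nat N) (of_int h / of_nat N) \<tau>"
proof -
  define v where "v = (of_int g / of_nat N :: real)"
  define w where "w = (of_int h / of_nat N :: real)"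
  have q: "norm (ee \<tau>) < 1" by (rule norm_ee_less_1[OF assms(2)])
  have z: "zeta N powi h = ee (of_real w)" "zeta N powi (- h) = ee (- of_real w)"
    using zeta_powi[OF assms(1), of h] zeta_powi[OF assms(1), of "- h"] by (simp_all add: w_def)
  have q1: "qpow \<tau> (real (Suc n) - 1 + v) = ee (of_real v * \<tau>) * ee \<tau> ^ n" for n
    unfolding qpow_ee ee_power ee_add[symmetric] by (simp add: algebra_simps)
  have q2: "qpow \<tau> (real (Suc n) - v) = ee (of_real (1 - v) * \<tau>) * ee \<tau> ^ n" for n
    unfolding qpow_ee ee_power ee_add[symmetric] by (simp add: algebra_simps)
  have "E_fun N g h \<tau> = qpow \<tau> (B2 v / 2) *
     (\<Prod>n. (1 - ee (of_real w) * (ee (of_real v * \<tau>) * ee \<tau> ^ n)) *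
          (1 - ee (- of_real w) * (ee (of_real (1 - v) * \<tau>) * ee \<tau> ^ n)))"
    unfolding E_fun_def v_def[symmetric] z q1 q2 by simp
  also have "\<dots> = Ef v w \<tau>"
    using prodinf_mult[OF qp_convergent[OF q] qp_convergent[OF q],
        of "ee (of_real w) * ee (of_real v * \<tau>)" "ee (- of_real w) * ee (of_real (1 - v) * \<tau>)"]
    unfolding Ef_qp[OF assms(2)] qp_def qpow_ee by (simp add: mult.assoc)
  finally show ?thesis unfolding v_def w_def .
qed

lemma Ef_nonzero:
  assumes "Im \<tau> > 0" "v \<notin> \<int> \<or> w \<notin> \<int>"
  shows "Ef v w \<tau> \<noteq> 0"
proof
  assume "Ef v w \<tau> = 0"
  then have "of_real v * \<tau> + of_real w \<in> lattice \<tau>"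
    using theta_eq_0_iff[OF assms(1)] by (simp add: Ef_def)
  then obtain m n :: int where mn: "of_real v * \<tau> + of_real w = of_int m + of_int n * \<tau>"
    unfolding lattice_def by blast
  have "v * Im \<tau> = of_int n * Im \<tau>" using arg_cong[OF mn, of Im] by simp
  then have v: "v = of_int n" using assms by simp
  have "w = of_int m" using arg_cong[OF mn, of Re] v by simp
  then show False using v assms by auto
qed

lemma Ef_moebius:
  assumes "a * d - b * c = 1" "Im \<tau> > 0"
    and V: "V = of_int a * v + of_int c * w" and W: "W = of_int b * v + of_int d * w"
  shows "Ef v w (moebius a b c d \<tau>) =
    ee (of_real (of_int (Phi a b c d) / 12 + (w - v * w - W + V * W) / 2)) * Ef V W \<tau>"
proof -
  have s: "siegel V W \<tau> = - ee (- of_real ((W - V * W) / 2)) * Ef V W \<tau>"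
    unfolding Ef_siegel by (simp add: ee_minus)
  have "Ef v w (moebius a b c d \<tau>) = - ee (of_real ((w - v * w) / 2)) *
      (ee (of_int (Phi a b c d) / 12) * siegel V W \<tau>)"
    unfolding Ef_siegel
    using siegel_moebius[OF assms(1), unfolded siegel_transforms_def, rule_format, OF assms(2), of v w]
    by (simp add: V W)
  also have "\<dots> = ee (of_real ((w - v * w) / 2)) * ee (of_int (Phi a b c d) / 12) *
      ee (- of_real ((W - V * W) / 2)) * Ef V W \<tau>" unfolding s by simp
  finally show ?thesis unfolding ee_add[symmetric]
    by (simp add: algebra_simps add_divide_distrib diff_divide_distrib)
qed

text \<open>With N = m n l, this is the matrix by which (a, b; N c, d) acts on m n \<tau>. It sends
  the characteristics to \<alpha>'/n + (t + 2 c i) and 2 d i/l + b m \<alpha>, whose integral parts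
  are then removed by \<open>Ef_add_left\<close> and \<open>Ef_add_right\<close>. The numerator 2 i
  is even so that no denominator 2 l occurs.\<close>

lemma Ef_Gamma0:
  fixes a b c d m n l \<alpha> \<alpha>' t i :: int
  assumes det: "a * d - b * (m * n * l * c) = 1" and pos: "n > 0" "l > 0" and \<tau>: "Im \<tau> > 0"
    and t: "a * \<alpha> = n * t + \<alpha>'"
  shows "Ef (of_int \<alpha> / of_int n) (of_int (2 * i) / of_int l) (moebius a (b * m * n) (c * l) d \<tau>) =
    ee (of_real (of_int (Phi a (b * m * n) (c * l) d) / 12
      + (of_int (a * b * m * \<alpha>\<^sup>2) / of_int n - of_int (b * m * \<alpha>) + of_int t) / 2
      + of_int (i * (1 - d) - 2 * c * d * i\<^sup>2 - 2 * t * d * i) / of_int l)) *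
    Ef (of_int \<alpha>' / of_int n) (of_int (2 * d * i) / of_int l) \<tau>"
proof -
  have det': "a * d - (b * m * n) * (c * l) = 1" using det by (simp add: algebra_simps)
  define V where "V = of_int a * (of_int \<alpha> / of_int n) + of_int (c * l) * (of_int (2 * i) / of_int l :: real)"
  define W where "W = of_int (b * m * n) * (of_int \<alpha> / of_int n) + of_int d * (of_int (2 * i) / of_int l :: real)"
  have V': "V = of_int \<alpha>' / of_int n + of_int (t + 2 * c * i)"
  proof -
    have "of_int a * of_int \<alpha> = (of_int n * of_int t + of_int \<alpha>' :: real)"
      using t by (metis of_int_add of_int_mult)
    then show ?thesis unfolding V_def using pos by (simp add: field_simps)
  qed
  have W': "W = of_int (2 * d * i) / of_int l + of_int (b * m * \<alpha>)"
    unfolding W_def using pos by (simp add: field_simps)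
  have 1: "Ef V W \<tau> = ee (of_real (of_int (t + 2 * c * i) / 2 - of_int (t + 2 * c * i) * (of_int (2 * d * i) / of_int l))) *
      Ef (of_int \<alpha>' / of_int n) (of_int (2 * d * i) / of_int l) \<tau>"
    unfolding W' Ef_add_right unfolding V' by (rule Ef_add_left[OF \<tau>])
  define w where "w = (of_int (2 * i) / of_int l :: real)"
  define v where "v = (of_int \<alpha> / of_int n :: real)"
  define X where "X = (of_int (Phi a (b * m * n) (c * l) d) / 12 + (w - v * w - W + V * W) / 2 :: real)"
  define Y where "Y = (of_int (t + 2 * c * i) / 2 - of_int (t + 2 * c * i) * (of_int (2 * d * i) / of_int l) :: real)"
  define Z where "Z = (of_int (Phi a (b * m * n) (c * l) d) / 12
      + (of_int (a * b * m * \<alpha>\<^sup>2) / of_int n - of_int (b * m * \<alpha>) + of_int t) / 2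
      + of_int (i * (1 - d) - 2 * c * d * i\<^sup>2 - 2 * t * d * i) / of_int l :: real)"
  have "Ef v w (moebius a (b * m * n) (c * l) d \<tau>) = ee (of_real X) * Ef V W \<tau>"
    unfolding X_def by (rule Ef_moebius[OF det' \<tau>]) (simp_all add: V_def W_def v_def w_def)
  also have "\<dots> = ee (of_real (X + Y)) * Ef (of_int \<alpha>' / of_int n) (of_int (2 * d * i) / of_int l) \<tau>"
    unfolding 1 Y_def[symmetric] by (simp add: ee_add)
  also have "ee (of_real (X + Y)) = ee (of_real Z)"
  proof (rule ee_cong)
    have adr: "of_int a * of_int d = (1 + of_int b * of_int m * of_int n * of_int l * of_int c :: real)"
    proof -
      have "a * d = 1 + b * m * n * l * c" using det by (simp add: algebra_simps)
      then show ?thesis by (metis of_int_1 of_int_add of_int_mult)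
    qed
    \<comment> \<open>The cross terms contain \<alpha> i (a d - 1)/(n l), which is integral because
      a d - 1 = b m n l c. Only the class of the exponent modulo 1 matters.\<close>
    have "X + Y - Z = of_int (2 * b * c * m * \<alpha> * i + c * i)"
    proof -
      define A where "A = (of_int \<alpha> :: real)" define I where "I = (of_int i :: real)"
      define n' where "n' = (of_int n :: real)" define l' where "l' = (of_int l :: real)"
      define a' where "a' = (of_int a :: real)" define b' where "b' = (of_int b :: real)"
      define c' where "c' = (of_int c :: real)" define d' where "d' = (of_int d :: real)"
      define m' where "m' = (of_int m :: real)" define t' where "t' = (of_int t :: real)"
      note fold = A_def[symmetric] I_def[symmetric] n'_def[symmetric] l'_def[symmetric] a'_def[symmetric]
        b'_def[symmetric] c'_def[symmetric] d'_def[symmetric] m'_def[symmetric] t'_def[symmetric]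
      have nz: "n' \<noteq> 0" "l' \<noteq> 0" using pos by (simp_all add: n'_def l'_def)
      have V2: "V = a' * A / n' + 2 * c' * I" unfolding V_def of_int_mult fold of_int_numeral using nz by simp
      have W2: "W = b' * m' * A + 2 * d' * I / l'" unfolding W_def of_int_mult fold of_int_numeral using nz by simp
      have "X + Y - Z = (2 * I / l' - A / n' * (2 * I / l') - W + V * W) / 2 + (t' + 2 * c' * I) / 2
          - (t' + 2 * c' * I) * (2 * d' * I / l') - (a' * b' * m' * A\<^sup>2 / n' - b' * m' * A + t') / 2
          - (I * (1 - d') - 2 * c' * d' * I\<^sup>2 - 2 * t' * d' * I) / l'"
        unfolding X_def Y_def Z_def v_def w_def of_int_mult of_int_add of_int_diff of_int_power of_int_numeral of_int_1 fold
        by simp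
      also have "\<dots> = A * I * (a' * d' - 1) / (n' * l') + b' * m' * c' * A * I + c' * I"
        unfolding V2 W2 using nz by (simp add: field_simps power2_eq_square)
      also have "a' * d' - 1 = b' * m' * n' * l' * c'"
        using adr unfolding fold by simp
      also have "A * I * (b' * m' * n' * l' * c') / (n' * l') + b' * m' * c' * A * I + c' * I =
         2 * b' * c' * m' * A * I + c' * I"
        using nz by (simp add: field_simps)
      finally show ?thesis unfolding of_int_mult of_int_add of_int_numeral fold .
    qed
    then show "complex_of_real (X + Y) - of_real Z \<in> \<int>"
      by (metis Ints_of_int of_real_diff of_real_of_int_eq)
  qed
  finally show ?thesis unfolding v_def w_def Z_def .
qed

section \<open>Expansions at cusps\<close>

text \<open>A power of q times a zero-free holomorphic function of q^(1/M) on the whole disc. Being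
  zero-free everywhere makes the class closed under inverses, hence under integral powers of either
  sign; A is the order in terms of q.\<close>

definition nice :: "real \<Rightarrow> (complex \<Rightarrow> complex) \<Rightarrow> bool" where
  "nice A g \<longleftrightarrow> (\<exists>M>0. \<exists>H. H holomorphic_on ball 0 1 \<and> (\<forall>z\<in>ball 0 1. H z \<noteq> 0) \<and>
     (\<forall>\<tau>. Im \<tau> > 0 \<longrightarrow> g \<tau> = ee (of_real A * \<tau>) * H (ee (\<tau> / of_nat (M::nat)))))"

lemma niceE':
  assumes "nice A g"
  obtains M H where "M > 0" "H holomorphic_on ball 0 1" "\<And>z. norm z < 1 \<Longrightarrow> H z \<noteq> 0"
    "\<And>\<tau>. Im \<tau> > 0 \<Longrightarrow> g \<tau> = ee (of_real A * \<tau>) * H (ee (\<tau> / of_nat (M::nat)))"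
  using assms unfolding nice_def by (auto intro: that)

lemma holomorphic_ball_compose:
  assumes "H holomorphic_on ball 0 1" "g holomorphic_on ball 0 1" "\<And>z. norm z < 1 \<Longrightarrow> norm (g z) < 1"
  shows "(\<lambda>z. H (g z)) holomorphic_on ball 0 (1::real)"
  by (rule holomorphic_on_compose_gen[OF assms(2,1), unfolded o_def]) (use assms(3) in auto)

text \<open>M may be replaced by any of its multiples. This yields a common denominator for
  products, and later one divisible by a given period.\<close>

lemma niceE:
  assumes "nice A g" "K > 0"
  obtains M H where "M > 0" "K dvd M" "H holomorphic_on ball 0 1" "\<And>z. norm z < 1 \<Longrightarrow> H z \<noteq> 0"
    "\<And>\<tau>. Im \<tau> > 0 \<Longrightarrow> g \<tau> = ee (of_real A * \<tau>) * H (ee (\<tau> / of_nat (M::nat)))"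
proof -
  from assms(1) obtain M H where M: "M > 0" and H: "H holomorphic_on ball 0 1" "\<And>z. norm z < 1 \<Longrightarrow> H z \<noteq> 0"
    and g: "\<And>\<tau>. Im \<tau> > 0 \<Longrightarrow> g \<tau> = ee (of_real A * \<tau>) * H (ee (\<tau> / of_nat (M::nat)))"
    by (rule niceE') (rule that)
  have small: "norm (z ^ K) < 1" if "norm z < 1" for z :: complex
    using that assms(2) by (simp add: norm_power power_less_one_iff)
  show ?thesis
  proof (rule that[of "M * K" "\<lambda>z. H (z ^ K)"])
    show "M * K > 0" "K dvd M * K" using M assms(2) by auto
    show "(\<lambda>z. H (z ^ K)) holomorphic_on ball 0 1"
      by (intro holomorphic_ball_compose[OF H(1)] holomorphic_intros small)
    show "H (z ^ K) \<noteq> 0" if "norm z < 1" for z using H(2) small[OF that] by blast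
    have "ee (\<tau> / of_nat (M * K)) ^ K = ee (\<tau> / of_nat M)" for \<tau>
      using assms(2) by (simp add: ee_power)
    then show "g \<tau> = ee (of_real A * \<tau>) * H (ee (\<tau> / of_nat (M * K)) ^ K)" if "Im \<tau> > 0" for \<tau>
      using g[OF that] by simp
  qed
qed

lemma niceI:
  assumes "M > 0" "H holomorphic_on ball 0 1" "\<And>z. norm z < 1 \<Longrightarrow> H z \<noteq> 0"
    "\<And>\<tau>. Im \<tau> > 0 \<Longrightarrow> g \<tau> = ee (of_real A * \<tau>) * H (ee (\<tau> / of_nat (M::nat)))"
  shows "nice A g"
  unfolding nice_def using assms by (auto intro!: exI[of _ M] exI[of _ H])

lemma nice_cong: "nice A g \<Longrightarrow> (\<And>\<tau>. Im \<tau> > 0 \<Longrightarrow> f \<tau> = g \<tau>) \<Longrightarrow> nice A f"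
  unfolding nice_def by metis

lemma nice_const: "c \<noteq> 0 \<Longrightarrow> nice 0 (\<lambda>_. c)"
  by (rule niceI[of 1 "\<lambda>_. c"]) auto

lemma nice_mult:
  assumes f: "nice A f" and g: "nice B g"
  shows "nice (A + B) (\<lambda>\<tau>. f \<tau> * g \<tau>)"
proof -
  obtain M H where 1: "M > 0" "H holomorphic_on ball 0 1" "\<And>z. norm z < 1 \<Longrightarrow> H z \<noteq> 0"
    "\<And>\<tau>. Im \<tau> > 0 \<Longrightarrow> f \<tau> = ee (of_real A * \<tau>) * H (ee (\<tau> / of_nat M))"
    by (rule niceE'[OF f]) (rule that)
  obtain M' H' where 2: "M' > 0" "M dvd M'" "H' holomorphic_on ball 0 1" "\<And>z. norm z < 1 \<Longrightarrow> H' z \<noteq> 0"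
    "\<And>\<tau>. Im \<tau> > 0 \<Longrightarrow> g \<tau> = ee (of_real B * \<tau>) * H' (ee (\<tau> / of_nat M'))"
    by (rule niceE[OF g 1(1)]) (rule that)
  obtain k where k: "M' = M * k" using 2(2) by auto
  then have k0: "k > 0" using 2(1) by simp
  have small: "norm (z ^ k) < 1" if "norm z < 1" for z :: complex
    using that k0 by (simp add: norm_power power_less_one_iff)
  show ?thesis
  proof (rule niceI[OF 2(1)])
    show "(\<lambda>z. H (z ^ k) * H' z) holomorphic_on ball 0 1"
      by (intro holomorphic_ball_compose[OF 1(2)] holomorphic_intros small 2(3))
    show "H (z ^ k) * H' z \<noteq> 0" if "norm z < 1" for z using 1(3) 2(4) small that by simp
    have "ee (\<tau> / of_nat M') ^ k = ee (\<tau> / of_nat M)" for \<tau>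
      using k0 by (simp add: ee_power k)
    then show "f \<tau> * g \<tau> = ee (of_real (A + B) * \<tau>) * (H (ee (\<tau> / of_nat M') ^ k) * H' (ee (\<tau> / of_nat M')))"
      if "Im \<tau> > 0" for \<tau>
      using 1(4)[OF that] 2(5)[OF that] by (simp add: algebra_simps ee_add)
  qed
qed

lemma nice_inverse:
  assumes "nice A f"
  shows "nice (- A) (\<lambda>\<tau>. inverse (f \<tau>))"
proof -
  obtain M H where 1: "M > 0" "H holomorphic_on ball 0 1" "\<And>z. norm z < 1 \<Longrightarrow> H z \<noteq> 0"
    "\<And>\<tau>. Im \<tau> > 0 \<Longrightarrow> f \<tau> = ee (of_real A * \<tau>) * H (ee (\<tau> / of_nat M))"
    by (rule niceE'[OF assms]) (rule that)
  show ?thesis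
    by (rule niceI[OF 1(1), of "\<lambda>z. inverse (H z)"]) (use 1 in \<open>auto intro!: holomorphic_intros simp: ee_minus\<close>)
qed

lemma nice_power: "nice A f \<Longrightarrow> nice (of_nat n * A) (\<lambda>\<tau>. f \<tau> ^ n)"
proof (induction n)
  case 0 then show ?case using nice_const[of 1] by simp
next
  case (Suc n) then show ?case using nice_mult[of A f "of_nat n * A" "\<lambda>\<tau>. f \<tau> ^ n"] by (simp add: algebra_simps)
qed

lemma nice_powi:
  assumes "nice A f"
  shows "nice (of_int k * A) (\<lambda>\<tau>. f \<tau> powi k)"
proof (cases "k \<ge> 0")
  case True
  then show ?thesis using nice_power[OF assms, of "nat k"] by (simp add: power_int_def)
next
  case False
  then show ?thesis using nice_power[OF nice_inverse[OF assms], of "nat (- k)"] by (simp add: power_int_def)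
qed

lemma nice_prod:
  assumes "finite I" "\<And>i. i \<in> I \<Longrightarrow> nice (A i) (f i)"
  shows "nice (\<Sum>i\<in>I. A i) (\<lambda>\<tau>. \<Prod>i\<in>I. f i \<tau>)"
  using assms by (induction I rule: finite_induct) (auto intro: nice_mult nice_const)

lemma nice_affine:
  assumes f: "nice A f" and a: "a > 0" and d: "d > 0"
  shows "nice (A * of_nat a / of_nat d) (\<lambda>\<tau>. f ((of_nat a * \<tau> + of_real b) / of_nat d))"
proof -
  obtain M H where 1: "M > 0" "H holomorphic_on ball 0 1" "\<And>z. norm z < 1 \<Longrightarrow> H z \<noteq> 0"
    "\<And>\<tau>. Im \<tau> > 0 \<Longrightarrow> f \<tau> = ee (of_real A * \<tau>) * H (ee (\<tau> / of_nat M))"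
    by (rule niceE'[OF f]) (rule that)
  define u where "u = ee (of_real (b / (d * M)))"
  have u: "norm u = 1" by (simp add: u_def norm_ee)
  have small: "norm (u * z ^ a) < 1" if "norm z < 1" for z
    using that a by (simp add: norm_mult u norm_power power_less_one_iff)
  show ?thesis
  proof (rule niceI[of "d * M"])
    show "d * M > 0" using d 1 by simp
    show "(\<lambda>z. ee (of_real (A * b / d)) * H (u * z ^ a)) holomorphic_on ball 0 1"
      by (intro holomorphic_ball_compose[OF 1(2)] holomorphic_intros small)
    show "ee (of_real (A * b / d)) * H (u * z ^ a) \<noteq> 0" if "norm z < 1" for z using 1(3) small[OF that] by simp
    show "f ((of_nat a * \<tau> + of_real b) / of_nat d) =
       ee (of_real (A * of_nat a / of_nat d) * \<tau>) * (ee (of_real (A * b / d)) * H (u * ee (\<tau> / of_nat (d * M)) ^ a))"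
      if "Im \<tau> > 0" for \<tau>
    proof -
      let ?t = "(of_nat a * \<tau> + of_real b) / of_nat d"
      have "Im ?t > 0" using that a d by simp
      moreover have "ee (of_real A * ?t) = ee (of_real (A * of_nat a / of_nat d) * \<tau>) * ee (of_real (A * b / d))"
        unfolding ee_add[symmetric] by (intro arg_cong[of _ _ ee]) (simp add: field_simps add_divide_distrib)
      moreover have "ee (?t / of_nat M) = u * ee (\<tau> / of_nat (d * M)) ^ a"
        unfolding u_def ee_power ee_add[symmetric] using d 1(1) by (intro arg_cong[of _ _ ee]) (simp add: field_simps)
      ultimately show ?thesis using 1(4)[of ?t] by simp
    qed
  qed
qed

lemma nice_shift: "nice A f \<Longrightarrow> nice A (\<lambda>\<tau>. f (\<tau> + of_real b))"
  using nice_affine[of A f 1 1 b] by simp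

lemma nice_nonzero: "nice A f \<Longrightarrow> Im \<tau> > 0 \<Longrightarrow> f \<tau> \<noteq> 0"
proof -
  assume f: "nice A f" and t: "Im \<tau> > 0"
  obtain M H where 1: "M > 0" "H holomorphic_on ball 0 1" "\<And>z. norm z < 1 \<Longrightarrow> H z \<noteq> 0"
    "\<And>\<tau>. Im \<tau> > 0 \<Longrightarrow> f \<tau> = ee (of_real A * \<tau>) * H (ee (\<tau> / of_nat M))"
    by (rule niceE'[OF f]) (rule that)
  show "f \<tau> \<noteq> 0" using 1(4)[OF t] 1(3)[of "ee (\<tau> / of_nat M)"] 1(1) t norm_ee_less_1[of "\<tau> / of_nat M"] by simp
qed

lemma nice_holomorphic:
  assumes f: "nice A f"
  shows "f holomorphic_on uhp"
proof -
  obtain M H where 1: "M > 0" "H holomorphic_on ball 0 1" "\<And>z. norm z < 1 \<Longrightarrow> H z \<noteq> 0"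
    "\<And>\<tau>. Im \<tau> > 0 \<Longrightarrow> f \<tau> = ee (of_real A * \<tau>) * H (ee (\<tau> / of_nat M))"
    by (rule niceE'[OF f]) (rule that)
  have "(\<lambda>\<tau>. ee (of_real A * \<tau>) * H (ee (\<tau> / of_nat M))) holomorphic_on uhp"
    by (intro holomorphic_intros holomorphic_on_compose_gen[OF _ 1(2), unfolded o_def])
       (use 1(1) in \<open>auto simp: norm_ee_less_1\<close>)
  then show ?thesis using 1(4) by (subst holomorphic_cong[OF refl]) auto
qed

text \<open>Made for m'' = 2, where only the square is a product of the functions \<open>Ef\<close>.
  The disc is contractible, so H has a holomorphic square root; the quotient of g by the resulting
  function takes only the values 1 and -1 and is therefore constant.\<close>

lemma nice_sqrt:
  assumes g: "nice A (\<lambda>\<tau>. (g \<tau>)\<^sup>2)" and hol: "g holomorphic_on uhp"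
  shows "nice (A / 2) g"
proof -
  obtain M H where 1: "M > 0" "H holomorphic_on ball 0 1" "\<And>z. norm z < 1 \<Longrightarrow> H z \<noteq> 0"
    "\<And>\<tau>. Im \<tau> > 0 \<Longrightarrow> (g \<tau>)\<^sup>2 = ee (of_real A * \<tau>) * H (ee (\<tau> / of_nat M))"
    by (rule niceE'[OF g]) (rule that)
  have "contractible (ball (0::complex) 1)" by (simp add: convex_imp_contractible)
  from contractible_imp_holomorphic_sqrt[OF 1(2) this] 1(3)
  obtain k where k: "k holomorphic_on ball 0 1" "\<And>z. norm z < 1 \<Longrightarrow> H z = (k z)\<^sup>2"
    by (metis dist_0_norm mem_ball)
  have k0: "k z \<noteq> 0" if "norm z < 1" for z using 1(3)[OF that] k(2)[OF that] by auto
  define r where "r = (\<lambda>\<tau>. ee (of_real (A / 2) * \<tau>) * k (ee (\<tau> / of_nat M)))"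
  have nr: "nice (A / 2) r" unfolding r_def by (rule niceI[OF 1(1) k(1) k0]) auto
  have sq: "(r \<tau>)\<^sup>2 = (g \<tau>)\<^sup>2" if "Im \<tau> > 0" for \<tau>
    using 1(4)[OF that] k(2)[of "ee (\<tau> / of_nat M)"] norm_ee_less_1[of "\<tau> / of_nat M"] that 1(1)
    by (simp add: r_def power_mult_distrib ee_power)
  have "(\<lambda>\<tau>. g \<tau> / r \<tau>) holomorphic_on uhp"
    using nice_nonzero[OF nr] nice_holomorphic[OF nr] hol by (intro holomorphic_intros) auto
  moreover have "finite ((\<lambda>\<tau>. g \<tau> / r \<tau>) ` uhp)"
  proof (rule finite_subset)
    show "(\<lambda>\<tau>. g \<tau> / r \<tau>) ` uhp \<subseteq> {1, -1}"
    proof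
      fix y assume "y \<in> (\<lambda>\<tau>. g \<tau> / r \<tau>) ` uhp"
      then obtain \<tau> where \<tau>: "Im \<tau> > 0" "y = g \<tau> / r \<tau>" by blast
      have "y\<^sup>2 = 1" unfolding \<tau>(2) power_divide sq[OF \<tau>(1), symmetric]
        using nice_nonzero[OF nr \<tau>(1)] by simp
      then show "y \<in> {1, -1}" by (simp add: power2_eq_1_iff)
    qed
  qed auto
  ultimately obtain s where s: "\<And>t. Im t > 0 \<Longrightarrow> g t / r t = s"
    using continuous_finite_range_constant[OF connected_uhp holomorphic_on_imp_continuous_on]
    by (auto simp: constant_on_def)
  have "s \<noteq> 0" using s[of \<i>] sq[of \<i>] nice_nonzero[OF nr, of \<i>] by auto
  then have "nice (0 + A / 2) (\<lambda>\<tau>. s * r \<tau>)" by (intro nice_mult nice_const nr)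
  then show ?thesis
    by (simp only: add_0) (erule nice_cong, use s nice_nonzero[OF nr] in \<open>auto simp: field_simps\<close>)
qed

section \<open>Leading powers, multipliers of translations, and meromorphy at a cusp\<close>

lemma ball_ee_cases:
  assumes "z \<noteq> 0" "norm z < 1" "M > 0"
  obtains \<tau> where "Im \<tau> > 0" "z = ee (\<tau> / of_nat M)"
proof -
  define \<tau> where "\<tau> = of_nat M * Ln z / (2 * of_real pi * \<i>)"
  have "2 * complex_of_real pi * \<i> * (\<tau> / of_nat M) = Ln z"
    using assms(3) by (simp add: \<tau>_def field_simps)
  then have 1: "z = ee (\<tau> / of_nat M)" using assms(1) by (simp add: ee_def)
  have "exp (- 2 * pi * Im (\<tau> / of_nat M)) < exp 0" using assms(2) unfolding 1 norm_ee by simp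
  then have "0 < 2 * pi * Im \<tau> / real M" by simp
  then have "Im \<tau> > 0" using assms(3) by (metis divide_less_cancel div_0 mult_pos_pos of_nat_0_less_iff pi_gt_zero zero_less_mult_pos zero_less_numeral)
  then show ?thesis using that 1 by blast
qed

lemma holomorphic_ball_eqI_at_0:
  assumes "F holomorphic_on ball 0 1" "G holomorphic_on ball 0 1"
    and eq: "\<And>z. z \<noteq> 0 \<Longrightarrow> norm z < 1 \<Longrightarrow> F z = G z"
  shows "F 0 = (G 0 :: complex)"
proof -
  have F: "(F \<longlongrightarrow> F 0) (at 0)" and G: "(G \<longlongrightarrow> G 0) (at 0)"
    using assms(1,2)[THEN holomorphic_on_imp_continuous_on]
    by (auto simp: continuous_on_eq_continuous_at isCont_def)
  have "eventually (\<lambda>z. F z = G z) (at 0)"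
    unfolding eventually_at using eq by (auto intro!: exI[of _ 1])
  then have "(G \<longlongrightarrow> F 0) (at 0)" using F by (rule Lim_transform_eventually[rotated])
  from tendsto_unique[OF _ this G] show ?thesis by simp
qed

text \<open>Dividing by q^A and letting the local parameter tend to 0 compares leading coefficients.
  The passages between integrality of an order at a cusp and triviality of a multiplier all go
  through this lemma.\<close>

lemma nice_multiplier:
  assumes f: "nice A f" and shift: "\<And>\<tau>. Im \<tau> > 0 \<Longrightarrow> f (\<tau> + of_real w) = \<kappa> * f \<tau>"
  shows "ee (of_real (A * w)) = \<kappa>"
proof -
  obtain M H where 1: "M > 0" "H holomorphic_on ball 0 1" "\<And>z. norm z < 1 \<Longrightarrow> H z \<noteq> 0"
    "\<And>\<tau>. Im \<tau> > 0 \<Longrightarrow> f \<tau> = ee (of_real A * \<tau>) * H (ee (\<tau> / of_nat M))"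
    by (rule niceE'[OF f]) (rule that)
  define u where "u = ee (of_real (w / M))"
  have u: "norm u = 1" by (simp add: u_def norm_ee)
  have "ee (of_real (A * w)) * H (u * 0) = \<kappa> * H 0"
  proof (rule holomorphic_ball_eqI_at_0[of "\<lambda>z. ee (of_real (A * w)) * H (u * z)" "\<lambda>z. \<kappa> * H z"])
    show "(\<lambda>z. ee (of_real (A * w)) * H (u * z)) holomorphic_on ball 0 1"
      by (intro holomorphic_ball_compose[OF 1(2)] holomorphic_intros) (simp add: norm_mult u)
    show "(\<lambda>z. \<kappa> * H z) holomorphic_on ball 0 1" using 1(2) by (intro holomorphic_intros)
    fix z :: complex assume "z \<noteq> 0" "norm z < 1"
    then obtain \<tau> where \<tau>: "Im \<tau> > 0" "z = ee (\<tau> / of_nat M)" using ball_ee_cases 1(1) by blast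
    have "f (\<tau> + of_real w) = ee (of_real A * \<tau>) * (ee (of_real (A * w)) * H (u * z))"
      using 1(4)[of "\<tau> + of_real w"] \<tau> unfolding \<tau>(2) u_def
      by (simp add: algebra_simps ee_add add_divide_distrib)
    moreover have "f (\<tau> + of_real w) = ee (of_real A * \<tau>) * (\<kappa> * H z)"
      using shift[OF \<tau>(1)] 1(4)[OF \<tau>(1)] \<tau>(2) by simp
    ultimately show "ee (of_real (A * w)) * H (u * z) = \<kappa> * H z" by simp
  qed
  then show ?thesis using 1(3)[of 0] by simp
qed

lemma nice_leading_power:
  assumes f: "nice A f"
  shows "has_leading_power f A"
proof -
  obtain M H where 1: "M > 0" "H holomorphic_on ball 0 1" "\<And>z. norm z < 1 \<Longrightarrow> H z \<noteq> 0"
    "\<And>\<tau>. Im \<tau> > 0 \<Longrightarrow> f \<tau> = ee (of_real A * \<tau>) * H (ee (\<tau> / of_nat M))"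
    by (rule niceE'[OF f]) (rule that)
  define c where "c = (\<lambda>n. (deriv ^^ n) H 0 / fact n)"
  have "(\<lambda>n. c n * qpow \<tau> (A + real n / real M)) sums f \<tau>" if "Im \<tau> > 0" for \<tau>
  proof -
    have "norm (ee (\<tau> / of_nat M)) < 1" using that 1(1) by (intro norm_ee_less_1) simp
    then have "(\<lambda>n. c n * ee (\<tau> / of_nat M) ^ n) sums H (ee (\<tau> / of_nat M))"
      using holomorphic_power_series[OF 1(2), of "ee (\<tau> / of_nat M)"] by (simp add: c_def)
    then have "(\<lambda>n. ee (of_real A * \<tau>) * (c n * ee (\<tau> / of_nat M) ^ n)) sums f \<tau>"
      unfolding 1(4)[OF that] by (rule sums_mult)
    moreover have "ee (of_real A * \<tau>) * (c n * ee (\<tau> / of_nat M) ^ n) = c n * qpow \<tau> (A + real n / real M)" for n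
      unfolding qpow_ee ee_power by (simp add: ring_distribs ee_add)
    ultimately show ?thesis by simp
  qed
  moreover have "c 0 \<noteq> 0" using 1(3)[of 0] by (simp add: c_def)
  ultimately show ?thesis unfolding has_leading_power_def using 1(1) by blast
qed

lemma tendsto_ee_0:
  assumes "k > 0"
  shows "((\<lambda>t. ee (of_real k * (\<i> * of_real t))) \<longlongrightarrow> 0) at_top"
proof (rule tendsto_norm_zero_cancel)
  have n: "norm (ee (of_real k * (\<i> * of_real t))) = exp (- (2 * pi * (k * t)))" for t
    by (simp add: norm_ee)
  show "((\<lambda>t. norm (ee (of_real k * (\<i> * of_real t)))) \<longlongrightarrow> 0) at_top"
    unfolding n using assms by real_asymp
qed

lemma leading_power_limit:
  assumes "has_leading_power f A"
  obtains c0 where "c0 \<noteq> 0" "((\<lambda>t. f (\<i> * of_real t) * ee (- (of_real A * (\<i> * of_real t)))) \<longlongrightarrow> c0) at_top"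
proof -
  from assms obtain M c where M: "M > (0::nat)" and c: "c 0 \<noteq> 0"
    "\<And>\<tau>. Im \<tau> > 0 \<Longrightarrow> (\<lambda>n. c n * qpow \<tau> (A + real n / real M)) sums f \<tau>"
    unfolding has_leading_power_def by blast
  define P where "P = (\<lambda>z. \<Sum>n. c n * z ^ n)"
  have eq: "(\<lambda>n. c n * ee (\<tau> / of_nat M) ^ n) sums (f \<tau> * ee (- (of_real A * \<tau>)))" if "Im \<tau> > 0" for \<tau>
  proof -
    have "(\<lambda>n. c n * qpow \<tau> (A + real n / real M) * ee (- (of_real A * \<tau>))) sums (f \<tau> * ee (- (of_real A * \<tau>)))"
      by (intro sums_mult2 c that)
    moreover have "c n * qpow \<tau> (A + real n / real M) * ee (- (of_real A * \<tau>)) = c n * ee (\<tau> / of_nat M) ^ n" for n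
      unfolding qpow_ee ee_power mult.assoc ee_add[symmetric] by (simp add: algebra_simps)
    ultimately show ?thesis by simp
  qed
  have "(\<lambda>n. c n * z ^ n) sums P z" if z: "z \<noteq> 0" "norm z < 1" for z
  proof -
    obtain \<tau> where "Im \<tau> > 0" "z = ee (\<tau> / of_nat M)" using ball_ee_cases[OF z M] by blast
    then show ?thesis using eq[of \<tau>] unfolding P_def by (metis sums_unique)
  qed
  then have lim: "(P \<longlongrightarrow> c 0) (at 0)" by (intro powser_limit_0_strong[of 1]) auto
  have L: "((\<lambda>t. P (ee (\<i> * of_real t / of_nat M))) \<longlongrightarrow> c 0) at_top"
  proof (rule filterlim_compose[OF lim])
    have "((\<lambda>t. ee (\<i> * of_real t / of_nat M)) \<longlongrightarrow> 0) at_top"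
      using tendsto_ee_0[of "1 / M"] M by simp
    then show "filterlim (\<lambda>t. ee (\<i> * complex_of_real t / of_nat M)) (at 0) at_top"
      by (intro filterlim_atI) auto
  qed
  have E: "eventually (\<lambda>t. P (ee (\<i> * of_real t / of_nat M)) =
      f (\<i> * of_real t) * ee (- (of_real A * (\<i> * of_real t)))) at_top"
    using eventually_gt_at_top[of 0]
  proof eventually_elim
    case (elim t)
    then show ?case unfolding P_def using eq[of "\<i> * of_real t"] by (simp add: sums_iff)
  qed
  show ?thesis by (rule that[OF c(1) Lim_transform_eventually[OF L E]])
qed

text \<open>Along the imaginary axis f divided by q^A and f divided by q^B would both have nonzero
  limits, although their ratio is a power of q tending to 0. This makes the definite description in
  \<open>cusp_order\<close> meaningful.\<close>

lemma leading_power_unique: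
  assumes "has_leading_power f A" "has_leading_power f B"
  shows "A = B"
proof -
  have "\<not> A < B" if f: "has_leading_power f A" "has_leading_power f B" for A B
  proof
    assume less: "A < B"
    obtain x where x: "x \<noteq> 0" "((\<lambda>t. f (\<i> * of_real t) * ee (- (of_real A * (\<i> * of_real t)))) \<longlongrightarrow> x) at_top"
      using leading_power_limit[OF f(1)] by blast
    obtain y where y: "y \<noteq> 0" "((\<lambda>t. f (\<i> * of_real t) * ee (- (of_real B * (\<i> * of_real t)))) \<longlongrightarrow> y) at_top"
      using leading_power_limit[OF f(2)] by blast
    define k where "k = B - A"
    have "k > 0" using less by (simp add: k_def)
    then have "((\<lambda>t. ee (of_real k * (\<i> * of_real t))) \<longlongrightarrow> 0) at_top" by (rule tendsto_ee_0)
    from tendsto_mult[OF y(2) this]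
    have "((\<lambda>t. f (\<i> * of_real t) * ee (- (of_real A * (\<i> * of_real t)))) \<longlongrightarrow> 0) at_top"
      unfolding mult.assoc ee_add[symmetric] by (simp add: k_def algebra_simps)
    then show False using x tendsto_unique[OF _ x(2)] by auto
  qed
  then show ?thesis using assms by (metis linorder_neqE_linordered_idom)
qed

text \<open>Periodicity makes A N an integer, and then H is invariant under multiplication of its
  argument by u, a root of unity of order K = M/N. So only exponents divisible by K occur in H, and
  a series in the K-th power of q^(1/M) is a series in q^(1/N).\<close>

lemma nice_periodic:
  assumes f: "nice A f" and N: "N > 0" and per: "\<And>\<tau>. Im \<tau> > 0 \<Longrightarrow> f (\<tau> + of_nat N) = f \<tau>"
  shows "\<exists>G. G meromorphic_on {0} \<and> (\<forall>\<tau>. Im \<tau> > 0 \<longrightarrow> f \<tau> = G (qpow \<tau> (1 / real N)))"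
proof -
  obtain M H where 1: "M > 0" "N dvd M" "H holomorphic_on ball 0 1" "\<And>z. norm z < 1 \<Longrightarrow> H z \<noteq> 0"
    "\<And>\<tau>. Im \<tau> > 0 \<Longrightarrow> f \<tau> = ee (of_real A * \<tau>) * H (ee (\<tau> / of_nat M))"
    by (rule niceE[OF f N]) (rule that)
  have "ee (of_real (A * real N)) = 1"
    by (rule nice_multiplier[OF f]) (use per in simp)
  then obtain k :: int where "of_real (A * real N) = (of_int k :: complex)"
    unfolding ee_eq_1_iff by (auto simp: Ints_def)
  then have k: "A * real N = of_int k" by (metis of_real_eq_iff of_real_of_int_eq)
  then have A: "A = of_int k / real N" using N by (simp add: field_simps)
  obtain K where K: "M = N * K" using 1(2) by auto
  have K0: "K > 0" using 1(1) K by simp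
  define u where "u = ee (1 / of_nat K)"
  have u: "norm u = 1" by (simp add: u_def norm_ee)
  have eA: "ee (of_real A * \<tau>) = ee (\<tau> / of_nat N) powi k" for \<tau>
    unfolding ee_powi A by simp
  have Hu': "H (u * z) = H z" if z: "z \<noteq> 0" "norm z < 1" for z
  proof -
    obtain \<tau> where \<tau>: "Im \<tau> > 0" "z = ee (\<tau> / of_nat M)" using ball_ee_cases[OF z 1(1)] by blast
    have "ee ((\<tau> + of_nat N) / of_nat M) = u * z"
      unfolding \<tau>(2) u_def ee_add[symmetric] using N K0 by (simp add: K field_simps)
    moreover have "ee (of_real A * (\<tau> + of_nat N)) = ee (of_real A * \<tau>)"
    proof (rule ee_cong)
      have "of_real A * of_nat N = (of_int k :: complex)"
        using arg_cong[OF k, of complex_of_real] by simp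
      then show "of_real A * (\<tau> + of_nat N) - of_real A * \<tau> \<in> \<int>" by (simp add: ring_distribs)
    qed
    ultimately show ?thesis
      using per[OF \<tau>(1)] 1(5)[OF \<tau>(1)] 1(5)[of "\<tau> + of_nat N"] \<tau> by simp
  qed
  then have Hu: "H (u * z) = H z" if z: "norm z < 1" for z
    using that by (cases "z = 0") auto
  define c where "c = (\<lambda>n. (deriv ^^ n) H 0 / fact n)"
  have cz: "c n = 0" if "\<not> K dvd n" for n
  proof -
    have "(deriv ^^ n) (\<lambda>z. H (u * z)) 0 = u ^ n * (deriv ^^ n) H (u * 0)"
      by (rule higher_deriv_compose_linear[OF 1(3), of "ball 0 1"]) (auto simp: norm_mult u)
    moreover have "(deriv ^^ n) (\<lambda>z. H (u * z)) 0 = (deriv ^^ n) H 0"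
      by (rule higher_deriv_cong_ev) (auto simp: eventually_nhds intro!: exI[of _ "ball 0 1"] Hu)
    ultimately have "(u ^ n - 1) * (deriv ^^ n) H 0 = 0" by (simp add: algebra_simps)
    moreover have "u ^ n \<noteq> 1"
    proof
      assume "u ^ n = 1"
      then have "(of_nat n / of_nat K :: complex) \<in> \<int>" by (simp add: u_def ee_power ee_eq_1_iff)
      then obtain j :: int where "(of_nat n / of_nat K :: complex) = of_int j" by (auto simp: Ints_def)
      then have "(of_int (int n) :: complex) = of_int (j * int K)" using K0 by (simp add: field_simps)
      then have "int n = j * int K" by (simp only: of_int_eq_iff)
      then have "int K dvd int n" by simp
      then show False using that by simp
    qed
    ultimately show ?thesis by (simp add: c_def)
  qed
  define G where "G = (\<lambda>w. \<Sum>n. c (K * n) * w ^ n)"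
  have sums: "(\<lambda>n. c (K * n) * (z ^ K) ^ n) sums H z" if "norm z < 1" for z
  proof -
    have "(\<lambda>n. c n * z ^ n) sums H z"
      using holomorphic_power_series[OF 1(3), of z] that by (simp add: c_def)
    then have "(\<lambda>n. c (K * n) * z ^ (K * n)) sums H z"
      using K0 cz by (subst sums_mono_reindex[of "\<lambda>n. K * n" "\<lambda>n. c n * z ^ n"]) (auto simp: strict_mono_def)
    then show ?thesis by (simp add: power_mult)
  qed
  have Gsums: "(\<lambda>n. c (K * n) * (w - 0) ^ n) sums G w" if "w \<in> ball 0 1" for w
  proof -
    have "\<exists>z. z ^ K = w \<and> norm z < 1"
    proof (cases "w = 0")
      case True then show ?thesis using K0 by (intro exI[of _ 0]) auto
    next
      case False
      obtain \<tau> where \<tau>: "Im \<tau> > 0" "w = ee (\<tau> / of_nat 1)"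
        by (rule ball_ee_cases[OF False _ zero_less_one]) (use \<open>w \<in> ball 0 1\<close> in auto)
      then show ?thesis using K0
        by (intro exI[of _ "ee (\<tau> / of_nat K)"]) (simp add: ee_power norm_ee_less_1)
    qed
    then show ?thesis using sums unfolding G_def by (auto simp: sums_iff)
  qed
  have Ghol: "G holomorphic_on ball 0 1" by (rule power_series_holomorphic[OF Gsums])
  have GH: "G (z ^ K) = H z" if "norm z < 1" for z
    using sums[OF that] by (simp add: G_def sums_iff)
  have "(\<lambda>w. w powi k * G w) meromorphic_on {0}"
  proof (intro meromorphic_intros)
    have "G analytic_on ball 0 1" using Ghol by (simp add: analytic_on_open)
    then show "G meromorphic_on {0}"
      by (intro analytic_on_imp_meromorphic_on) (auto intro: analytic_on_subset)
  qed
  moreover have "f \<tau> = qpow \<tau> (1 / real N) powi k * G (qpow \<tau> (1 / real N))" if "Im \<tau> > 0" for \<tau>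
  proof -
    have q: "qpow \<tau> (1 / real N) = ee (\<tau> / of_nat N)" by (simp add: qpow_ee)
    have "ee (\<tau> / of_nat M) ^ K = ee (\<tau> / of_nat N)" using K0 by (simp add: ee_power K)
    moreover have "norm (ee (\<tau> / of_nat M)) < 1" using that 1(1) by (intro norm_ee_less_1) simp
    ultimately show ?thesis unfolding q using 1(5)[OF that] GH[of "ee (\<tau> / of_nat M)"] by (simp add: eA)
  qed
  ultimately show ?thesis by blast
qed

text \<open>For r = 0 the first product equals 1 - ee w at q = 0, which is nonzero exactly because w
  is then not an integer; for r > 0 both products start with 1 there.\<close>

lemma nice_Ef_aux:
  assumes v: "v = of_nat r / of_nat M" "r < M" and nz: "r \<noteq> 0 \<or> w \<notin> \<int>"
  shows "nice (B2 v / 2) (Ef v w)"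
proof -
  have M: "M > 0" using v by simp
  have small: "norm (z ^ M) < 1" if "norm z < 1" for z :: complex
    using that M by (simp add: norm_power power_less_one_iff)
  show ?thesis
  proof (rule niceI[OF M])
    let ?H = "\<lambda>z. qp (ee (of_real w) * z ^ r) (z ^ M) * qp (ee (- of_real w) * z ^ (M - r)) (z ^ M)"
    show "?H holomorphic_on ball 0 1"
      by (intro holomorphic_intros qp_holomorphic) (use small in auto)
    show "?H z \<noteq> 0" if "norm z < 1" for z
    proof -
      have aux: "c * z ^ i * (z ^ M) ^ n \<noteq> 1" if "norm c = 1" "i > 0 \<or> c \<noteq> 1" for c i n
      proof
        assume eq: "c * z ^ i * (z ^ M) ^ n = 1"
        then have "norm z ^ (i + M * n) = 1"
          using that(1) by (metis mult_1 norm_mult norm_one norm_power power_add power_mult mult.assoc)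
        then have "i + M * n = 0"
          using \<open>norm z < 1\<close> by (metis norm_ge_zero power_strict_decreasing_iff power_0 less_irrefl
             power_less_one_iff gr0I)
        then show False using eq that M by auto
      qed
      have "ee (of_real w) \<noteq> 1 \<or> r > 0" using nz by (auto simp: ee_eq_1_iff)
      then show ?thesis
        using aux[of "ee (of_real w)" r] aux[of "ee (- of_real w)" "M - r"] v(2) small[OF that]
        by (auto simp: qp_eq_0_iff norm_ee)
    qed
    fix \<tau> assume "Im \<tau> > 0"
    have "ee (\<tau> / of_nat M) ^ r = ee (of_real v * \<tau>)" "ee (\<tau> / of_nat M) ^ M = ee \<tau>"
      "ee (\<tau> / of_nat M) ^ (M - r) = ee (of_real (1 - v) * \<tau>)"
    proof -
      have "ee (\<tau> / of_nat M) ^ n = ee (of_real (of_nat n / of_nat M) * \<tau>)" for n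
        by (simp add: ee_power)
      moreover have "1 - v = of_nat (M - r) / of_nat M" using M v by (simp add: of_nat_diff field_simps)
      ultimately show "ee (\<tau> / of_nat M) ^ r = ee (of_real v * \<tau>)" "ee (\<tau> / of_nat M) ^ M = ee \<tau>"
        "ee (\<tau> / of_nat M) ^ (M - r) = ee (of_real (1 - v) * \<tau>)" using M v(1) by simp_all
    qed
    then show "Ef v w \<tau> = ee (of_real (B2 v / 2) * \<tau>) * ?H (ee (\<tau> / of_nat M))"
      unfolding Ef_qp[OF \<open>Im \<tau> > 0\<close>] by simp
  qed
qed

lemma nice_Ef:
  assumes v: "v \<in> \<rat>" and nz: "v \<notin> \<int> \<or> w \<notin> \<int>"
  shows "\<exists>A. nice A (Ef v w)"
proof -
  define u where "u = frac v"
  have "u \<in> \<rat>" unfolding u_def frac_def using v by (intro Rats_diff Rats_of_int)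
  moreover have "0 \<le> u" "u < 1" by (auto simp: u_def frac_lt_1)
  ultimately obtain r M :: nat where "M > 0" and u: "u = of_nat r / of_nat M"
    by (metis Rats_abs_nat_div_natE abs_of_nonneg neq0_conv)
  have r: "r < M" using \<open>u < 1\<close> \<open>M > 0\<close> by (simp add: u)
  have "r \<noteq> 0 \<or> w \<notin> \<int>"
  proof (cases "w \<in> \<int>")
    case True
    then have "v \<notin> \<int>" using nz by blast
    then have "u \<noteq> 0" by (simp add: u_def)
    then show ?thesis using u by auto
  qed simp
  from nice_Ef_aux[OF u r this] have n: "nice (B2 u / 2) (Ef u w)" .
  have "v = u + of_int \<lfloor>v\<rfloor>" by (simp add: u_def frac_def)
  then have "Ef v w \<tau> = ee (of_real (of_int \<lfloor>v\<rfloor> / 2 - of_int \<lfloor>v\<rfloor> * w)) * Ef u w \<tau>" if "Im \<tau> > 0" for \<tau>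
    using Ef_add_left[OF that, of u "\<lfloor>v\<rfloor>" w] by metis
  moreover have "nice (0 + B2 u / 2) (\<lambda>\<tau>. ee (of_real (of_int \<lfloor>v\<rfloor> / 2 - of_int \<lfloor>v\<rfloor> * w)) * Ef u w \<tau>)"
    by (intro nice_mult nice_const n) simp
  ultimately show ?thesis using nice_cong by blast
qed

text \<open>The integral matrix (K a, K b; c, d) is written as a unimodular matrix times an upper
  triangular one: the first column is divided by its gcd g, and Bezout supplies the second column.
  The triangular substitution is then handled by \<open>nice_affine\<close>.\<close>

lemma scaled_moebius_decomp:
  assumes det: "a * d - b * c = (1::int)" and K: "K > (0::nat)"
  obtains p s r u B :: int and g D :: nat where "p * u - s * r = 1" "g > 0" "D > 0"
    "\<And>\<tau>. Im \<tau> > 0 \<Longrightarrow> of_nat K * moebius a b c d \<tau> = moebius p s r u ((of_nat g * \<tau> + of_real (of_int B)) / of_nat D)"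
proof -
  define g where "g = gcd (int K * a) c"
  have "a \<noteq> 0 \<or> c \<noteq> 0" using det by auto
  then have g0: "g > 0" using K by (auto simp: g_def)
  define p where "p = int K * a div g" define r where "r = c div g"
  have pg: "p * g = int K * a" and rg: "r * g = c" by (simp_all add: p_def r_def g_def)
  have "coprime p r" unfolding p_def r_def g_def using \<open>a \<noteq> 0 \<or> c \<noteq> 0\<close> K by (intro div_gcd_coprime) auto
  then obtain x y where xy: "x * p + y * r = 1" using bezout_int[of p r] by auto
  define u where "u = x" define s where "s = - y"
  have det': "p * u - s * r = 1" using xy by (simp add: u_def s_def mult.commute)
  define D where "D = p * d - r * (int K * b)" define B where "B = u * int K * b - s * d"
  have gD: "g * D = int K"
  proof -
    have "g * D = (p * g) * d - (r * g) * (int K * b)" by (simp add: D_def algebra_simps)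
    also have "\<dots> = int K * (a * d - b * c)" unfolding pg rg by (simp add: algebra_simps)
    finally show ?thesis using det by simp
  qed
  have D0: "D > 0" using gD g0 K by (metis of_nat_0_less_iff zero_less_mult_pos)
  have e3: "p * B + s * D = int K * b"
  proof -
    have "p * B + s * D = (p * u - s * r) * (int K * b)" by (simp add: B_def D_def algebra_simps)
    then show ?thesis using det' by simp
  qed
  have e4: "r * B + u * D = d"
  proof -
    have "r * B + u * D = (p * u - s * r) * d" by (simp add: B_def D_def algebra_simps)
    then show ?thesis using det' by simp
  qed
  show ?thesis
  proof (rule that[of p u s r "nat g" "nat D" B])
    show "p * u - s * r = 1" "nat g > 0" "nat D > 0" using det' g0 D0 by auto
    fix \<tau> :: complex assume \<tau>: "Im \<tau> > 0"
    define \<sigma> where "\<sigma> = (of_nat (nat g) * \<tau> + of_real (of_int B)) / of_nat (nat D)"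
    have \<sigma>: "\<sigma> = (of_int g * \<tau> + of_int B) / of_int D" using g0 D0 by (simp add: \<sigma>_def)
    have D': "(of_int D :: complex) \<noteq> 0" using D0 by simp
    have "of_int p * \<sigma> + of_int s = (of_int (p * g) * \<tau> + of_int (p * B + s * D)) / of_int D"
      using D' by (simp add: \<sigma> field_simps)
    then have n: "of_int p * \<sigma> + of_int s = of_nat K * (of_int a * \<tau> + of_int b) / of_int D"
      unfolding pg e3 by (simp add: algebra_simps)
    have "of_int r * \<sigma> + of_int u = (of_int (r * g) * \<tau> + of_int (r * B + u * D)) / of_int D"
      using D' by (simp add: \<sigma> field_simps)
    then have d: "of_int r * \<sigma> + of_int u = (of_int c * \<tau> + of_int d) / of_int D"
      unfolding rg e4 .
    have "moebius p s r u \<sigma> = of_nat K * moebius a b c d \<tau>"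
      unfolding moebius_def n d using D' by simp
    then show "of_nat K * moebius a b c d \<tau> = moebius p s r u ((of_nat (nat g) * \<tau> + of_real (of_int B)) / of_nat (nat D))"
      unfolding \<sigma>_def by simp
  qed
qed

lemma nice_Ef_moebius:
  assumes v: "v \<in> \<rat>" and w: "w \<in> \<rat>" and nz: "v \<notin> \<int> \<or> w \<notin> \<int>"
    and det: "a * d - b * c = 1" and K: "K > 0"
  shows "\<exists>A. nice A (\<lambda>\<tau>. Ef v w (of_nat K * moebius a b c d \<tau>))"
proof -
  obtain p s r u B :: int and g D :: nat where 1: "p * u - s * r = 1" "g > 0" "D > 0"
    "\<And>\<tau>. Im \<tau> > 0 \<Longrightarrow> of_nat K * moebius a b c d \<tau> = moebius p s r u ((of_nat g * \<tau> + of_real (of_int B)) / of_nat D)"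
    by (rule scaled_moebius_decomp[OF det K]) (rule that)
  define V where "V = of_int p * v + of_int r * w"
  define W where "W = of_int s * v + of_int u * w"
  have V: "V \<in> \<rat>" unfolding V_def using v w by (intro Rats_add Rats_mult) auto
  have r1: "of_int p * of_int u - of_int s * of_int r = (1::real)"
    using 1(1) by (metis of_int_1 of_int_diff of_int_mult)
  \<comment> \<open>The unimodular matrix is invertible over the integers, so integral V and W would
    make v and w integral.\<close>
  have "V \<notin> \<int> \<or> W \<notin> \<int>"
  proof (rule ccontr)
    assume "\<not> (V \<notin> \<int> \<or> W \<notin> \<int>)"
    then have "of_int u * V - of_int r * W \<in> \<int>" "of_int p * W - of_int s * V \<in> \<int>" by auto
    moreover have "of_int u * V - of_int r * W = (of_int p * of_int u - of_int s * of_int r) * v"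
      "of_int p * W - of_int s * V = (of_int p * of_int u - of_int s * of_int r) * w"
      by (simp_all add: V_def W_def algebra_simps)
    ultimately show False using nz by (simp add: r1)
  qed
  from nice_Ef[OF V this] obtain A where A: "nice A (Ef V W)" by blast
  define C where "C = ee (of_real (of_int (Phi p s r u) / 12 + (w - v * w - W + V * W) / 2))"
  have "nice (0 + A) (\<lambda>\<tau>. C * Ef V W \<tau>)" by (intro nice_mult nice_const A) (simp add: C_def)
  from nice_affine[OF this 1(2,3), of "of_int B"]
  have "nice ((0 + A) * of_nat g / of_nat D) (\<lambda>\<tau>. C * Ef V W ((of_nat g * \<tau> + of_real (of_int B)) / of_nat D))" .
  moreover have "Ef v w (of_nat K * moebius a b c d \<tau>) = C * Ef V W ((of_nat g * \<tau> + of_real (of_int B)) / of_nat D)"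
    if "Im \<tau> > 0" for \<tau>
    unfolding 1(4)[OF that] C_def using that 1(2,3)
    by (intro Ef_moebius[OF 1(1)]) (simp_all add: V_def W_def)
  ultimately show ?thesis by (blast intro: nice_cong[of _ _ "\<lambda>\<tau>. Ef v w (of_nat K * moebius a b c d \<tau>)"])
qed

lemma cusp_order_eq:
  assumes "nice A (\<lambda>\<tau>. f (moebius 1 0 (int c) 1 \<tau>))"
  shows "cusp_order N f 1 c = real N / real (gcd (c\<^sup>2) N) * A"
proof -
  have n: "has_leading_power (\<lambda>\<tau>. f (moebius 1 b (int c) d \<tau>)) A" if "1 * d - b * int c = 1" for b d
  proof -
    have "moebius 1 b (int c) d \<tau> = moebius 1 0 (int c) 1 (\<tau> + of_real (of_int b))" for \<tau>
      using moebius_add_int[of 1 0 "int c" 1 \<tau> b] that by (simp add: algebra_simps)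
    then show ?thesis using nice_leading_power[OF nice_shift[OF assms, of "of_int b"]] by simp
  qed
  have "(THE A. \<forall>b d. 1 * d - b * int c = 1 \<longrightarrow> has_leading_power (\<lambda>\<tau>. f (moebius 1 b (int c) d \<tau>)) A) = A"
  proof (rule the_equality)
    fix A' assume "\<forall>b d. 1 * d - b * int c = 1 \<longrightarrow> has_leading_power (\<lambda>\<tau>. f (moebius 1 b (int c) d \<tau>)) A'"
    then have "has_leading_power (\<lambda>\<tau>. f (moebius 1 0 (int c) 1 \<tau>)) A'" by simp
    then show "A' = A" using leading_power_unique nice_leading_power[OF assms] by blast
  qed (use n in auto)
  then show ?thesis unfolding cusp_order_def by simp
qed

section \<open>Representatives of units modulo sign\<close>

lemma cong_uminus_iff: "[x = - y] (mod n) \<longleftrightarrow> [- x = y] (mod n)" for x y n :: int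
  by (metis add.inverse_inverse cong_minus_minus_iff)

lemma unit_repsD:
  assumes "unit_reps_mod_pm1 n S" "\<alpha> \<in> S"
  shows "1 \<le> \<alpha>" "\<alpha> < int n" "coprime \<alpha> (int n)"
  using assms by (auto simp: unit_reps_mod_pm1_def)

lemma unit_reps_finite: "unit_reps_mod_pm1 n S \<Longrightarrow> finite S"
  unfolding unit_reps_mod_pm1_def by (meson finite_atLeastAtMost_int finite_subset)

lemma unit_reps_ex:
  assumes "unit_reps_mod_pm1 n S" "coprime u (int n)"
  obtains \<alpha> where "\<alpha> \<in> S" "[u = \<alpha>] (mod int n) \<or> [u = - \<alpha>] (mod int n)"
  using assms unfolding unit_reps_mod_pm1_def by blast

lemma unit_reps_unique:
  assumes "unit_reps_mod_pm1 n S" "coprime u (int n)" "\<alpha> \<in> S" "\<beta> \<in> S"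
    "[u = \<alpha>] (mod int n) \<or> [u = - \<alpha>] (mod int n)" "[u = \<beta>] (mod int n) \<or> [u = - \<beta>] (mod int n)"
  shows "\<alpha> = \<beta>"
  using assms unfolding unit_reps_mod_pm1_def by blast

lemma unit_reps_bij:
  assumes S: "unit_reps_mod_pm1 n S" and S': "unit_reps_mod_pm1 n S'" and u: "coprime u (int n)"
  obtains r where "bij_betw r S S'"
    "\<And>\<alpha>. \<alpha> \<in> S \<Longrightarrow> [u * \<alpha> = r \<alpha>] (mod int n) \<or> [u * \<alpha> = - r \<alpha>] (mod int n)"
proof -
  have cop: "coprime (u * \<alpha>) (int n)" if "\<alpha> \<in> S" for \<alpha>
    using u unit_repsD(3)[OF S that] by simp
  have "\<exists>r. \<forall>\<alpha>\<in>S. r \<alpha> \<in> S' \<and> ([u * \<alpha> = r \<alpha>] (mod int n) \<or> [u * \<alpha> = - r \<alpha>] (mod int n))"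
    using unit_reps_ex[OF S' cop] by (intro bchoice) blast
  then obtain r where r: "\<And>\<alpha>. \<alpha> \<in> S \<Longrightarrow> r \<alpha> \<in> S'"
    "\<And>\<alpha>. \<alpha> \<in> S \<Longrightarrow> [u * \<alpha> = r \<alpha>] (mod int n) \<or> [u * \<alpha> = - r \<alpha>] (mod int n)" by blast
  have "inj_on r S"
  proof (rule inj_onI)
    fix x y assume xy: "x \<in> S" "y \<in> S" "r x = r y"
    have "[s = z] (mod int n) \<or> [s = - z] (mod int n) \<Longrightarrow> [t = z] (mod int n) \<or> [t = - z] (mod int n) \<Longrightarrow>
        [s = t] (mod int n) \<or> [s = - t] (mod int n)" for s t z
      using cong_trans[OF _ cong_sym] cong_uminus_iff by (metis minus_minus)
    from this[OF r(2)[OF xy(1), unfolded xy(3)] r(2)[OF xy(2)]]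
    have "[u * x = u * y] (mod int n) \<or> [u * x = u * (- y)] (mod int n)" by simp
    then have "[x = y] (mod int n) \<or> [x = - y] (mod int n)"
      using u cong_mult_lcancel by blast
    then show "x = y" using unit_reps_unique[OF S unit_repsD(3)[OF S xy(1)] xy(1,2)] by auto
  qed
  moreover have "S' \<subseteq> r ` S"
  proof
    fix \<beta> assume \<beta>: "\<beta> \<in> S'"
    obtain v where v: "[u * v = 1] (mod int n)" using cong_solve_coprime_int[OF u] by auto
    then have "coprime v (int n)" using coprime_iff_invertible_int by (metis mult.commute)
    then have "coprime (v * \<beta>) (int n)" using unit_repsD(3)[OF S' \<beta>] by simp
    then obtain \<alpha> where \<alpha>: "\<alpha> \<in> S" "[v * \<beta> = \<alpha>] (mod int n) \<or> [v * \<beta> = - \<alpha>] (mod int n)"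
      by (rule unit_reps_ex[OF S]) (rule that)
    have uv: "[u * (v * \<beta>) = \<beta>] (mod int n)"
      using cong_scalar_right[OF v, of \<beta>] by (simp add: mult.assoc)
    have "[u * \<alpha> = \<beta>] (mod int n) \<or> [u * \<alpha> = - \<beta>] (mod int n)"
    proof (rule disjE[OF \<alpha>(2)])
      assume "[v * \<beta> = \<alpha>] (mod int n)"
      then have "[u * (v * \<beta>) = u * \<alpha>] (mod int n)" by (rule cong_scalar_left)
      then show ?thesis using uv cong_sym cong_trans by blast
    next
      assume "[v * \<beta> = - \<alpha>] (mod int n)"
      then have "[u * (v * \<beta>) = - (u * \<alpha>)] (mod int n)" using cong_scalar_left by fastforce
      then show ?thesis using uv cong_sym cong_trans cong_uminus_iff by (metis minus_minus)
    qed
    then have "r \<alpha> = \<beta>" using unit_reps_unique[OF S' cop[OF \<alpha>(1)] r(1)[OF \<alpha>(1)] \<beta> r(2)[OF \<alpha>(1)]] by blast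
    then show "\<beta> \<in> r ` S" using \<alpha>(1) by blast
  qed
  ultimately have "bij_betw r S S'" using r(1) by (auto simp: bij_betw_def)
  then show ?thesis using that r(2) by blast
qed

text \<open>Multiplication by a unit permutes the classes modulo sign, so a function of the class
  may be reindexed. The case u = 1 compares two systems of representatives; u = a gives the
  invariance of a product under a matrix.\<close>

lemma unit_reps_prod:
  fixes \<Psi> :: "int \<Rightarrow> 'a :: comm_monoid_mult"
  assumes S: "unit_reps_mod_pm1 n S" and S': "unit_reps_mod_pm1 n S'" and u: "coprime u (int n)"
    and \<Psi>: "\<And>x y. coprime y (int n) \<Longrightarrow> [x = y] (mod int n) \<or> [x = - y] (mod int n) \<Longrightarrow> \<Psi> x = \<Psi> y"
  shows "(\<Prod>\<alpha>\<in>S. \<Psi> (u * \<alpha>)) = (\<Prod>\<alpha>\<in>S'. \<Psi> \<alpha>)"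
proof -
  obtain r where r: "bij_betw r S S'"
    "\<And>\<alpha>. \<alpha> \<in> S \<Longrightarrow> [u * \<alpha> = r \<alpha>] (mod int n) \<or> [u * \<alpha> = - r \<alpha>] (mod int n)"
    by (rule unit_reps_bij[OF S S' u]) (rule that)
  have "coprime (r \<alpha>) (int n)" if "\<alpha> \<in> S" for \<alpha>
    using unit_repsD(3)[OF S'] r(1) that by (auto simp: bij_betw_def)
  then have "\<Psi> (u * \<alpha>) = \<Psi> (r \<alpha>)" if "\<alpha> \<in> S" for \<alpha>
    using \<Psi> r(2) that by blast
  then show ?thesis
    unfolding prod.reindex_bij_betw[OF r(1), symmetric] by (intro prod.cong refl)
qed

lemma unit_reps_sum:
  fixes \<Psi> :: "int \<Rightarrow> 'a :: comm_monoid_add"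
  assumes S: "unit_reps_mod_pm1 n S" and S': "unit_reps_mod_pm1 n S'" and u: "coprime u (int n)"
    and \<Psi>: "\<And>x y. coprime y (int n) \<Longrightarrow> [x = y] (mod int n) \<or> [x = - y] (mod int n) \<Longrightarrow> \<Psi> x = \<Psi> y"
  shows "(\<Sum>\<alpha>\<in>S. \<Psi> (u * \<alpha>)) = (\<Sum>\<alpha>\<in>S'. \<Psi> \<alpha>)"
proof -
  obtain r where r: "bij_betw r S S'"
    "\<And>\<alpha>. \<alpha> \<in> S \<Longrightarrow> [u * \<alpha> = r \<alpha>] (mod int n) \<or> [u * \<alpha> = - r \<alpha>] (mod int n)"
    by (rule unit_reps_bij[OF S S' u]) (rule that)
  have "coprime (r \<alpha>) (int n)" if "\<alpha> \<in> S" for \<alpha>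
    using unit_repsD(3)[OF S'] r(1) that by (auto simp: bij_betw_def)
  then have "\<Psi> (u * \<alpha>) = \<Psi> (r \<alpha>)" if "\<alpha> \<in> S" for \<alpha>
    using \<Psi> r(2) that by blast
  then show ?thesis
    unfolding sum.reindex_bij_betw[OF r(1), symmetric] by (intro sum.cong refl)
qed

lemma coprime_diff_self: "coprime (n - x) n \<longleftrightarrow> coprime x n" for x n :: int
  by (metis coprime_minus_left_iff coprime_iff_gcd_eq_1 gcd_add1 gcd.commute minus_diff_eq uminus_add_conv_diff add.commute diff_add_cancel gcd_diff1 gcd_diff2)

text \<open>The representatives and their complements n - \<alpha> exhaust the units. The two sets
  are disjoint because n = 2 \<alpha> with \<alpha> prime to n would force \<alpha> = 1 and n =
  2.\<close>

lemma unit_reps_card: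
  assumes S: "unit_reps_mod_pm1 n S" and n: "n > 2"
  shows "2 * card S = totient n"
proof -
  define T where "T = (\<lambda>\<alpha>. int n - \<alpha>) ` S"
  have cT: "card T = card S" unfolding T_def by (intro card_image) (auto simp: inj_on_def)
  have fin: "finite S" "finite T" using unit_reps_finite[OF S] by (auto simp: T_def)
  have "S \<inter> T = {}"
  proof (rule ccontr)
    assume "S \<inter> T \<noteq> {}"
    then obtain \<alpha> \<beta> where ab: "\<alpha> \<in> S" "\<beta> \<in> S" "\<alpha> = int n - \<beta>" by (auto simp: T_def)
    then have "[\<alpha> = - \<beta>] (mod int n)" by (simp add: cong_iff_dvd_diff)
    then have "\<alpha> = \<beta>" using unit_reps_unique[OF S unit_repsD(3)[OF S ab(1)] ab(1,2)] by auto
    then have "int n = 2 * \<alpha>" using ab(3) by simp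
    then have "\<alpha> dvd int n" by simp
    then have "is_unit \<alpha>" using unit_repsD(3)[OF S ab(1)] by (metis coprime_common_divisor dvd_refl)
    then have "\<alpha> = 1" using unit_repsD(1)[OF S ab(1)] by auto
    then show False using \<open>int n = 2 * \<alpha>\<close> n by simp
  qed
  then have "card (S \<union> T) = 2 * card S" using fin cT by (simp add: card_Un_disjoint)
  moreover have "S \<union> T = int ` totatives n"
  proof
    show "S \<union> T \<subseteq> int ` totatives n"
    proof
      fix x assume "x \<in> S \<union> T"
      then have "1 \<le> x" "x < int n" "coprime x (int n)"
        using unit_repsD[OF S] by (fastforce simp: T_def coprime_diff_self)+
      moreover from this(1) obtain k where "x = int k" using zero_le_imp_eq_int[of x] by auto
      ultimately show "x \<in> int ` totatives n" by (simp add: totatives_def)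
    qed
    show "int ` totatives n \<subseteq> S \<union> T"
    proof
      fix x assume "x \<in> int ` totatives n"
      then obtain k where k: "x = int k" "0 < k" "k \<le> n" "coprime k n" by (auto simp: totatives_def)
      have "k \<noteq> n" using k n by auto
      then have kn: "k < n" using k by simp
      have cx: "coprime x (int n)" using k by simp
      obtain \<alpha> where \<alpha>: "\<alpha> \<in> S" "[x = \<alpha>] (mod int n) \<or> [x = - \<alpha>] (mod int n)"
        by (rule unit_reps_ex[OF S cx]) (rule that)
      from \<alpha>(2) show "x \<in> S \<union> T"
      proof
        assume "[x = \<alpha>] (mod int n)"
        then have "x = \<alpha>" using unit_repsD[OF S \<alpha>(1)] k kn by (intro cong_less_imp_eq_int[of x "int n" \<alpha>]) auto
        then show ?thesis using \<alpha> by simp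
      next
        assume "[x = - \<alpha>] (mod int n)"
        then have "[x = int n - \<alpha>] (mod int n)"
          by (simp add: cong_iff_dvd_diff algebra_simps dvd_diff_commute)
        then have "x = int n - \<alpha>" using unit_repsD[OF S \<alpha>(1)] k kn by (intro cong_less_imp_eq_int) auto
        then show ?thesis using \<alpha> by (auto simp: T_def)
      qed
    qed
  qed
  ultimately show ?thesis by (simp add: totient_def card_image)
qed

text \<open>For odd n exactly one of x and n - x is even. This is Eisenstein's choice of
  representatives: for even \<alpha> the parity of the quotient of a \<alpha> by n tells which sign
  brings the remainder back into the system.\<close>

definition even_units :: "nat \<Rightarrow> int set" where
  "even_units n = {\<alpha> \<in> {1..int n - 1}. even \<alpha> \<and> coprime \<alpha> (int n)}"

lemma even_units_reps:
  assumes "odd n" "n > 1"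
  shows "unit_reps_mod_pm1 n (even_units n)"
  unfolding unit_reps_mod_pm1_def
proof (intro conjI ballI allI impI)
  show "even_units n \<subseteq> {1..int n - 1}" by (auto simp: even_units_def)
  show "coprime \<alpha> (int n)" if "\<alpha> \<in> even_units n" for \<alpha> using that by (auto simp: even_units_def)
  fix u assume u: "coprime u (int n)"
  define v where "v = u mod int n"
  have v: "coprime v (int n)" using u assms by (simp add: v_def)
  have "v \<noteq> 0" using v assms by auto
  moreover have "0 \<le> v" "v < int n" using assms by (simp_all add: v_def)
  ultimately have v1: "1 \<le> v" "v < int n" by simp_all
  have uv: "[u = x] (mod int n) \<longleftrightarrow> [v = x] (mod int n)" for x by (simp add: v_def cong_def)
  have key: "([v = x] (mod int n) \<longleftrightarrow> x = v) \<and> ([v = - x] (mod int n) \<longleftrightarrow> x = int n - v)"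
    if "1 \<le> x" "x < int n" for x
  proof -
    have "[v = x] (mod int n) \<longleftrightarrow> x = v" using that v1 cong_less_imp_eq_int[of v "int n" x] by auto
    moreover have "[v = - x] (mod int n) \<longleftrightarrow> [int n - v = x] (mod int n)"
      by (simp add: cong_iff_dvd_diff) (metis add.commute diff_diff_eq dvd_add_right_iff dvd_refl minus_diff_eq dvd_minus_iff diff_conv_add_uminus add_diff_eq)
    moreover have "[int n - v = x] (mod int n) \<longleftrightarrow> x = int n - v"
      using that v1 cong_less_imp_eq_int[of "int n - v" "int n" x] by auto
    ultimately show ?thesis by blast
  qed
  show "\<exists>!\<alpha>. \<alpha> \<in> even_units n \<and> ([u = \<alpha>] (mod int n) \<or> [u = - \<alpha>] (mod int n))"
  proof (rule ex1I[of _ "if even v then v else int n - v"])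
    show "(if even v then v else int n - v) \<in> even_units n \<and>
       ([u = if even v then v else int n - v] (mod int n) \<or> [u = - (if even v then v else int n - v)] (mod int n))"
      unfolding uv using key[of v] key[of "int n - v"] v1 v assms by (auto simp: even_units_def coprime_diff_self)
    show "\<alpha> = (if even v then v else int n - v)"
      if "\<alpha> \<in> even_units n \<and> ([u = \<alpha>] (mod int n) \<or> [u = - \<alpha>] (mod int n))" for \<alpha>
      using that key[of \<alpha>] assms unfolding uv by (auto simp: even_units_def)
  qed
qed

section \<open>Power sums over the representatives\<close>

lemma unit_reps_sum_cong:
  assumes S: "unit_reps_mod_pm1 n S" and u: "coprime u (int n)"
    and f: "\<And>x y. coprime y (int n) \<Longrightarrow> [x = y] (mod int n) \<or> [x = - y] (mod int n) \<Longrightarrow> [f x = f y] (mod q)"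
  shows "[(\<Sum>\<alpha>\<in>S. f (u * \<alpha>)) = (\<Sum>\<alpha>\<in>S. f \<alpha>)] (mod q :: int)"
proof -
  have "(\<Sum>\<alpha>\<in>S. f (u * \<alpha>) mod q) = (\<Sum>\<alpha>\<in>S. f \<alpha> mod q)"
    using f unfolding cong_def by (rule unit_reps_sum[OF S S u, of "\<lambda>x. f x mod q", unfolded cong_def])
  then show ?thesis unfolding cong_def by (metis mod_sum_eq)
qed

lemma cong_square_pm: "[x = y] (mod n) \<or> [x = - y] (mod n) \<Longrightarrow> [x\<^sup>2 = y\<^sup>2] (mod n)" for x y n :: int
  by (metis cong_pow power2_minus)

text \<open>Multiplying the representatives by u permutes them up to sign, which squares do not
  see.\<close>

lemma unit_reps_square_sum:
  assumes S: "unit_reps_mod_pm1 n S" and u: "coprime u (int n)"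
  shows "int n dvd (u\<^sup>2 - 1) * (\<Sum>\<alpha>\<in>S. \<alpha>\<^sup>2)"
proof -
  have "[(\<Sum>\<alpha>\<in>S. (u * \<alpha>)\<^sup>2) = (\<Sum>\<alpha>\<in>S. \<alpha>\<^sup>2)] (mod int n)"
    by (rule unit_reps_sum_cong[OF S u]) (rule cong_square_pm)
  then have "[u\<^sup>2 * (\<Sum>\<alpha>\<in>S. \<alpha>\<^sup>2) = (\<Sum>\<alpha>\<in>S. \<alpha>\<^sup>2)] (mod int n)"
    by (simp add: power_mult_distrib sum_distrib_left)
  then show ?thesis by (simp add: cong_iff_dvd_diff algebra_simps)
qed

abbreviation inv_mod :: "nat \<Rightarrow> int \<Rightarrow> int" where
  "inv_mod n x \<equiv> modular_inverse (int n) x"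

lemma inv_mod: "coprime x (int n) \<Longrightarrow> [x * inv_mod n x = 1] (mod int n)"
  by (rule cong_modular_inverse1)

lemma inverse_cong_unique:
  assumes "[x * y = 1] (mod n)" "[x' * z = 1] (mod n)" "[x = x'] (mod n)"
  shows "[y = z] (mod n :: int)"
proof -
  have "[y * (x' * z) = y * 1] (mod n)" by (intro cong_scalar_left assms(2))
  moreover have "[(x * y) * z = 1 * z] (mod n)" by (intro cong_scalar_right assms(1))
  moreover have "[y * (x' * z) = (x * y) * z] (mod n)"
    using cong_scalar_right[OF cong_sym[OF assms(3)], of "y * z"] by (simp add: mult_ac)
  ultimately show ?thesis by (metis cong_sym cong_trans mult_1 mult_1_right)
qed

lemma inv_mod_pm:
  assumes "coprime y (int n)" "[x = y] (mod int n) \<or> [x = - y] (mod int n)"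
  shows "([x = y] (mod int n) \<and> [inv_mod n x = inv_mod n y] (mod int n)) \<or>
    ([x = - y] (mod int n) \<and> [inv_mod n x = - inv_mod n y] (mod int n))"
  using assms(2)
proof
  assume xy: "[x = y] (mod int n)"
  then have "coprime x (int n)" using assms(1) cong_imp_coprime cong_sym by blast
  then show ?thesis using inverse_cong_unique[OF inv_mod inv_mod[OF assms(1)] xy] xy by blast
next
  assume xy: "[x = - y] (mod int n)"
  then have "coprime x (int n)" using assms(1) cong_imp_coprime cong_sym by (metis coprime_minus_left_iff)
  moreover have "[(- y) * (- inv_mod n y) = 1] (mod int n)" using inv_mod[OF assms(1)] by simp
  ultimately show ?thesis using inverse_cong_unique[OF inv_mod _ xy] xy by blast
qed

text \<open>The same argument for the inverses: u times the inverse of u \<alpha> is the inverse of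
  \<alpha>.\<close>

lemma unit_reps_inv_square_sum:
  assumes S: "unit_reps_mod_pm1 n S" and u: "coprime u (int n)"
  shows "int n dvd (u\<^sup>2 - 1) * (\<Sum>\<alpha>\<in>S. (inv_mod n \<alpha>)\<^sup>2)"
proof -
  have "[(\<Sum>\<alpha>\<in>S. (inv_mod n (u * \<alpha>))\<^sup>2) = (\<Sum>\<alpha>\<in>S. (inv_mod n \<alpha>)\<^sup>2)] (mod int n)"
    by (rule unit_reps_sum_cong[OF S u]) (use inv_mod_pm cong_square_pm in blast)
  then have 1: "[u\<^sup>2 * (\<Sum>\<alpha>\<in>S. (inv_mod n (u * \<alpha>))\<^sup>2) = u\<^sup>2 * (\<Sum>\<alpha>\<in>S. (inv_mod n \<alpha>)\<^sup>2)] (mod int n)"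
    by (rule cong_scalar_left)
  have "[(u * inv_mod n (u * \<alpha>))\<^sup>2 = (inv_mod n \<alpha>)\<^sup>2] (mod int n)" if "\<alpha> \<in> S" for \<alpha>
  proof -
    have c: "coprime \<alpha> (int n)" "coprime (u * \<alpha>) (int n)" using unit_repsD(3)[OF S that] u by auto
    have "[\<alpha> * (u * inv_mod n (u * \<alpha>)) = 1] (mod int n)" using inv_mod[OF c(2)] by (simp add: mult_ac)
    then show ?thesis using inverse_cong_unique[OF _ inv_mod[OF c(1)] cong_refl] cong_pow by blast
  qed
  then have "[(\<Sum>\<alpha>\<in>S. (u * inv_mod n (u * \<alpha>))\<^sup>2) = (\<Sum>\<alpha>\<in>S. (inv_mod n \<alpha>)\<^sup>2)] (mod int n)"
    by (rule cong_sum)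
  then have "[u\<^sup>2 * (\<Sum>\<alpha>\<in>S. (inv_mod n (u * \<alpha>))\<^sup>2) = (\<Sum>\<alpha>\<in>S. (inv_mod n \<alpha>)\<^sup>2)] (mod int n)"
    by (simp add: power_mult_distrib sum_distrib_left)
  then have "[u\<^sup>2 * (\<Sum>\<alpha>\<in>S. (inv_mod n \<alpha>)\<^sup>2) = (\<Sum>\<alpha>\<in>S. (inv_mod n \<alpha>)\<^sup>2)] (mod int n)"
    using 1 cong_sym cong_trans by blast
  then show ?thesis by (simp add: cong_iff_dvd_diff algebra_simps)
qed

text \<open>Take u = 2 modulo p and u = 1 modulo n/p: then u^2 - 1 is 3 modulo p, a unit for p \<ge>
  5. For p = 2 and p = 3 every unit has square 1 modulo p, so these two primes stay
  exceptional.\<close>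

lemma ex_unit_square_ne_1:
  assumes p: "prime p" "p dvd n" "p \<noteq> 2" "p \<noteq> 3" and n: "squarefree n" "n > 0"
  obtains u where "coprime u (int n)" "coprime (u\<^sup>2 - 1) (int p)"
proof -
  obtain k where k: "n = p * k" using p(2) by auto
  have "coprime p k"
  proof (rule ccontr)
    assume "\<not> coprime p k"
    then have "p dvd k" using p(1) prime_imp_coprime_nat by blast
    then have "p\<^sup>2 dvd n" by (auto simp: k power2_eq_square)
    then show False using n(1) p(1) by (metis not_prime_unit squarefreeD)
  qed
  then have ck: "coprime (int p) (int k)" by simp
  obtain u where u: "[u = 2] (mod int p)" "[u = 1] (mod int k)"
    using binary_chinese_remainder_int[OF ck] by blast
  have p5: "p \<ge> 5"
  proof -
    have "p \<noteq> 4" using p(1) by (metis dvd_triv_left mult_2 numeral_Bit0 one_add_one prime_nat_iff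
       semiring_norm(83) numeral_eq_iff num.distinct(1) even_numeral prime_odd_nat even_iff_mod_2_eq_zero order_refl linorder_not_le p(3) prime_ge_2_nat le_neq_implies_less)
    then show ?thesis using prime_ge_2_nat[OF p(1)] p by simp
  qed
  have "coprime (2::int) (int p)"
    using p p5 by (metis coprime_commute coprime_int_iff of_nat_numeral prime_imp_coprime_nat primes_coprime two_is_prime_nat)
  then have "coprime u (int p)" using u(1) cong_imp_coprime cong_sym by blast
  moreover have "coprime u (int k)" using u(2) cong_imp_coprime cong_sym by (metis coprime_1_left)
  ultimately have "coprime u (int n)" by (simp add: k)
  moreover have "coprime (3::int) (int p)"
    using p p5 primes_coprime[of 3 p] coprime_int_iff[of 3 p] by simp
  moreover have "[u\<^sup>2 - 1 = 2\<^sup>2 - 1] (mod int p)" by (intro cong_diff cong_pow u cong_refl)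
  ultimately have "coprime (u\<^sup>2 - 1) (int p)" using cong_imp_coprime[of 3 "u\<^sup>2 - 1"] cong_sym by auto
  then show ?thesis using that \<open>coprime u (int n)\<close> by blast
qed

lemma unit_reps_dvd_sums:
  assumes S: "unit_reps_mod_pm1 n S" and p: "prime p" "p dvd n" "p \<noteq> 2" "p \<noteq> 3" and n: "squarefree n" "n > 0"
  shows "int p dvd (\<Sum>\<alpha>\<in>S. \<alpha>\<^sup>2)" "int p dvd (\<Sum>\<alpha>\<in>S. (inv_mod n \<alpha>)\<^sup>2)"
proof -
  obtain u where u: "coprime u (int n)" "coprime (u\<^sup>2 - 1) (int p)"
    by (rule ex_unit_square_ne_1[OF p n]) (rule that)
  have pn: "int p dvd int n" using p(2) by simp
  show "int p dvd (\<Sum>\<alpha>\<in>S. \<alpha>\<^sup>2)" "int p dvd (\<Sum>\<alpha>\<in>S. (inv_mod n \<alpha>)\<^sup>2)"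
    using dvd_trans[OF pn unit_reps_square_sum[OF S u(1)]]
      dvd_trans[OF pn unit_reps_inv_square_sum[OF S u(1)]] u(2)
    by (auto simp: coprime_commute coprime_dvd_mult_right_iff)
qed

lemma squarefree_dvdI:
  assumes "squarefree n" "n > 0" "\<And>p. prime p \<Longrightarrow> p dvd n \<Longrightarrow> int p dvd x"
  shows "int n dvd x"
proof (cases "x = 0")
  case False
  have "n dvd nat \<bar>x\<bar>"
  proof (rule multiplicity_le_imp_dvd)
    fix p :: nat assume p: "prime p"
    show "multiplicity p n \<le> multiplicity p (nat \<bar>x\<bar>)"
    proof (cases "p dvd n")
      case True
      have "multiplicity p n \<le> 1"
        using squarefree_factorial_semiring''[of n] assms(1,2) p by auto
      moreover have "p dvd nat \<bar>x\<bar>" using assms(3)[OF p True] by (simp add: nat_abs_dvd_iff)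
      then have "multiplicity p (nat \<bar>x\<bar>) \<ge> 1"
        using p False by (intro multiplicity_geI) (auto dest: prime_gt_1_nat)
      ultimately show ?thesis by linarith
    qed (simp add: not_dvd_imp_multiplicity_0)
  qed (use assms False in auto)
  then show ?thesis by (simp add: nat_abs_dvd_iff)
qed simp

text \<open>The factor 6 covers the primes 2 and 3, which \<open>unit_reps_dvd_sums\<close> does not
  reach.\<close>

lemma unit_reps_six_square_sum:
  assumes S: "unit_reps_mod_pm1 n S" and n: "squarefree n" "n > 0"
  shows "int n dvd 6 * (\<Sum>\<alpha>\<in>S. \<alpha>\<^sup>2)"
proof (rule squarefree_dvdI[OF n])
  fix p assume p: "prime p" "p dvd n"
  have "int p dvd (\<Sum>\<alpha>\<in>S. \<alpha>\<^sup>2)" if "p \<noteq> 2" "p \<noteq> 3"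
    by (rule unit_reps_dvd_sums(1)[OF S p that n])
  moreover have "int 2 dvd 6" "int 3 dvd 6" by simp_all
  ultimately show "int p dvd 6 * (\<Sum>\<alpha>\<in>S. \<alpha>\<^sup>2)" by (metis dvd_mult dvd_mult2)
qed


section \<open>Evaluation of the multiplier\<close>

abbreviation floor_sum :: "nat \<Rightarrow> int set \<Rightarrow> int \<Rightarrow> int" where
  "floor_sum n S a \<equiv> (\<Sum>\<alpha>\<in>S. (a * \<alpha>) div int n)"

abbreviation eps :: "int \<Rightarrow> int" where
  "eps x \<equiv> (if even x then 1 else -1)"

lemma eps_sum: "finite S \<Longrightarrow> (\<Prod>\<alpha>\<in>S. eps (t \<alpha>)) = eps (\<Sum>\<alpha>\<in>S. t \<alpha>)"
  by (induction S rule: finite_induct) auto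

lemma ee_half_int: "ee (of_int x / 2) = of_int (eps x)"
proof (cases "even x")
  case True
  then obtain k where "x = 2 * k" by auto
  then have "(of_int x / 2 :: complex) = of_int k" by simp
  then show ?thesis using True by (simp only: ee_int) simp
next
  case False
  then obtain k where "x = 2 * k + 1" by (auto elim!: oddE)
  then have "(of_int x / 2 :: complex) = of_int k + 1/2" by (simp add: field_simps)
  then show ?thesis using False by (simp only: ee_add ee_int ee_half) simp
qed

lemma fermat_theorem_of_int:
  assumes "prime p" "\<not> int p dvd a"
  shows "[a ^ (p - 1) = 1] (mod int p)"
proof -
  define b where "b = nat (a mod int p)"
  have b: "int b = a mod int p" using prime_gt_0_nat[OF assms(1)] by (simp add: b_def)
  have "\<not> p dvd b"
    using assms(2) b by (metis dvd_mod_iff dvd_refl int_dvd_int_iff)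
  then have "[b ^ (p - 1) = 1] (mod p)" by (rule fermat_theorem[OF assms(1)])
  then have "[int b ^ (p - 1) = 1] (mod int p)" using cong_int_iff[of "b ^ (p - 1)" 1 p] by simp
  moreover have "[int b ^ (p - 1) = a ^ (p - 1)] (mod int p)"
    unfolding b by (intro cong_pow) (simp add: cong_def)
  ultimately show ?thesis using cong_sym cong_trans by blast
qed

text \<open>Eisenstein's form of Gauss's lemma. Write a \<alpha> = n t + \<beta>; since \<alpha> is
  even and n odd, t and \<beta> have the same parity, so the representative is \<beta> or n -
  \<beta> according to the parity of t. Multiplying these congruences, the product of all
  representatives cancels.\<close>

lemma gauss_floor_sum:
  assumes n: "odd n" "n > 1" and a: "coprime a (int n)"
  shows "[eps (floor_sum n (even_units n) a) * a ^ card (even_units n) = 1] (mod int n)"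
proof -
  let ?S = "even_units n"
  have S: "unit_reps_mod_pm1 n ?S" by (rule even_units_reps[OF n])
  have fin: "finite ?S" by (rule unit_reps_finite[OF S])
  obtain r where r: "bij_betw r ?S ?S"
    "\<And>\<alpha>. \<alpha> \<in> ?S \<Longrightarrow> [a * \<alpha> = r \<alpha>] (mod int n) \<or> [a * \<alpha> = - r \<alpha>] (mod int n)"
    by (rule unit_reps_bij[OF S S a]) (rule that)
  have key: "[eps ((a * \<alpha>) div int n) * (a * \<alpha>) = r \<alpha>] (mod int n)" if \<alpha>: "\<alpha> \<in> ?S" for \<alpha>
  proof -
    define t where "t = (a * \<alpha>) div int n"
    define \<beta> where "\<beta> = (a * \<alpha>) mod int n"
    have e: "a * \<alpha> = int n * t + \<beta>" by (simp add: t_def \<beta>_def)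
    have c: "coprime (a * \<alpha>) (int n)" using a unit_repsD(3)[OF S \<alpha>] by simp
    then have c\<beta>: "coprime \<beta> (int n)" using n by (simp add: \<beta>_def)
    have "\<beta> \<noteq> 0" using c\<beta> n by auto
    moreover have "0 \<le> \<beta>" "\<beta> < int n" using n by (simp_all add: \<beta>_def)
    ultimately have \<beta>: "1 \<le> \<beta>" "\<beta> < int n" by simp_all
    have "even (a * \<alpha>)" using \<alpha> by (auto simp: even_units_def)
    then have par: "even t \<longleftrightarrow> even \<beta>" unfolding e using n by auto
    have rS: "r \<alpha> \<in> ?S" using r(1) \<alpha> by (auto simp: bij_betw_def)
    have cong: "[a * \<alpha> = \<beta>] (mod int n)" by (simp add: \<beta>_def cong_def)
    show ?thesis
    proof (cases "even t")
      case True
      have "\<beta> \<in> ?S" using par True \<beta> c\<beta> by (auto simp: even_units_def)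
      then have "\<beta> = r \<alpha>" using unit_reps_unique[OF S c _ rS _ r(2)[OF \<alpha>]] cong by blast
      then show ?thesis using True cong by (simp add: t_def)
    next
      case False
      have "int n - \<beta> \<in> ?S" using par False \<beta> c\<beta> n by (auto simp: even_units_def coprime_diff_self)
      moreover have 1: "[a * \<alpha> = - (int n - \<beta>)] (mod int n)" 
      proof -
        have "int n dvd \<beta> - (\<beta> - int n)" by simp
        then have "[\<beta> = \<beta> - int n] (mod int n)" unfolding cong_iff_dvd_diff .
        then have "[a * \<alpha> = \<beta> - int n] (mod int n)" by (rule cong_trans[OF cong])
        then show ?thesis by simp
      qed
      ultimately have eq: "int n - \<beta> = r \<alpha>" using unit_reps_unique[OF S c _ rS _ r(2)[OF \<alpha>]] by blast
      have "[- (a * \<alpha>) = r \<alpha>] (mod int n)" using 1 unfolding eq cong_uminus_iff .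
      then show ?thesis using False by (simp add: t_def)
    qed
  qed
  have "[(\<Prod>\<alpha>\<in>?S. eps ((a * \<alpha>) div int n) * (a * \<alpha>)) = (\<Prod>\<alpha>\<in>?S. r \<alpha>)] (mod int n)"
    by (rule cong_prod) (rule key)
  also have "(\<Prod>\<alpha>\<in>?S. r \<alpha>) = \<Prod>?S" by (rule prod.reindex_bij_betw[OF r(1)])
  also have "(\<Prod>\<alpha>\<in>?S. eps ((a * \<alpha>) div int n) * (a * \<alpha>)) =
      (eps (floor_sum n ?S a) * a ^ card ?S) * \<Prod>?S"
    by (simp only: prod.distrib eps_sum[OF fin] prod_constant mult.assoc)
  finally have "[(eps (floor_sum n ?S a) * a ^ card ?S) * \<Prod>?S = 1 * \<Prod>?S] (mod int n)" by simp
  moreover have "coprime (\<Prod>?S) (int n)"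
    by (rule prod_coprime_left) (use unit_repsD(3)[OF S] in auto)
  ultimately show ?thesis using cong_mult_rcancel by blast
qed

text \<open>For an odd prime n and a prime to n this is the Legendre symbol of a times (-1)^((n-1)/2
  (d-1)/2), by \<open>gauss_floor_sum\<close> and Euler's criterion. The floor sum is the form in
  which it comes out of the transformation formula.\<close>

definition theta_sign :: "nat \<Rightarrow> int \<Rightarrow> int \<Rightarrow> int" where
  "theta_sign n a d = (if even n then 1
     else eps (int (card (even_units n)) * ((d - 1) div 2) + floor_sum n (even_units n) a))"

lemma theta_sign_abs: "theta_sign n a d = 1 \<or> theta_sign n a d = -1"
  by (simp add: theta_sign_def)

text \<open>For odd n = q k with q prime and k > 2 the totient of k is even, so the number of
  representatives is a multiple of q - 1. It is therefore even, and a to this power is 1 modulo q by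
  Fermat; Gauss's lemma then says that the sign is 1 modulo the odd prime q.\<close>

lemma theta_sign_composite:
  assumes n: "squarefree n" "n > 1" and p: "\<not> prime n" and a: "coprime a (int n)"
  shows "theta_sign n a d = 1"
proof (cases "even n")
  case False
  let ?S = "even_units n"
  let ?K = "card ?S"
  have S: "unit_reps_mod_pm1 n ?S" by (rule even_units_reps[OF False n(2)])
  obtain q where q: "prime q" "q dvd n" using n by (metis nat_neq_iff prime_factor_nat)
  then obtain k where k: "n = q * k" by auto
  have k0: "k > 0" using n k by (cases k) auto
  have ko: "odd k" "odd q" using False k by auto
  have k1: "k \<noteq> 1" using p q k by auto
  have k2: "k > 2" using k0 k1 ko(1) by (metis One_nat_def Suc_lessI even_numeral nat_neq_iff numeral_2_eq_2 less_Suc_eq less_one)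
  have "coprime q k"
  proof (rule ccontr)
    assume "\<not> coprime q k"
    then have "q dvd k" using q(1) prime_imp_coprime_nat by blast
    then have "q\<^sup>2 dvd n" by (auto simp: k power2_eq_square)
    then show False using n(1) q(1) by (metis not_prime_unit squarefreeD)
  qed
  then have "totient n = (q - 1) * totient k" using q(1) by (simp add: k totient_mult_coprime totient_prime)
  moreover have "even (totient k)" using k2 by (rule totient_even)
  then obtain j where j: "totient k = 2 * j" by auto
  have n2: "n > 2" using n(2) False by (metis even_numeral nat_neq_iff not_less_eq numeral_2_eq_2 One_nat_def Suc_lessI)
  ultimately have "2 * ?K = 2 * ((q - 1) * j)" using unit_reps_card[OF S n2] j by simp
  then have K: "?K = (q - 1) * j" by simp
  have "even (q - 1)" using ko(2) q(1) by simp
  then have Ke: "even ?K" unfolding K by simp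
  have qa: "\<not> int q dvd a"
  proof
    assume "int q dvd a"
    moreover have "int q dvd int n" using q(2) by simp
    ultimately have "is_unit (int q)" using a coprime_common_divisor by blast
    then show False using q(1) by (simp add: prime_int_nat_transfer)
  qed
  have "[a ^ (q - 1) = 1] (mod int q)"
    using fermat_theorem_of_int[OF _ qa] q(1) by simp
  then have "[(a ^ (q - 1)) ^ j = 1 ^ j] (mod int q)" by (rule cong_pow)
  then have aK: "[a ^ ?K = 1] (mod int q)" by (simp add: K power_mult)
  have "[eps (floor_sum n ?S a) * a ^ ?K = 1] (mod int q)"
    using cong_dvd_modulus[OF gauss_floor_sum[OF False n(2) a]] q(2) by simp
  then have "[eps (floor_sum n ?S a) * 1 = 1] (mod int q)"
    using cong_scalar_left[OF aK] cong_sym cong_trans by metis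
  moreover have "\<not> [- 1 = 1] (mod int q)"
  proof
    assume "[- 1 = 1] (mod int q)"
    then have "int q dvd 2" by (simp add: cong_iff_dvd_diff)
    then have "q dvd 2" by presburger
    then show False using ko(2) q(1) by (metis dvd_refl primes_dvd_imp_eq two_is_prime_nat)
  qed
  ultimately have "even (floor_sum n ?S a)" by (auto split: if_splits)
  then show ?thesis using Ke by (simp add: theta_sign_def)
qed (simp add: theta_sign_def)

text \<open>As a d is 1 modulo n, a (d - a) is 1 - a^2 there, and
  \<open>unit_reps_square_sum\<close> applies with u = a. This clears the denominator n of the
  quadratic term in the multiplier.\<close>

lemma dvd_diff_square_sum:
  assumes S: "unit_reps_mod_pm1 n S" and det: "a * d - b * int n * c = 1"
  shows "int n dvd (d - a) * (\<Sum>\<alpha>\<in>S. \<alpha>\<^sup>2)"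
proof -
  let ?Q = "\<Sum>\<alpha>\<in>S. \<alpha>\<^sup>2"
  have a: "coprime a (int n)"
  proof (rule coprimeI)
    fix x assume "x dvd a" "x dvd int n"
    then have "x dvd a * d - b * int n * c" by (intro dvd_diff dvd_mult2 dvd_mult)
    then show "is_unit x" using det by simp
  qed
  have "int n dvd (b * c * ?Q) * int n - (a\<^sup>2 - 1) * ?Q"
    using unit_reps_square_sum[OF S a] by (intro dvd_diff) auto
  also have "(b * c * ?Q) * int n - (a\<^sup>2 - 1) * ?Q = a * ((d - a) * ?Q)"
  proof -
    have "a * d = 1 + b * int n * c" using det by simp
    then have "a * d * ?Q = (1 + b * int n * c) * ?Q" by simp
    then show ?thesis by (simp add: algebra_simps power2_eq_square)
  qed
  finally show ?thesis using a by (simp add: coprime_commute coprime_dvd_mult_right_iff)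
qed

text \<open>The exponent is what the multiplier of a product over representatives leaves after the
  multiples of the two orders are split off. Its middle term is an integer: n divides (d - a) Q, and
  the factor 2 comes from the representatives being even.\<close>

lemma theta_sign_odd:
  assumes n: "odd n" "n > 1" and d: "odd d" and det: "a * d - b * int n * c = 1"
  defines "S \<equiv> even_units n"
  shows "ee (of_real (of_int (int (card S) * (d - 1)) / 4 - of_int (b * (d - a) * (\<Sum>\<alpha>\<in>S. \<alpha>\<^sup>2)) / (2 * of_nat n)
     + of_int (floor_sum n S a) / 2)) = of_int (theta_sign n a d)"
proof -
  let ?Q = "\<Sum>\<alpha>\<in>S. \<alpha>\<^sup>2" and ?T = "floor_sum n S a"
  have S: "unit_reps_mod_pm1 n S" unfolding S_def by (rule even_units_reps[OF n])
  obtain V where V: "(d - a) * ?Q = int n * V" using dvd_diff_square_sum[OF S det] by auto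
  have "even ?Q" by (rule dvd_sum) (auto simp: S_def even_units_def)
  then have "even (int n * V)" unfolding V[symmetric] by simp
  then obtain U where U: "V = 2 * U" using n(1) by auto
  obtain j where j: "d = 2 * j + 1" using d by (auto elim!: oddE)
  have "of_int (b * (d - a) * ?Q) = (2 * of_nat n * of_int (b * U) :: real)"
    using V U by (simp add: mult.assoc flip: of_int_mult) (simp add: algebra_simps)
  then have "of_int (int (card S) * (d - 1)) / 4 - of_int (b * (d - a) * ?Q) / (2 * of_nat n) + of_int ?T / 2 =
     (of_int (int (card S) * j + ?T) / 2 - of_int (b * U) :: real)"
    using n by (simp add: j field_simps)
  then have "ee (of_real (of_int (int (card S) * (d - 1)) / 4 - of_int (b * (d - a) * ?Q) / (2 * of_nat n) + of_int ?T / 2))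
     = ee (of_int (int (card S) * j + ?T) / 2)"
    by (intro ee_cong) simp
  then show ?thesis unfolding ee_half_int using n(1) by (simp add: theta_sign_def S_def j)
qed

text \<open>The same exponent as in \<open>theta_sign_odd\<close>. Now n is twice an odd number and
  the representatives are odd, so Q is congruent modulo 4 to their number K. Over the denominator 4
  the exponent is K (d - 1) - 2 V + 2 T, where 2 T and 2 V are congruent modulo 4 to (a - 1) K and b
  (d - a) K.\<close>

lemma theta_sign_even:
  assumes n: "even n" "squarefree n" "n > 0" and S: "unit_reps_mod_pm1 n S"
    and d: "odd d" and det: "a * d - b * int n * c = 1"
  shows "ee (of_real (of_int (int (card S) * (d - 1)) / 4 - of_int (b * (d - a) * (\<Sum>\<alpha>\<in>S. \<alpha>\<^sup>2)) / (2 * of_nat n)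
     + of_int (floor_sum n S a) / 2)) = 1"
proof -
  define K where "K = int (card S)"
  define Q where "Q = (\<Sum>\<alpha>\<in>S. \<alpha>\<^sup>2)" define T where "T = floor_sum n S a"
  obtain n' where n': "int n = 2 * n'" using n(1) by (metis dvd_def int_dvd_int_iff of_nat_numeral even_of_nat_iff)
  have "odd n'"
  proof
    assume "even n'"
    then have "2\<^sup>2 dvd int n" by (auto simp: n')
    then have "int (2\<^sup>2) dvd int n" by simp
    then have "(2::nat)\<^sup>2 dvd n" by (simp only: int_dvd_int_iff)
    then show False using n(2) by (metis squarefreeD nat_dvd_1_iff_1 numeral_eq_one_iff semiring_norm(85))
  qed
  then obtain i where i: "n' = 2 * i + 1" by (auto elim!: oddE)
  obtain V where V: "b * ((d - a) * Q) = int n * V"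
    using dvd_diff_square_sum[OF S det] unfolding Q_def[symmetric] by (metis dvd_def dvd_mult)
  have odd: "odd \<alpha>" if "\<alpha> \<in> S" for \<alpha>
  proof
    assume "even \<alpha>"
    moreover have "even (int n)" using n(1) by simp
    ultimately have "is_unit (2::int)" using unit_repsD(3)[OF S that] coprime_common_divisor by blast
    then show False by simp
  qed
  have ao: "odd a"
  proof
    assume "even a"
    then have "even (a * d - b * int n * c)" using n(1) by simp
    then show False using det by simp
  qed
  have "[Q = (\<Sum>\<alpha>\<in>S. 1)] (mod 4)"
    unfolding Q_def
  proof (rule cong_sum)
    fix \<alpha> assume "\<alpha> \<in> S"
    then obtain j where j: "\<alpha> = 2 * j + 1" using odd by (auto elim!: oddE)
    have "\<alpha>\<^sup>2 - 1 = 4 * (j * (j + 1))" by (simp add: j algebra_simps power2_eq_square)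
    then show "[\<alpha>\<^sup>2 = 1] (mod 4)" by (simp add: cong_iff_dvd_diff)
  qed
  then have Q: "[Q = K] (mod 4)" by (simp add: K_def)
  \<comment> \<open>A change of sign replaces a residue z by n - z, and n - 2 z is divisible by 4
    because n/2 and z are odd. So modulo 4 the sum of residues depends on the classes only.\<close>
  have "[(\<Sum>\<alpha>\<in>S. (a * \<alpha>) mod int n) = (\<Sum>\<alpha>\<in>S. \<alpha> mod int n)] (mod 4)"
  proof (rule unit_reps_sum_cong[OF S])
    show "coprime a (int n)"
    proof (rule coprimeI)
      fix x assume "x dvd a" "x dvd int n"
      then have "x dvd a * d - b * int n * c" by (intro dvd_diff dvd_mult2 dvd_mult)
      then show "is_unit x" using det by simp
    qed
    fix x y :: int assume y: "coprime y (int n)" and xy: "[x = y] (mod int n) \<or> [x = - y] (mod int n)"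
    show "[x mod int n = y mod int n] (mod 4)"
    proof (cases "[x = y] (mod int n)")
      case False
      then have xy: "[x = - y] (mod int n)" using xy by blast
      define z where "z = y mod int n"
      have cz: "coprime z (int n)" using y n(3) by (simp add: z_def)
      have zo: "odd z"
      proof
        assume "even z"
        moreover have "even (int n)" using n(1) by simp
        ultimately have "is_unit (2::int)" using cz coprime_common_divisor by blast
        then show False by simp
      qed
      then have "z \<noteq> 0" by auto
      have "x mod int n = int n - z"
        using xy \<open>z \<noteq> 0\<close> zmod_zminus1_eq_if[of y "int n"] unfolding cong_def z_def by simp
      moreover obtain j where j: "z = 2 * j + 1" using zo by (auto elim!: oddE)
      ultimately have "x mod int n - y mod int n = 4 * (i - j)"
        unfolding z_def[symmetric] using n' i by (simp only: z_def[symmetric]) simp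
      then show ?thesis by (simp add: cong_iff_dvd_diff)
    qed (simp add: cong_def)
  qed
  also have "(\<Sum>\<alpha>\<in>S. \<alpha> mod int n) = \<Sum>S"
  proof (rule sum.cong[OF refl])
    show "\<alpha> mod int n = \<alpha>" if "\<alpha> \<in> S" for \<alpha>
      using unit_repsD[OF S that] by simp
  qed
  finally have 1: "4 dvd (\<Sum>\<alpha>\<in>S. (a * \<alpha>) mod int n) - \<Sum>S" by (simp add: cong_iff_dvd_diff)
  have 2: "a * \<Sum>S = int n * T + (\<Sum>\<alpha>\<in>S. (a * \<alpha>) mod int n)"
    unfolding T_def sum_distrib_left sum.distrib[symmetric] by simp
  have "[\<Sum>S = (\<Sum>\<alpha>\<in>S. 1)] (mod 2)"
    by (rule cong_sum) (use odd in \<open>auto simp: cong_def odd_iff_mod_2_eq_one\<close>)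
  then have "2 dvd \<Sum>S - K" by (simp add: K_def cong_iff_dvd_diff)
  then obtain g where "\<Sum>S - K = 2 * g" unfolding dvd_def by blast
  then have g: "\<Sum>S = K + 2 * g" by simp
  obtain j where j: "a = 2 * j + 1" using ao by (auto elim!: oddE)
  obtain k where k: "d = 2 * k + 1" using d by (auto elim!: oddE)
  from 1 obtain w where "(\<Sum>\<alpha>\<in>S. (a * \<alpha>) mod int n) - \<Sum>S = 4 * w" unfolding dvd_def by blast
  then have w: "(\<Sum>\<alpha>\<in>S. (a * \<alpha>) mod int n) = \<Sum>S + 4 * w" by simp
  have T: "4 dvd 2 * T - (a - 1) * K"
  proof -
    have 2: "a * \<Sum>S = int n * T + (\<Sum>S + 4 * w)" using 2 w by simp
    have "2 * T - (a - 1) * K = 4 * (j * g - w - i * T)" using 2 unfolding g n' i j by (simp add: algebra_simps)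
    then show ?thesis by simp
  qed
  have VV: "4 dvd 2 * V - b * (d - a) * K"
  proof -
    from Q obtain x where "Q - K = 4 * x" unfolding cong_iff_dvd_diff dvd_def by blast
    then have x: "Q = K + 4 * x" by simp
    have "2 * V - b * (d - a) * K = 4 * (b * (d - a) * x - i * V)" using V unfolding x n' i by (simp add: algebra_simps)
    then show ?thesis by simp
  qed
  \<comment> \<open>With a = 2 j + 1 and d = 2 k + 1 the determinant gives j + k \<equiv> b c modulo
    2. For even b both parts are even; for odd b the numbers j + k and k - j have equal
    parity.\<close>
  have "4 dvd (a + d - 2) - b * (d - a)"
  proof -
    have e: "(2 * j + 1) * (2 * k + 1) - b * (2 * (2 * i + 1)) * c = 1" using det unfolding n' i j k .
    then have "2 * (2 * (j * k) + j + k) = 2 * (b * c + 2 * (b * c * i))" by (simp add: algebra_simps)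
    then have e2: "j + k = b * c + 2 * (b * c * i - j * k)" by simp
    have "even ((j + k) - b * (k - j))"
    proof (cases "even b")
      case True then show ?thesis unfolding e2 by simp
    next
      case False then show ?thesis by auto
    qed
    then obtain y where "(j + k) - b * (k - j) = 2 * y" by blast
    moreover have "(a + d - 2) - b * (d - a) = 2 * ((j + k) - b * (k - j))" by (simp add: j k algebra_simps)
    ultimately have "(a + d - 2) - b * (d - a) = 4 * y" by simp
    then show ?thesis unfolding dvd_def by blast
  qed
  from dvd_diff[OF dvd_add[OF dvd_mult[OF this] T] VV]
  have "4 dvd K * ((a + d - 2) - b * (d - a)) + (2 * T - (a - 1) * K) - (2 * V - b * (d - a) * K)" .
  also have "K * ((a + d - 2) - b * (d - a)) + (2 * T - (a - 1) * K) - (2 * V - b * (d - a) * K) = K * (d - 1) - 2 * V + 2 * T"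
    by (simp add: algebra_simps)
  finally obtain z where z: "K * (d - 1) - 2 * V + 2 * T = 4 * z" by auto
  have "of_int (b * (d - a) * Q) / (2 * of_nat n) = (of_int V / 2 :: real)"
    using n(3) unfolding mult.assoc V by simp
  then have "of_int (K * (d - 1)) / 4 - of_int (b * (d - a) * Q) / (2 * of_nat n) + of_int T / 2 =
     (of_int (K * (d - 1) - 2 * V + 2 * T) / 4 :: real)" by (simp only:) simp
  also have "\<dots> = of_int z" unfolding z by simp
  finally show ?thesis unfolding K_def Q_def T_def by (simp only: of_real_of_int_eq ee_int)
qed

section \<open>Congruences modulo the square of a prime and Fermat quotients\<close>

lemma binomial_cong_square: "y\<^sup>2 dvd (x + y) ^ q - x ^ q - of_nat q * y * x ^ (q - 1)" for x y :: int
proof (induction q)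
  case (Suc q)
  show ?case
  proof (cases "q = 0")
    case False
    have "(x + y) ^ Suc q - x ^ Suc q - of_nat (Suc q) * y * x ^ (Suc q - 1) =
      (x + y) * ((x + y) ^ q - x ^ q - of_nat q * y * x ^ (q - 1)) + y\<^sup>2 * (of_nat q * x ^ (q - 1))"
      using False by (cases q) (simp_all add: algebra_simps power2_eq_square)
    then show ?thesis using Suc by (metis dvd_add dvd_mult dvd_triv_left)
  qed simp
qed simp

text \<open>
  Raising \<open>a * \<alpha> = n * t + \<alpha>'\<close> to the power \<open>p - 1\<close> modulo \<open>p\<^sup>2\<close> expresses the quotient \<open>t\<close> through
  the Fermat quotients of \<open>a\<close>, \<open>\<alpha>\<close> and \<open>\<alpha>'\<close>; the last two cancel in the sum.
\<close>
lemma fermat_quotient_sum: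
  assumes S: "unit_reps_mod_pm1 n S" and n: "n > 1" and p: "prime p" "odd p" "p dvd n"
    and a: "coprime a (int n)" and ad: "[a * d = 1] (mod int p)"
  shows "[int n * (\<Sum>\<alpha>\<in>S. inv_mod n \<alpha> * (1 - d) - 2 * ((a * \<alpha>) div int n) * d * inv_mod n \<alpha>) =
     2 * int (card S) * (a ^ (p - 1) - 1)] (mod (int p)\<^sup>2)"
proof -
  define P where "P = int p"
  have P: "P dvd int n" using p(3) by (simp add: P_def)
  have P2n: "P\<^sup>2 dvd int n * x" if "P dvd x" for x using mult_dvd_mono[OF P that] by (simp add: power2_eq_square)
  have p3: "p \<ge> 3" using p by (metis even_numeral Suc_leI le_neq_implies_less numeral_2_eq_2 numeral_3_eq_3 prime_ge_2_nat)
  have ep: "even (p - 1)" "odd (p - 2)" using p(2) p3 by auto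
  have fermat: "[x ^ (p - 1) = 1] (mod P)" if "coprime x (int n)" for x
  proof -
    have "\<not> int p dvd x"
    proof
      assume "int p dvd x"
      then have "is_unit (int p)" using that P coprime_common_divisor unfolding P_def by blast
      then show False using p3 by simp
    qed
    then show ?thesis using fermat_theorem_of_int[of p x] p(1) by (simp add: P_def)
  qed
  have inv: "[x ^ (p - 2) = y] (mod P)" if "coprime x (int n)" "[x * y = 1] (mod P)" for x y
  proof -
    have "p - 1 = Suc (p - 2)" using p3 by simp
    then have "[x * x ^ (p - 2) = 1] (mod P)" using fermat[OF that(1)] by simp
    then show ?thesis using inverse_cong_unique[OF _ that(2) cong_refl] by blast
  qed
  \<comment> \<open>The second term is the first-order correction that makes \<open>R\<close>
    invariant modulo p^2 when x is replaced by n - x. So the sum of \<open>R\<close> over the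
    representatives does not change under multiplication by a.\<close>
  define R where "R = (\<lambda>x. 2 * x ^ (p - 1) + int n * x ^ (p - 2))"
  have bin: "[(x + int n * t) ^ (p - 1) = x ^ (p - 1) - int n * t * x ^ (p - 2)] (mod P\<^sup>2)" for x t
  proof -
    have "P\<^sup>2 dvd (int n * t)\<^sup>2" using P by (intro dvd_power_same dvd_mult2)
    then have "P\<^sup>2 dvd (x + int n * t) ^ (p - 1) - x ^ (p - 1) - of_nat (p - 1) * (int n * t) * x ^ (p - 1 - 1)"
      using binomial_cong_square dvd_trans by blast
    moreover have "P\<^sup>2 dvd int n * (P * (t * x ^ (p - 2)))" by (intro P2n dvd_triv_left)
    ultimately have "P\<^sup>2 dvd ((x + int n * t) ^ (p - 1) - x ^ (p - 1) - of_nat (p - 1) * (int n * t) * x ^ (p - 1 - 1))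
       + int n * (P * (t * x ^ (p - 2)))" by (rule dvd_add)
    also have "\<dots> = (x + int n * t) ^ (p - 1) - (x ^ (p - 1) - int n * t * x ^ (p - 2))"
      using p3 by (simp add: P_def of_nat_diff algebra_simps numeral_2_eq_2)
    finally show ?thesis by (simp add: cong_iff_dvd_diff)
  qed
  have R: "[R (int n - x) = R x] (mod P\<^sup>2)" for x
  proof -
    have "(int n - x) ^ (p - 1) = (x + int n * (- 1)) ^ (p - 1)"
      using ep(1) by (metis add.commute minus_diff_eq mult_minus1_right power_minus_even uminus_add_conv_diff)
    then have "[(int n - x) ^ (p - 1) = x ^ (p - 1) + int n * x ^ (p - 2)] (mod P\<^sup>2)"
      using bin[of x "- 1"] by simp
    then have 1: "P\<^sup>2 dvd 2 * ((int n - x) ^ (p - 1) - (x ^ (p - 1) + int n * x ^ (p - 2)))"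
      unfolding cong_iff_dvd_diff by (rule dvd_mult)
    have "[int n - x = - x] (mod P)" using P by (simp add: cong_iff_dvd_diff)
    then have "[(int n - x) ^ (p - 2) = (- x) ^ (p - 2)] (mod P)" by (rule cong_pow)
    then have "P dvd (int n - x) ^ (p - 2) + x ^ (p - 2)" using ep(2) by (simp add: cong_iff_dvd_diff)
    then have "P\<^sup>2 dvd int n * ((int n - x) ^ (p - 2) + x ^ (p - 2))" by (rule P2n)
    with 1 have "P\<^sup>2 dvd 2 * ((int n - x) ^ (p - 1) - (x ^ (p - 1) + int n * x ^ (p - 2))) +
        int n * ((int n - x) ^ (p - 2) + x ^ (p - 2))" by (rule dvd_add)
    then show ?thesis by (simp add: R_def cong_iff_dvd_diff algebra_simps)
  qed
  have sum: "[(\<Sum>\<alpha>\<in>S. R ((a * \<alpha>) mod int n)) = (\<Sum>\<alpha>\<in>S. R (\<alpha> mod int n))] (mod P\<^sup>2)"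
  proof (rule unit_reps_sum_cong[OF S a])
    fix x y :: int assume y: "coprime y (int n)" and xy: "[x = y] (mod int n) \<or> [x = - y] (mod int n)"
    show "[R (x mod int n) = R (y mod int n)] (mod P\<^sup>2)"
    proof (cases "[x = y] (mod int n)")
      case False
      then have xy: "[x = - y] (mod int n)" using xy by blast
      have "y mod int n \<noteq> 0" using y n by (metis coprime_0_left_iff coprime_mod_left_iff int_ops(2) not_less_iff_gr_or_eq of_nat_0_eq_iff of_nat_eq_1_iff not_one_less_zero zdvd1_eq abs_of_nat less_numeral_extra(3))
      then have "x mod int n = int n - y mod int n"
        using xy zmod_zminus1_eq_if[of y "int n"] unfolding cong_def by simp
      then show ?thesis using R by simp
    qed (simp add: cong_def)
  qed
  have pointwise: "[int n * (inv_mod n \<alpha> * (1 - d) - 2 * ((a * \<alpha>) div int n) * d * inv_mod n \<alpha>) =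
      R (\<alpha> mod int n) - R ((a * \<alpha>) mod int n) + 2 * (a ^ (p - 1) - 1)] (mod P\<^sup>2)" if \<alpha>S: "\<alpha> \<in> S" for \<alpha>
  proof -
    define t where "t = (a * \<alpha>) div int n"
    define \<beta> where "\<beta> = (a * \<alpha>) mod int n"
    define \<delta> where "\<delta> = inv_mod n \<alpha>"
    have e: "a * \<alpha> = \<beta> + int n * t" by (simp add: t_def \<beta>_def)
    have c: "coprime \<alpha> (int n)" by (rule unit_repsD(3)[OF S \<alpha>S])
    have c\<beta>: "coprime \<beta> (int n)" using a c n by (simp add: \<beta>_def)
    have \<alpha>n: "\<alpha> mod int n = \<alpha>" using unit_repsD[OF S \<alpha>S] by simp
    have \<alpha>\<delta>: "[\<alpha> * \<delta> = 1] (mod P)" using inv_mod[OF c] P cong_dvd_modulus unfolding \<delta>_def by blast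
    have "[\<beta> = a * \<alpha>] (mod P)" using P by (simp add: e cong_iff_dvd_diff)
    then have "[\<beta> * (d * \<delta>) = a * \<alpha> * (d * \<delta>)] (mod P)" by (rule cong_scalar_right)
    moreover have "[(a * d) * (\<alpha> * \<delta>) = 1 * 1] (mod P)" using ad \<alpha>\<delta> unfolding P_def by (rule cong_mult)
    ultimately have \<beta>\<delta>: "[\<beta> * (d * \<delta>) = 1] (mod P)" by (metis cong_trans mult.assoc mult.left_commute mult_1)
    have d1: "P dvd \<alpha> ^ (p - 2) - \<delta>" using inv[OF c \<alpha>\<delta>] by (simp add: cong_iff_dvd_diff)
    have d2: "P dvd \<beta> ^ (p - 2) - d * \<delta>" using inv[OF c\<beta> \<beta>\<delta>] by (simp add: cong_iff_dvd_diff)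
    \<comment> \<open>The binomial expansion gives z x \<equiv> y - n t v modulo p^2. As p divides z
      - 1 and x - 1, the product z x may be replaced by z + x - 1, which separates the Fermat
      quotients of a, \<alpha> and \<beta>.\<close>
    define u where "u = \<alpha> ^ (p - 2)" define v where "v = \<beta> ^ (p - 2)"
    define x where "x = \<alpha> ^ (p - 1)" define y where "y = \<beta> ^ (p - 1)" define z where "z = a ^ (p - 1)"
    have "P\<^sup>2 dvd (a * \<alpha>) ^ (p - 1) - (y - int n * t * v)"
      using bin[of \<beta> t] unfolding e y_def v_def by (simp add: cong_iff_dvd_diff)
    then have b: "P\<^sup>2 dvd z * x - (y - int n * t * v)" by (simp add: z_def x_def power_mult_distrib)
    have "P dvd z - 1" "P dvd x - 1"
      using fermat[OF a] fermat[OF c] by (simp_all add: cong_iff_dvd_diff z_def x_def)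
    then have "P\<^sup>2 dvd (z - 1) * (x - 1)" unfolding power2_eq_square by (rule mult_dvd_mono)
    then have "P\<^sup>2 dvd (- int n * (u - \<delta>) + int n * ((1 + 2 * t) * (v - d * \<delta>)) - 2 * (z * x - (y - int n * t * v)))
        + 2 * ((z - 1) * (x - 1))"
      using P2n[OF d1] P2n[OF dvd_mult[OF d2, of "1 + 2 * t"]] dvd_mult[OF b, of 2] unfolding u_def v_def
      by (intro dvd_add dvd_diff) (simp_all only: dvd_mult minus_mult_left[symmetric] dvd_minus_iff)
    also have "\<dots> = int n * (\<delta> * (1 - d) - 2 * t * d * \<delta>) - ((2 * x + int n * u) - (2 * y + int n * v) + 2 * (z - 1))"
      by (simp add: algebra_simps)
    finally show ?thesis
      unfolding \<alpha>n R_def \<beta>_def[symmetric] t_def[symmetric] \<delta>_def[symmetric]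
      by (simp add: cong_iff_dvd_diff u_def v_def x_def y_def z_def)
  qed
  have "[(\<Sum>\<alpha>\<in>S. int n * (inv_mod n \<alpha> * (1 - d) - 2 * ((a * \<alpha>) div int n) * d * inv_mod n \<alpha>)) =
     (\<Sum>\<alpha>\<in>S. R (\<alpha> mod int n) - R ((a * \<alpha>) mod int n) + 2 * (a ^ (p - 1) - 1))] (mod P\<^sup>2)"
    by (rule cong_sum) (rule pointwise)
  also have "(\<Sum>\<alpha>\<in>S. R (\<alpha> mod int n) - R ((a * \<alpha>) mod int n) + 2 * (a ^ (p - 1) - 1)) =
     (\<Sum>\<alpha>\<in>S. R (\<alpha> mod int n)) - (\<Sum>\<alpha>\<in>S. R ((a * \<alpha>) mod int n)) + 2 * int (card S) * (a ^ (p - 1) - 1)"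
    by (simp add: sum.distrib sum_subtractf)
  also have "[\<dots> = (\<Sum>\<alpha>\<in>S. R (\<alpha> mod int n)) - (\<Sum>\<alpha>\<in>S. R (\<alpha> mod int n)) + 2 * int (card S) * (a ^ (p - 1) - 1)] (mod P\<^sup>2)"
    by (intro cong_add cong_diff sum cong_refl)
  finally show ?thesis by (simp add: sum_distrib_left P_def)
qed

section \<open>Transformation of the products over representatives\<close>

text \<open>The function F_{m,h} as a function of N' \<tau>, apart from the square root for n = 2.
  Here k stands for h/2 modulo the odd number l.\<close>

definition Gf :: "nat \<Rightarrow> nat \<Rightarrow> int set \<Rightarrow> int \<Rightarrow> complex \<Rightarrow> complex" where
  "Gf n l S k \<tau> = (\<Prod>\<alpha>\<in>S. Ef (of_int \<alpha> / of_nat n) (of_int (2 * (inv_mod n \<alpha> * k)) / of_nat l) \<tau>)"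

lemma Ef_cong_right:
  assumes "[x = y] (mod int l)" "l > 0"
  shows "Ef v (of_int (2 * (x * k)) / of_nat l) \<tau> = Ef v (of_int (2 * (y * k)) / of_nat l) \<tau>"
proof -
  obtain z where "x - y = int l * z" using assms(1) by (auto simp: cong_iff_dvd_diff)
  then have "x = y + int l * z" by simp
  then have "(of_int (2 * (x * k)) / of_nat l :: real) = of_int (2 * (y * k)) / of_nat l + of_int (2 * z * k)"
    using assms(2) by (simp add: field_simps)
  then show ?thesis by (simp only: Ef_add_right)
qed

text \<open>The factor of \<open>Gf\<close> extended to all integers x by reduction modulo n, so
  that it depends only on the class of x up to sign and the product can be reindexed.\<close>

definition Gf_factor :: "nat \<Rightarrow> nat \<Rightarrow> int \<Rightarrow> complex \<Rightarrow> int \<Rightarrow> complex" where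
  "Gf_factor n l k \<tau> x = Ef (of_int (x mod int n) / of_nat n) (of_int (2 * (inv_mod n x * k)) / of_nat l) \<tau>"

lemma Gf_factor_pm:
  assumes n: "n > 1" and l: "l dvd n" and \<tau>: "Im \<tau> > 0"
    and y: "coprime y (int n)" and xy: "[x = y] (mod int n) \<or> [x = - y] (mod int n)"
  shows "Gf_factor n l k \<tau> x = Gf_factor n l k \<tau> y"
proof -
  have l0: "l > 0" using n l by (auto intro!: gr0I)
  have ln: "int l dvd int n" using l by simp
  from inv_mod_pm[OF y xy] show ?thesis
  proof
    assume as: "[x = y] (mod int n) \<and> [inv_mod n x = inv_mod n y] (mod int n)"
    have "x mod int n = y mod int n" using as unfolding cong_def by blast
    then show ?thesis unfolding Gf_factor_def
      by (simp only: Ef_cong_right[OF cong_dvd_modulus[OF conjunct2[OF as] ln] l0])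
  next
    assume as: "[x = - y] (mod int n) \<and> [inv_mod n x = - inv_mod n y] (mod int n)"
    have "\<not> int n dvd y"
    proof
      assume "int n dvd y"
      then have "is_unit (int n)" using coprime_common_divisor[OF y _ dvd_refl] by simp
      then show False using n by simp
    qed
    then have "y mod int n \<noteq> 0" by (simp add: dvd_eq_mod_eq_0)
    then have "x mod int n = int n - y mod int n"
      using as zmod_zminus1_eq_if[of y "int n"] unfolding cong_def by simp
    then have 1: "of_int (x mod int n) / of_nat n = 1 - (of_int (y mod int n) / of_nat n :: real)"
      using n by (simp add: field_simps)
    have "[inv_mod n x = - inv_mod n y] (mod int l)" by (rule cong_dvd_modulus[OF conjunct2[OF as] ln])
    then have "Gf_factor n l k \<tau> x = Ef (of_int (x mod int n) / of_nat n) (of_int (2 * (- inv_mod n y * k)) / of_nat l) \<tau>"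
      unfolding Gf_factor_def by (rule Ef_cong_right[OF _ l0])
    also have "\<dots> = Ef (1 - (of_int (y mod int n) / of_nat n)) (- (of_int (2 * (inv_mod n y * k)) / of_nat l)) \<tau>"
      unfolding 1 by simp
    finally show ?thesis unfolding Ef_reflect[OF \<tau>] Gf_factor_def .
  qed
qed

lemma Gf_eq_factor:
  assumes S: "unit_reps_mod_pm1 n S"
  shows "Gf n l S k \<tau> = (\<Prod>\<alpha>\<in>S. Gf_factor n l k \<tau> \<alpha>)"
  unfolding Gf_def Gf_factor_def
proof (rule prod.cong[OF refl])
  fix \<alpha> assume "\<alpha> \<in> S"
  from unit_repsD[OF S this] have "\<alpha> mod int n = \<alpha>" by simp
  then show "Ef (of_int \<alpha> / of_nat n) (of_int (2 * (inv_mod n \<alpha> * k)) / of_nat l) \<tau> =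
    Ef (of_int (\<alpha> mod int n) / of_nat n) (of_int (2 * (inv_mod n \<alpha> * k)) / of_nat l) \<tau>" by simp
qed

lemma Gf_reps_indep:
  assumes S: "unit_reps_mod_pm1 n S" and S': "unit_reps_mod_pm1 n S'" and n: "n > 1" and l: "l dvd n" and \<tau>: "Im \<tau> > 0"
  shows "Gf n l S k \<tau> = Gf n l S' k \<tau>"
  unfolding Gf_eq_factor[OF S] Gf_eq_factor[OF S']
  using unit_reps_prod[OF S S' _ Gf_factor_pm[OF n l \<tau>], of 1] by simp

lemma ee_sum: "finite A \<Longrightarrow> ee (\<Sum>x\<in>A. f x) = (\<Prod>x\<in>A. ee (f x))"
  by (induction A rule: finite_induct) (auto simp: ee_add)

definition lin_sum :: "nat \<Rightarrow> int set \<Rightarrow> int \<Rightarrow> int \<Rightarrow> int" where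
  "lin_sum n S a d = (\<Sum>\<alpha>\<in>S. inv_mod n \<alpha> * (1 - d) - 2 * ((a * \<alpha>) div int n) * d * inv_mod n \<alpha>)"

definition inv_square_sum :: "nat \<Rightarrow> int set \<Rightarrow> int" where
  "inv_square_sum n S = (\<Sum>\<alpha>\<in>S. (inv_mod n \<alpha>)\<^sup>2)"

text \<open>This is 6 n^2 times the sum of B2 (\<alpha>/n), which governs the order at
  infinity.\<close>

definition bernoulli_sum :: "nat \<Rightarrow> int set \<Rightarrow> int" where
  "bernoulli_sum n S = (\<Sum>\<alpha>\<in>S. 6 * \<alpha>\<^sup>2 - 6 * \<alpha> * int n + (int n)\<^sup>2)"

lemma coprime_of_det: "a * d - b * (m * n * l * c) = 1 \<Longrightarrow> coprime a (n::int)"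
proof (rule coprimeI)
  fix x assume det: "a * d - b * (m * n * l * c) = 1" and "x dvd a" "x dvd n"
  then have "x dvd a * d - b * (m * n * l * c)" by (intro dvd_diff) auto
  then show "is_unit x" using det by simp
qed

text \<open>Each factor is transformed by \<open>Ef_Gamma0\<close> with \<alpha>' the residue of a
  \<alpha>. Since d is inverse to a modulo n, the new second characteristic is the one attached to a
  \<alpha>, so the factors are merely permuted.\<close>

lemma Gf_Gamma0:
  fixes m :: nat
  assumes S: "unit_reps_mod_pm1 n S" and n: "n > 1" and l: "l dvd n"
    and det: "a * d - b * (int m * int n * int l * c) = 1" and \<tau>: "Im \<tau> > 0"
  shows "Gf n l S k (moebius a (b * int m * int n) (c * int l) d \<tau>) =
    ee (of_real (of_int (int (card S) * Phi a (b * int m * int n) (c * int l) d) / 12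
      + (of_int (a * b * int m * (\<Sum>\<alpha>\<in>S. \<alpha>\<^sup>2)) / of_nat n - of_int (b * int m * \<Sum>S) + of_int (floor_sum n S a)) / 2
      + of_int (k * lin_sum n S a d - 2 * c * d * k\<^sup>2 * inv_square_sum n S) / of_nat l)) * Gf n l S k \<tau>"
proof -
  have l0: "l > 0" using n l by (auto intro!: gr0I)
  have ln: "int l dvd int n" using l by simp
  have fin: "finite S" by (rule unit_reps_finite[OF S])
  have a: "coprime a (int n)" by (rule coprime_of_det[OF det])
  define \<Phi> where "\<Phi> = Phi a (b * int m * int n) (c * int l) d"
  define X where "X = (\<lambda>\<alpha>. (of_int \<Phi> / 12
      + (of_int (a * b * int m * \<alpha>\<^sup>2) / of_nat n - of_int (b * int m * \<alpha>) + of_int ((a * \<alpha>) div int n)) / 2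
      + of_int ((inv_mod n \<alpha> * k) * (1 - d) - 2 * c * d * (inv_mod n \<alpha> * k)\<^sup>2
          - 2 * ((a * \<alpha>) div int n) * d * (inv_mod n \<alpha> * k)) / of_nat l :: real))"
  have "Ef (of_int \<alpha> / of_nat n) (of_int (2 * (inv_mod n \<alpha> * k)) / of_nat l) (moebius a (b * int m * int n) (c * int l) d \<tau>) =
      ee (of_real (X \<alpha>)) * Gf_factor n l k \<tau> (a * \<alpha>)" if \<alpha>: "\<alpha> \<in> S" for \<alpha>
  proof -
    have c\<alpha>: "coprime \<alpha> (int n)" by (rule unit_repsD(3)[OF S \<alpha>])
    have 1: "Ef (of_int \<alpha> / of_int (int n)) (of_int (2 * (inv_mod n \<alpha> * k)) / of_int (int l)) (moebius a (b * int m * int n) (c * int l) d \<tau>) =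
       ee (of_real (X \<alpha>)) * Ef (of_int ((a * \<alpha>) mod int n) / of_int (int n)) (of_int (2 * d * (inv_mod n \<alpha> * k)) / of_int (int l)) \<tau>"
      unfolding X_def \<Phi>_def
      using Ef_Gamma0[OF det _ _ \<tau>, of \<alpha> "(a * \<alpha>) div int n" "(a * \<alpha>) mod int n" "inv_mod n \<alpha> * k"] n l0
      by simp
    have "[inv_mod n (a * \<alpha>) = d * inv_mod n \<alpha>] (mod int n)"
    proof (rule inverse_cong_unique[OF inv_mod _ cong_refl])
      show "coprime (a * \<alpha>) (int n)" using a c\<alpha> by simp
      have "int n dvd a * d - 1" using det by (metis add_diff_cancel_left' diff_add_cancel dvd_mult dvd_triv_right dvd_mult2 mult.commute)
      then have "[a * d = 1] (mod int n)" by (simp add: cong_iff_dvd_diff)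
      then have "[(a * d) * (\<alpha> * inv_mod n \<alpha>) = 1 * 1] (mod int n)" using inv_mod[OF c\<alpha>] by (rule cong_mult)
      then show "[a * \<alpha> * (d * inv_mod n \<alpha>) = 1] (mod int n)" by (simp add: mult_ac)
    qed
    then have "[inv_mod n (a * \<alpha>) = d * inv_mod n \<alpha>] (mod int l)" using cong_dvd_modulus[OF _ ln] by blast
    from Ef_cong_right[OF this l0]
    have "Gf_factor n l k \<tau> (a * \<alpha>) = Ef (of_int ((a * \<alpha>) mod int n) / of_nat n) (of_int (2 * (d * inv_mod n \<alpha> * k)) / of_nat l) \<tau>"
      unfolding Gf_factor_def .
    then show ?thesis using 1 by (simp add: mult.assoc)
  qed
  then have "Gf n l S k (moebius a (b * int m * int n) (c * int l) d \<tau>) =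
      (\<Prod>\<alpha>\<in>S. ee (of_real (X \<alpha>))) * (\<Prod>\<alpha>\<in>S. Gf_factor n l k \<tau> (a * \<alpha>))"
    unfolding Gf_def by (simp add: prod.distrib)
  also have "(\<Prod>\<alpha>\<in>S. Gf_factor n l k \<tau> (a * \<alpha>)) = Gf n l S k \<tau>"
    unfolding Gf_eq_factor[OF S] by (rule unit_reps_prod[OF S S a Gf_factor_pm[OF n l \<tau>]])
  also have "(\<Prod>\<alpha>\<in>S. ee (of_real (X \<alpha>))) = ee (of_real (\<Sum>\<alpha>\<in>S. X \<alpha>))"
    unfolding of_real_sum ee_sum[OF fin] ..
  also have "(\<Sum>\<alpha>\<in>S. X \<alpha>) = of_int (int (card S) * \<Phi>) / 12
      + (of_int (a * b * int m * (\<Sum>\<alpha>\<in>S. \<alpha>\<^sup>2)) / of_nat n - of_int (b * int m * \<Sum>S) + of_int (floor_sum n S a)) / 2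
      + of_int (k * lin_sum n S a d - 2 * c * d * k\<^sup>2 * inv_square_sum n S) / of_nat l"
  proof -
    have "(\<Sum>\<alpha>\<in>S. (inv_mod n \<alpha> * k) * (1 - d) - 2 * c * d * (inv_mod n \<alpha> * k)\<^sup>2
          - 2 * ((a * \<alpha>) div int n) * d * (inv_mod n \<alpha> * k)) = k * lin_sum n S a d - 2 * c * d * k\<^sup>2 * inv_square_sum n S"
      unfolding lin_sum_def inv_square_sum_def sum_distrib_left sum_subtractf[symmetric]
      by (rule sum.cong) (auto simp: algebra_simps power_mult_distrib)
    note 1 = arg_cong[OF this, of real_of_int, unfolded of_int_sum]
    show ?thesis
      unfolding X_def sum.distrib sum_divide_distrib[symmetric] sum_subtractf 1
      by (simp add: sum_distrib_left sum_divide_distrib)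
  qed
  finally show ?thesis unfolding \<Phi>_def .
qed

text \<open>The exponent X of \<open>Gf_Gamma0\<close> is sorted into Y, made of multiples of the
  two orders and the part over l, and the exponent s evaluated by \<open>theta_sign_odd\<close> and
  \<open>theta_sign_even\<close>; the difference is an integer. For odd d the determinant relation
  removes the term with a d^2 from \<open>Phi\<close>.\<close>

theorem Gf_multiplier:
  fixes m :: nat
  assumes S: "unit_reps_mod_pm1 n S" and S': "odd n \<Longrightarrow> S = even_units n"
    and n: "n > 1" "squarefree n" and l: "l dvd n"
    and det: "a * d - b * (int m * int n * int l * c) = 1" and d: "odd d" and \<tau>: "Im \<tau> > 0"
  shows "Gf n l S k (moebius a (b * int m * int n) (c * int l) d \<tau>) =
    ee (of_real (of_int (b * d) * (of_int (int m * bernoulli_sum n S) / (12 * of_nat n))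
      + of_int (c * (a - 2 * d - b * d * (int m * int n * int l * c))) * (of_int (int l * int (card S)) / 12)
      + of_int (k * lin_sum n S a d - 2 * c * d * k\<^sup>2 * inv_square_sum n S) / of_nat l)) *
    of_int (theta_sign n a d) * Gf n l S k \<tau>"
proof -
  define K where "K = int (card S)"
  define Q where "Q = (\<Sum>\<alpha>\<in>S. \<alpha>\<^sup>2)" define T where "T = floor_sum n S a"
  define b' where "b' = b * int m" define c' where "c' = int l * c"
  have det': "a * d - b' * int n * c' = 1" using det by (simp add: b'_def c'_def mult_ac)
  define s where "s = (of_int (K * (d - 1)) / 4 - of_int (b' * (d - a) * Q) / (2 * of_nat n) + of_int T / 2 :: real)"
  define M where "M = (of_int (k * lin_sum n S a d - 2 * c * d * k\<^sup>2 * inv_square_sum n S) / of_nat l :: real)"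
  define X where "X = (of_int (K * Phi a (b * int m * int n) (c * int l) d) / 12
      + (of_int (a * b * int m * Q) / of_nat n - of_int (b * int m * \<Sum>S) + of_int T) / 2 + M)"
  define Y where "Y = of_int (b * d) * (of_int (int m * bernoulli_sum n S) / (12 * of_nat n))
      + of_int (c * (a - 2 * d - b * d * (int m * int n * int l * c))) * (of_int (int l * K) / 12) + M"
  have es: "ee (of_real s) = of_int (theta_sign n a d)"
  proof (cases "even n")
    case True
    then show ?thesis
      using theta_sign_even[OF True n(2) _ S d det'] n(1) unfolding s_def K_def Q_def T_def
      by (simp add: theta_sign_def)
  next
    case False
    then show ?thesis using theta_sign_odd[OF False n(1) d det'] S' unfolding s_def K_def Q_def T_def by simp
  qed
  obtain j where j: "d = 2 * j + 1" using d by (auto elim!: oddE)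
  have "bernoulli_sum n S = 6 * Q - 6 * int n * \<Sum>S + (int n)\<^sup>2 * K"
  proof -
    have "bernoulli_sum n S = (\<Sum>\<alpha>\<in>S. 6 * \<alpha>\<^sup>2 - 6 * int n * \<alpha> + (int n)\<^sup>2)"
      unfolding bernoulli_sum_def by (rule sum.cong) (simp_all add: mult_ac)
    then show ?thesis unfolding Q_def K_def
      by (simp add: sum.distrib sum_subtractf sum_distrib_left[symmetric])
  qed
  then have B: "real_of_int (bernoulli_sum n S) = 6 * of_int Q - 6 * of_nat n * of_int (\<Sum>S) + (of_nat n)\<^sup>2 * of_int K"
    by simp
  have \<Phi>: "Phi a (b * int m * int n) (c * int l) d =
     c' * (a - 2 * d - b' * int n * c' * d) + d * (b' * int n) + 3 * (d - 1) + (d * c' * (1 - (a * d - b' * int n * c')))"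
    using d by (simp add: Phi_def b'_def c'_def algebra_simps power2_eq_square)
  have \<Phi>: "Phi a (b * int m * int n) (c * int l) d =
     c' * (a - 2 * d - b' * int n * c' * d) + d * (b' * int n) + 3 * (d - 1)"
    unfolding \<Phi> det' by simp
  have "X - (Y + s) = of_int (b' * j * \<Sum>S)"
  proof -
    have n0: "real n \<noteq> 0" using n by simp
    define \<Sigma> where "\<Sigma> = real_of_int (\<Sum>S)"
    have Y': "Y = of_int b' * of_int d * (6 * of_int Q - 6 * of_nat n * \<Sigma> + (of_nat n)\<^sup>2 * of_int K) / (12 * of_nat n)
      + of_int (c' * (a - 2 * d - b' * int n * c' * d)) * of_int K / 12 + M"
      unfolding Y_def \<Sigma>_def B[symmetric] by (simp add: b'_def c'_def mult_ac)
    have X': "X = of_int K * (of_int (c' * (a - 2 * d - b' * int n * c' * d)) + of_int d * of_int b' * of_nat n + 3 * (of_int d - 1)) / 12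
      + (of_int a * of_int b' * of_int Q / of_nat n - of_int b' * \<Sigma> + of_int T) / 2 + M"
      unfolding X_def \<Phi> \<Sigma>_def by (simp add: b'_def mult_ac)
    define Z where "Z = real_of_int (c' * (a - 2 * d - b' * int n * c' * d))"
    show ?thesis
      unfolding X' Y' s_def Z_def[symmetric] \<Sigma>_def[symmetric] of_int_mult using n0
      by (simp add: j field_simps power2_eq_square)
  qed
  then have "complex_of_real X - of_real (Y + s) = of_int (b' * j * \<Sum>S)"
    by (metis of_real_diff of_real_of_int_eq)
  then have "ee (of_real X) = ee (of_real (Y + s))" by (intro ee_cong) (simp only: Ints_of_int)
  also have "\<dots> = ee (of_real Y) * of_int (theta_sign n a d)" by (simp add: ee_add es)
  finally show ?thesis
    using Gf_Gamma0[OF S n(1) l det \<tau>, of k] unfolding X_def Y_def M_def K_def Q_def T_def by simp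
qed

section \<open>The level\<close>

lemma max_square_root_ge:
  assumes "n > 0" "d\<^sup>2 dvd n"
  shows "d \<le> max_square_root n"
proof -
  have "{d. d\<^sup>2 dvd n} \<subseteq> {..n}"
  proof
    fix d assume "d \<in> {d. d\<^sup>2 dvd n}"
    then have "d\<^sup>2 \<le> n" using assms(1) by (auto dest: dvd_imp_le)
    moreover have "d \<le> d\<^sup>2" by (simp add: power2_nat_le_imp_le)
    ultimately show "d \<in> {..n}" by simp
  qed
  then have "finite {d. d\<^sup>2 dvd n}" by (rule finite_subset) simp
  then show ?thesis unfolding max_square_root_def using assms(2) by (intro Max_ge) auto
qed

text \<open>If p^2 divides n but p does not divide the root s, then (p s)^2 divides n as well,
  against maximality.\<close>

lemma prime_dvd_max_square_root_iff:
  assumes n: "n > 0" and p: "prime p"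
  shows "p dvd max_square_root n \<longleftrightarrow> p\<^sup>2 dvd n"
proof
  assume "p dvd max_square_root n"
  then have "p\<^sup>2 dvd (max_square_root n)\<^sup>2" by (rule dvd_power_same)
  then show "p\<^sup>2 dvd n" using max_square_root_dvd[OF n] dvd_trans by blast
next
  let ?s = "max_square_root n"
  assume pn: "p\<^sup>2 dvd n"
  show "p dvd ?s"
  proof (rule ccontr)
    assume "\<not> p dvd ?s"
    then have "coprime p ?s" using p prime_imp_coprime_nat by blast
    then have "coprime (p\<^sup>2) (?s\<^sup>2)" by simp
    then have "p\<^sup>2 * ?s\<^sup>2 dvd n" using pn max_square_root_dvd[OF n] by (rule divides_mult[rotated 2])
    then have "(p * ?s)\<^sup>2 dvd n" by (simp add: power_mult_distrib)
    then have "p * ?s \<le> ?s" by (rule max_square_root_ge[OF n])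
    moreover have "?s \<noteq> 0" using max_square_root_dvd[OF n] n by (intro notI) simp
    ultimately show False using prime_gt_1_nat[OF p] by simp
  qed
qed

lemma squarefreeI_prime:
  assumes "n > (0::nat)" "\<And>p. prime p \<Longrightarrow> \<not> p\<^sup>2 dvd n"
  shows "squarefree n"
  using assms by (subst squarefree_factorial_semiring) auto

lemma unit_reps_div_not_Int:
  assumes S: "unit_reps_mod_pm1 n S" and \<alpha>: "\<alpha> \<in> S"
  shows "(of_int \<alpha> / of_nat n :: real) \<notin> \<int>"
proof
  assume "(of_int \<alpha> / of_nat n :: real) \<in> \<int>"
  then obtain z :: int where z: "(of_int \<alpha> / of_nat n :: real) = of_int z" by (auto simp: Ints_def)
  have n: "n > 0" using unit_repsD[OF S \<alpha>] by simp
  have "real_of_int \<alpha> = of_int (z * int n)" using n z by (simp add: field_simps)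
  then have z: "\<alpha> = z * int n" by (simp only: of_int_eq_iff)
  have "0 < z * int n" "z * int n < 1 * int n" using unit_repsD[OF S \<alpha>] z by auto
  then have "0 < z" "z < 1" using n by (simp_all add: zero_less_mult_iff)
  then show False by simp
qed

section \<open>Divisors of a level satisfying the hypotheses\<close>

locale level =
  fixes N :: nat and S :: "nat \<Rightarrow> int set" and e :: "nat \<Rightarrow> nat \<Rightarrow> int"
  assumes N: "N > 0" and odd_L: "odd (max_square_root N)" and sqf_L: "squarefree (max_square_root N)"
    and coprime_L: "coprime (max_square_root N) (totient (N div max_square_root N))"
    and reps: "\<And>m. m \<in> proper_divisors N \<Longrightarrow> unit_reps_mod_pm1 (mpp N m) (S (mpp N m))"
begin

abbreviation "L \<equiv> max_square_root N"
abbreviation "Dv \<equiv> proper_divisors N"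
abbreviation "nn m \<equiv> mpp N m"
abbreviation "ll m \<equiv> ell N m"

lemma L_square_dvd: "L\<^sup>2 dvd N" by (rule max_square_root_dvd[OF N])

lemma L_pos: "L > 0"
  using L_square_dvd N by (intro gr0I) auto

text \<open>If p^3 divides N, then p divides L exactly once, so p^2 still divides N/L. Then p
  divides the totient of p^2, hence that of N/L, which is prime to L.\<close>

lemma not_cube_dvd:
  assumes p: "prime p"
  shows "\<not> p ^ 3 dvd N"
proof
  assume p3: "p ^ 3 dvd N"
  then have "p\<^sup>2 dvd N" by (metis dvd_trans le_imp_power_dvd numeral_le_iff semiring_norm(71) num.simps order_refl less_imp_le_nat lessI numeral_2_eq_2 numeral_3_eq_3)
  then have pL: "p dvd L" using prime_dvd_max_square_root_iff[OF N p] by blast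
  then obtain L' where L': "L = p * L'" by auto
  have "\<not> p dvd L'"
  proof
    assume "p dvd L'"
    then have "p\<^sup>2 dvd L" by (auto simp: L' power2_eq_square)
    then show False using sqf_L p by (metis not_prime_unit squarefreeD)
  qed
  then have cop: "coprime (p\<^sup>2) L'" using p prime_imp_coprime_nat by (metis coprime_power_left_iff)
  define M where "M = N div L"
  have "L dvd N" using L_square_dvd unfolding power2_eq_square by (rule dvd_mult_left)
  then have NM: "N = L * M" by (simp add: M_def)
  have "p ^ 3 = p * p\<^sup>2" by (simp add: power3_eq_cube power2_eq_square)
  then have "p * p\<^sup>2 dvd p * (L' * M)" using p3 NM L' by (metis mult.assoc)
  then have "p\<^sup>2 dvd L' * M" using prime_gt_0_nat[OF p] by simp
  then have "p\<^sup>2 dvd M" using cop coprime_dvd_mult_right_iff by blast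
  then have "totient (p\<^sup>2) dvd totient M" by (rule totient_dvd)
  then have "p dvd totient M" using totient_prime_power[OF p, of 2] by (auto dest: dvd_mult_left)
  then have "p dvd 1" using pL coprime_L unfolding M_def[symmetric] using coprime_common_divisor by blast
  then show False using p by simp
qed

lemma not_four_dvd: "\<not> 4 dvd N"
proof
  assume "4 dvd N"
  then have "2\<^sup>2 dvd N" by simp
  then have "2 dvd L" using prime_dvd_max_square_root_iff[OF N two_is_prime_nat] by blast
  then show False using odd_L by simp
qed

lemma finite_Dv: "finite Dv"
  using N by (auto simp: proper_divisors_def intro: finite_subset[of _ "{..N}"] dvd_imp_le)

context
  fixes m assumes m: "m \<in> Dv"
begin

lemma m_pos: "m > 0" and M_eq: "N = m * (N div m)" and M_gt_1: "N div m > 1"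
proof -
  have md: "m dvd N" "m \<noteq> N" using m by (auto simp: proper_divisors_def)
  then show "m > 0" "N = m * (N div m)" using N by (auto intro: gr0I)
  then show "N div m > 1" using N md(2) by (metis One_nat_def Suc_lessI gr0I mult.right_neutral mult_0_right)
qed

lemma ell_square_dvd: "(ll m)\<^sup>2 dvd N div m"
  unfolding ell_def using M_gt_1 by (intro max_square_root_dvd) simp

lemma ell_pos: "ll m > 0"
  using ell_square_dvd M_gt_1 by (intro gr0I) auto

lemma M_mpp: "N div m = ll m * nn m"
proof -
  have "ll m dvd N div m" using ell_square_dvd by (metis dvd_mult_left power2_eq_square)
  then show ?thesis unfolding mpp_def by (simp add: div_mult2_eq)
qed

lemma N_eq: "N = m * nn m * ll m"
  using M_eq M_mpp by (metis mult.assoc mult.commute)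

lemma mpp_pos: "nn m > 0"
  using N_eq N by (intro gr0I) auto

lemma ell_dvd_mpp: "ll m dvd nn m"
  using ell_square_dvd ell_pos unfolding M_mpp by (simp add: power2_eq_square)

lemma mpp_dvd: "nn m dvd N"
  using N_eq by (metis dvd_mult2 dvd_triv_right)

lemma mpp_gt_1: "nn m > 1"
proof (rule ccontr)
  assume "\<not> nn m > 1"
  then have "nn m = 1" using mpp_pos by simp
  then have "ll m = 1" using ell_dvd_mpp by simp
  then show False using M_mpp M_gt_1 \<open>nn m = 1\<close> by simp
qed

lemma prime_dvd_ell_iff: "prime p \<Longrightarrow> p dvd ll m \<longleftrightarrow> p\<^sup>2 dvd N div m"
  unfolding ell_def using M_gt_1 by (intro prime_dvd_max_square_root_iff) simp

lemma prime_ell_L: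
  assumes "prime p" "p dvd ll m"
  shows "p dvd L" "\<not> p dvd m"
proof -
  have p2: "p\<^sup>2 dvd N div m" using prime_dvd_ell_iff assms by blast
  then have "p\<^sup>2 dvd N" using M_eq by (metis dvd_mult)
  then show "p dvd L" using prime_dvd_max_square_root_iff[OF N assms(1)] by blast
  show "\<not> p dvd m"
  proof
    assume "p dvd m"
    then have "p * p\<^sup>2 dvd m * (N div m)" using p2 by (rule mult_dvd_mono)
    then have "p ^ 3 dvd N" using M_eq by (simp add: power3_eq_cube power2_eq_square mult.assoc)
    then show False using not_cube_dvd[OF assms(1)] by blast
  qed
qed

text \<open>Together with \<open>prime_ell_L\<close>: each prime divisor of L divides exactly one of
  m and l(m). Congruences modulo p are proved separately in the two cases.\<close>

lemma prime_not_dvd_ell: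
  assumes "prime p" "p dvd L" "\<not> p dvd ll m"
  shows "p dvd m"
proof (rule ccontr)
  assume "\<not> p dvd m"
  then have "coprime (p\<^sup>2) m" using assms(1) prime_imp_coprime_nat by (metis coprime_power_left_iff)
  moreover have "p\<^sup>2 dvd m * (N div m)" using prime_dvd_max_square_root_iff[OF N assms(1)] assms(2) M_eq by simp
  ultimately have "p\<^sup>2 dvd N div m" using coprime_dvd_mult_right_iff by blast
  then show False using prime_dvd_ell_iff assms by blast
qed

lemma squarefree_ell: "squarefree (ll m)"
proof (rule squarefreeI_prime[OF ell_pos])
  fix p :: nat assume p: "prime p"
  show "\<not> p\<^sup>2 dvd ll m"
  proof
    assume "p\<^sup>2 dvd ll m"
    then have "p\<^sup>2 * p\<^sup>2 dvd ll m * ll m" by (intro mult_dvd_mono)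
    then have "p\<^sup>2 * p\<^sup>2 dvd N" using ell_square_dvd M_eq by (metis dvd_mult dvd_trans power2_eq_square)
    moreover have "p ^ 3 dvd p\<^sup>2 * p\<^sup>2" by (simp add: power3_eq_cube power2_eq_square)
    ultimately show False using not_cube_dvd[OF p] dvd_trans by blast
  qed
qed

lemma ell_dvd_L: "ll m dvd L"
proof -
  have "int (ll m) dvd int L"
    by (rule squarefree_dvdI[OF squarefree_ell ell_pos]) (use prime_ell_L(1) in auto)
  then show ?thesis by simp
qed

lemma odd_ell: "odd (ll m)"
  using ell_dvd_L odd_L by (meson dvd_trans)

lemma squarefree_mpp: "squarefree (nn m)"
proof (rule squarefreeI_prime[OF mpp_pos])
  fix p :: nat assume p: "prime p"
  show "\<not> p\<^sup>2 dvd nn m"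
  proof
    assume p2: "p\<^sup>2 dvd nn m"
    then have "p\<^sup>2 dvd N div m" unfolding M_mpp by simp
    then have "p dvd ll m" using prime_dvd_ell_iff[OF p] by blast
    then have "p * p\<^sup>2 dvd ll m * nn m" using p2 by (rule mult_dvd_mono)
    then have "p ^ 3 dvd N" using M_eq M_mpp by (metis dvd_mult power3_eq_cube power2_eq_square mult.assoc)
    then show False using not_cube_dvd[OF p] by blast
  qed
qed

text \<open>As l divides m'' = 2 and is odd, l = 1. So m'' = 2 can happen only for m = N/2.\<close>

lemma mpp_eq_2: "nn m = 2 \<Longrightarrow> ll m = 1" "nn m = 2 \<Longrightarrow> N = 2 * m" "nn m = 2 \<Longrightarrow> odd m"
proof -
  assume n2: "nn m = 2"
  then show l: "ll m = 1" using ell_dvd_mpp odd_ell by (metis dvd_antisym even_numeral prime_nat_iff two_is_prime_nat)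
  then show N2: "N = 2 * m" using N_eq n2 by simp
  then show "odd m" using not_four_dvd by auto
qed

lemma N_div_ell: "N div ll m = m * nn m"
  using N_eq ell_pos by (metis nonzero_mult_div_cancel_right less_numeral_extra(3))

end

text \<open>For odd $m''$ the even representatives turn the parity of the floor sums into Gauss's lemma.\<close>
definition S1 :: "nat \<Rightarrow> int set" where
  "S1 n = (if odd n then even_units n else S n)"

lemma S1: "m \<in> Dv \<Longrightarrow> unit_reps_mod_pm1 (nn m) (S1 (nn m))"
  unfolding S1_def using reps even_units_reps mpp_gt_1 by auto

text \<open>Writing \<open>h\<close> as \<open>2 * k\<close> modulo the odd number $\ell$ keeps halves out of the multiplier.\<close>
definition half_rep :: "nat \<Rightarrow> nat \<Rightarrow> int" where
  "half_rep l h = (if even h then int (h div 2) else int ((h + l) div 2))"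

lemma half_rep: "odd l \<Longrightarrow> [2 * half_rep l h = int h] (mod int l)"
proof (cases "even h")
  case True
  then show ?thesis by (auto simp: half_rep_def)
next
  case False
  assume "odd l"
  then have "2 * ((h + l) div 2) = h + l" using False by simp
  then have "2 * half_rep l h = int h + int l" using False by (simp add: half_rep_def)
  then show ?thesis by (simp add: cong_iff_dvd_diff)
qed

section \<open>The functions of the level: expansions at cusps and multipliers\<close>

abbreviation F :: "nat \<Rightarrow> nat \<Rightarrow> complex \<Rightarrow> complex" where
  "F m h \<equiv> F_fun N (S (nn m)) m (int h)"

abbreviation "kk m h \<equiv> half_rep (ll m) h"

lemma E_fun_Gf:
  assumes m: "m \<in> Dv" and \<tau>: "Im \<tau> > 0"
  shows "E_fun N (\<alpha> * int m * int (ll m)) (inv_mod (nn m) \<alpha> * int h * int (N div ll m)) (of_nat (N div ll m) * \<tau>) =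
    Ef (of_int \<alpha> / of_nat (nn m)) (of_int (2 * (inv_mod (nn m) \<alpha> * kk m h)) / of_nat (ll m)) (of_nat (N div ll m) * \<tau>)"
proof -
  note pos = m_pos[OF m] mpp_pos[OF m] ell_pos[OF m]
  have N': "N div ll m > 0" unfolding N_div_ell[OF m] using pos by simp
  have "Im (of_nat (N div ll m) * \<tau>) > 0" using N' \<tau> by simp
  note 1 = E_fun_eq_Ef[OF N this]
  have a: "of_int (\<alpha> * int m * int (ll m)) / real N = of_int \<alpha> / of_nat (nn m)"
    using pos by (subst N_eq[OF m]) (simp add: field_simps)
  obtain j where "2 * kk m h - int h = int (ll m) * j"
    using half_rep[OF odd_ell[OF m], of h] by (auto simp: cong_iff_dvd_diff)
  then have j: "int h = 2 * kk m h - int (ll m) * j" by simp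
  have "of_int (inv_mod (nn m) \<alpha> * int h * int (N div ll m)) / real N = of_int (inv_mod (nn m) \<alpha> * int h) / real (ll m)"
    unfolding N_div_ell[OF m] using pos by (subst (2) N_eq[OF m]) (simp add: field_simps)
  also have "\<dots> = of_int (2 * (inv_mod (nn m) \<alpha> * kk m h)) / of_nat (ll m) + of_int (- inv_mod (nn m) \<alpha> * j)"
    unfolding j using pos by (simp add: field_simps)
  finally show ?thesis unfolding 1 a by (simp only: Ef_add_right)
qed

lemma F_Gf:
  assumes m: "m \<in> Dv" and n2: "nn m \<noteq> 2" and \<tau>: "Im \<tau> > 0"
  shows "F m h \<tau> = Gf (nn m) (ll m) (S1 (nn m)) (kk m h) (of_nat (N div ll m) * \<tau>)"
proof -
  have "Im (of_nat (N div ll m) * \<tau>) > 0" unfolding N_div_ell[OF m] using \<tau> m_pos[OF m] mpp_pos[OF m] by simp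
  note 1 = Gf_reps_indep[OF S1[OF m] reps[OF m] mpp_gt_1[OF m] ell_dvd_mpp[OF m] this]
  have "F m h \<tau> = (\<Prod>\<alpha>\<in>S (nn m). E_fun N (\<alpha> * int m * int (ll m))
      (inv_mod (nn m) \<alpha> * int h * int (N div ll m)) (of_nat (N div ll m) * \<tau>))"
    using n2 by (simp add: F_fun_def Let_def)
  also have "\<dots> = Gf (nn m) (ll m) (S (nn m)) (kk m h) (of_nat (N div ll m) * \<tau>)"
    unfolding Gf_def E_fun_Gf[OF m \<tau>] ..
  finally show ?thesis unfolding 1 .
qed

lemma reps_2:
  assumes S: "unit_reps_mod_pm1 2 S'"
  shows "S' = {1}"
proof -
  have "S' \<subseteq> {1}" using S by (auto simp: unit_reps_mod_pm1_def)
  moreover obtain \<alpha> where "\<alpha> \<in> S'" by (rule unit_reps_ex[OF S, of 1]) auto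
  ultimately show ?thesis by auto
qed

lemma F_square_Gf:
  assumes m: "m \<in> Dv" and n2: "nn m = 2" and h: "h < ll m" and \<tau>: "Im \<tau> > 0"
  shows "(F m h \<tau>)\<^sup>2 = Gf (nn m) (ll m) (S1 (nn m)) (kk m h) (of_nat (N div ll m) * \<tau>)"
proof -
  have l: "ll m = 1" by (rule mpp_eq_2(1)[OF m n2])
  have h0: "h = 0" using h l by simp
  have k0: "kk m h = 0" by (simp add: h0 half_rep_def)
  have md: "m dvd N" using m by (auto simp: proper_divisors_def)
  have S1': "S1 (nn m) = {1}" using S1[OF m] reps_2 n2 by simp
  have "(F m h \<tau>)\<^sup>2 = E_fun N (1 * int m * int (ll m)) (inv_mod (nn m) 1 * int h * int (N div ll m)) (of_nat (N div ll m) * \<tau>)"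
    using F_fun_power2[OF N md n2 \<tau>] by (simp add: h0)
  also have "\<dots> = Gf (nn m) (ll m) {1} (kk m h) (of_nat (N div ll m) * \<tau>)"
    unfolding E_fun_Gf[OF m \<tau>] Gf_def by simp
  finally show ?thesis unfolding S1' .
qed

text \<open>\<open>nice_sqrt\<close> asks for holomorphy of the function itself, not only of its
  square; the explicit product supplies it, and later also the exact behaviour under
  translation.\<close>

lemma F_2_qp:
  assumes m: "m \<in> Dv" and n2: "nn m = 2" and h: "h < ll m"
  shows "F m h \<tau> = ee (- (of_nat m * \<tau> / 24)) * qp (ee (of_nat m * \<tau>)) (ee (of_nat (2 * m) * \<tau>))"
proof -
  have l: "ll m = 1" by (rule mpp_eq_2(1)[OF m n2])
  have N2: "N = 2 * m" by (rule mpp_eq_2(2)[OF m n2])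
  have h0: "h = 0" using h l by simp
  have 1: "qpow \<tau> (real (2 * m) * (real (Suc n) - 1 / 2)) = ee (of_nat m * \<tau>) * ee (of_nat (2 * m) * \<tau>) ^ n" for n
    unfolding qpow_ee ee_power ee_add[symmetric]
    by (intro arg_cong[of _ _ ee]) (simp add: field_simps)
  have 2: "qpow \<tau> (- real (2 * m) / 48) = ee (- (of_nat m * \<tau> / 24))"
    unfolding qpow_ee by (intro arg_cong[of _ _ ee]) (simp add: field_simps)
  have "F m h \<tau> = qpow \<tau> (- real (2 * m) / 48) * (\<Prod>n. 1 - qpow \<tau> (real (2 * m) * (real (Suc n) - 1 / 2)))"
    unfolding F_fun_def Let_def using n2 l h0 N2 by simp
  then show ?thesis unfolding 1 2 qp_def .
qed

lemma Gf_nonzero: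
  assumes m: "m \<in> Dv" and \<tau>: "Im \<tau> > 0"
  shows "Gf (nn m) l (S1 (nn m)) k \<tau> \<noteq> 0"
  unfolding Gf_def prod_zero_iff[OF unit_reps_finite[OF S1[OF m]]]
proof (rule notI, elim bexE)
  fix \<alpha> assume \<alpha>: "\<alpha> \<in> S1 (nn m)" and 0: "Ef (of_int \<alpha> / of_nat (nn m)) (of_int (2 * (inv_mod (nn m) \<alpha> * k)) / of_nat l) \<tau> = 0"
  from unit_reps_div_not_Int[OF S1[OF m] \<alpha>] show False using Ef_nonzero[OF \<tau>] 0 by blast
qed

lemma F_nonzero:
  assumes m: "m \<in> Dv" and h: "h < ll m" and \<tau>: "Im \<tau> > 0"
  shows "F m h \<tau> \<noteq> 0"
proof -
  have "Im (of_nat (N div ll m) * \<tau>) > 0" unfolding N_div_ell[OF m] using \<tau> m_pos[OF m] mpp_pos[OF m] by simp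
  note nz = Gf_nonzero[OF m this, of "ll m" "kk m h"]
  show ?thesis
  proof (cases "nn m = 2")
    case True then show ?thesis using F_square_Gf[OF m True h \<tau>] nz by auto
  next
    case False then show ?thesis using F_Gf[OF m False \<tau>] nz by simp
  qed
qed

lemma nice_Gf_moebius:
  assumes m: "m \<in> Dv" and det: "a * d - b * c = 1"
  shows "\<exists>A. nice A (\<lambda>\<tau>. Gf (nn m) l (S1 (nn m)) k (of_nat (N div ll m) * moebius a b c d \<tau>))"
proof -
  have K: "N div ll m > 0" unfolding N_div_ell[OF m] using m_pos[OF m] mpp_pos[OF m] by simp
  have "\<exists>A. nice A (\<lambda>\<tau>. Ef (of_int \<alpha> / of_nat (nn m)) (of_int (2 * (inv_mod (nn m) \<alpha> * k)) / of_nat l) (of_nat (N div ll m) * moebius a b c d \<tau>))"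
    if \<alpha>: "\<alpha> \<in> S1 (nn m)" for \<alpha>
  proof (rule nice_Ef_moebius[OF _ _ _ det K])
    show "(of_int \<alpha> / of_nat (nn m) :: real) \<in> \<rat>" "of_int (2 * (inv_mod (nn m) \<alpha> * k)) / of_nat l \<in> (\<rat> :: real set)"
      by (auto intro!: Rats_divide)
    from unit_reps_div_not_Int[OF S1[OF m] \<alpha>]
    show "(of_int \<alpha> / of_nat (nn m) :: real) \<notin> \<int> \<or> of_int (2 * (inv_mod (nn m) \<alpha> * k)) / of_nat l \<notin> (\<int> :: real set)" by blast
  qed
  then obtain A where A: "\<And>\<alpha>. \<alpha> \<in> S1 (nn m) \<Longrightarrow> nice (A \<alpha>) (\<lambda>\<tau>. Ef (of_int \<alpha> / of_nat (nn m)) (of_int (2 * (inv_mod (nn m) \<alpha> * k)) / of_nat l) (of_nat (N div ll m) * moebius a b c d \<tau>))"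
    by metis
  then show ?thesis unfolding Gf_def by (intro exI) (rule nice_prod[OF unit_reps_finite[OF S1[OF m]] A])
qed

lemma nice_F_moebius:
  assumes m: "m \<in> Dv" and h: "h < ll m" and det: "a * d - b * c = 1"
  shows "\<exists>A. nice A (\<lambda>\<tau>. F m h (moebius a b c d \<tau>))"
proof -
  obtain A where A: "nice A (\<lambda>\<tau>. Gf (nn m) (ll m) (S1 (nn m)) (kk m h) (of_nat (N div ll m) * moebius a b c d \<tau>))"
    using nice_Gf_moebius[OF m det] by blast
  note im = Im_moebius_pos[OF det]
  show ?thesis
  proof (cases "nn m = 2")
    case False
    have "nice A (\<lambda>\<tau>. F m h (moebius a b c d \<tau>))"
      by (rule nice_cong[OF A]) (rule F_Gf[OF m False im])
    then show ?thesis by blast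
  next
    case True
    have "nice A (\<lambda>\<tau>. (F m h (moebius a b c d \<tau>))\<^sup>2)"
      by (rule nice_cong[OF A]) (rule F_square_Gf[OF m True h im])
    moreover have "(\<lambda>\<tau>. F m h (moebius a b c d \<tau>)) holomorphic_on uhp"
      unfolding F_2_qp[OF m True h]
      using im m_pos[OF m] holomorphic_moebius[OF det]
      by (intro holomorphic_intros qp_holomorphic open_uhp) (auto intro!: norm_ee_less_1)
    ultimately have "nice (A / 2) (\<lambda>\<tau>. F m h (moebius a b c d \<tau>))" by (rule nice_sqrt)
    then show ?thesis by blast
  qed
qed

text \<open>
  \<open>oi m\<close> is the order of $F_{m,h}$ at $\infty$ and \<open>oz m\<close> that of $F_{m,0}$ at 0; the factor 1/2
  accounts for the square root taken when $m'' = 2$.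
\<close>
definition oi :: "nat \<Rightarrow> real" where
  "oi m = (if nn m = 2 then 1 / 2 else 1) * (of_int (int m * bernoulli_sum (nn m) (S1 (nn m))) / (12 * of_nat (nn m)))"

definition oz :: "nat \<Rightarrow> real" where
  "oz m = (if nn m = 2 then 1 / 2 else 1) * (of_int (int (ll m) * int (card (S1 (nn m)))) / 12)"

abbreviation "lin m a d \<equiv> lin_sum (nn m) (S1 (nn m)) a d"
abbreviation "isq m \<equiv> inv_square_sum (nn m) (S1 (nn m))"

text \<open>Conjugation by multiplication with N' = m m'' turns b into b m m'' and N c into c l, the
  shape required by \<open>Gf_multiplier\<close>.\<close>

lemma Gf_level:
  assumes m: "m \<in> Dv" and det: "a * d - b * (int N * c) = 1" and d: "odd d" and \<tau>: "Im \<tau> > 0"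
  shows "Gf (nn m) (ll m) (S1 (nn m)) k (of_nat (N div ll m) * moebius a b (int N * c) d \<tau>) =
    ee (of_real (of_int (b * d) * (of_int (int m * bernoulli_sum (nn m) (S1 (nn m))) / (12 * of_nat (nn m)))
      + of_int (c * (a - 2 * d - b * d * (int N * c))) * (of_int (int (ll m) * int (card (S1 (nn m)))) / 12)
      + of_int (k * lin m a d - 2 * c * d * k\<^sup>2 * isq m) / of_nat (ll m))) *
    of_int (theta_sign (nn m) a d) * Gf (nn m) (ll m) (S1 (nn m)) k (of_nat (N div ll m) * \<tau>)"
proof -
  have Nc: "int N * c = int m * int (nn m) * int (ll m) * c" by (subst N_eq[OF m]) simp
  have pos: "(of_nat (m * nn m) :: complex) \<noteq> 0" using m_pos[OF m] mpp_pos[OF m] by simp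
  have "moebius a (b * int m * int (nn m)) (c * int (ll m)) d (of_nat (m * nn m) * \<tau>) =
      of_nat (m * nn m) * moebius a b (int N * c) d \<tau>"
    unfolding moebius_def Nc using pos by (simp add: algebra_simps divide_simps)
  then have 1: "of_nat (N div ll m) * moebius a b (int N * c) d \<tau> =
      moebius a (b * int m * int (nn m)) (c * int (ll m)) d (of_nat (N div ll m) * \<tau>)"
    unfolding N_div_ell[OF m] by simp
  have im: "Im (of_nat (N div ll m) * \<tau>) > 0" unfolding N_div_ell[OF m] using \<tau> m_pos[OF m] mpp_pos[OF m] by simp
  show ?thesis
    unfolding 1 unfolding Nc
    by (rule Gf_multiplier[OF S1[OF m] _ mpp_gt_1[OF m] squarefree_mpp[OF m] ell_dvd_mpp[OF m] det[unfolded Nc] d im])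
       (simp add: S1_def)
qed

text \<open>For \<open>mpp N m = 2\<close> the sign is not determined; it drops out since the exponent turns out to be even.\<close>
lemma F_multiplier:
  assumes m: "m \<in> Dv" and h: "h < ll m" and det: "a * d - b * (int N * c) = 1" and d: "odd d"
  shows "\<exists>s::int. (s = 1 \<or> s = -1) \<and> (nn m \<noteq> 2 \<longrightarrow> s = theta_sign (nn m) a d) \<and>
    (\<forall>\<tau>. Im \<tau> > 0 \<longrightarrow> F m h (moebius a b (int N * c) d \<tau>) =
      ee (of_real (of_int (b * d) * oi m + of_int (c * (a - 2 * d - b * d * (int N * c))) * oz m
        + of_int (kk m h * lin m a d - 2 * c * d * (kk m h)\<^sup>2 * isq m) / of_nat (ll m))) * of_int s * F m h \<tau>)"
proof (cases "nn m = 2")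
  case False
  show ?thesis
  proof (intro exI[of _ "theta_sign (nn m) a d"] conjI theta_sign_abs impI allI refl)
    fix \<tau> assume \<tau>: "Im \<tau> > 0"
    show "F m h (moebius a b (int N * c) d \<tau>) =
      ee (of_real (of_int (b * d) * oi m + of_int (c * (a - 2 * d - b * d * (int N * c))) * oz m
        + of_int (kk m h * lin m a d - 2 * c * d * (kk m h)\<^sup>2 * isq m) / of_nat (ll m))) *
      of_int (theta_sign (nn m) a d) * F m h \<tau>"
      using Gf_level[OF m det d \<tau>, of "kk m h"] False
      unfolding F_Gf[OF m False \<tau>] F_Gf[OF m False Im_moebius_pos[OF det \<tau>]] oi_def oz_def by simp
  qed
next
  case True
  have l: "ll m = 1" by (rule mpp_eq_2(1)[OF m True])
  have k0: "kk m h = 0" using h l by (simp add: half_rep_def)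
  define X where "X = of_int (b * d) * oi m + of_int (c * (a - 2 * d - b * d * (int N * c))) * oz m
        + of_int (kk m h * lin m a d - 2 * c * d * (kk m h)\<^sup>2 * isq m) / of_nat (ll m)"
  have ts: "theta_sign (nn m) a d = 1" using True by (simp add: theta_sign_def)
  have sq: "(F m h (moebius a b (int N * c) d \<tau>))\<^sup>2 = (ee (of_real X) * F m h \<tau>)\<^sup>2" if \<tau>: "Im \<tau> > 0" for \<tau>
  proof -
    have "(ee (of_real X))\<^sup>2 = ee (of_real (2 * X))" by (simp add: ee_power)
    then show ?thesis
      unfolding power_mult_distrib F_square_Gf[OF m True h \<tau>] F_square_Gf[OF m True h Im_moebius_pos[OF det \<tau>]]
        Gf_level[OF m det d \<tau>] ts X_def oi_def oz_def using True k0 by (simp add: algebra_simps)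
  qed
  \<comment> \<open>The two sides have equal squares, so their ratio is 1 or -1 at each point. Being
    continuous on the connected half plane, it is one sign for all \<tau>.\<close>
  define r where "r = (\<lambda>\<tau>. F m h (moebius a b (int N * c) d \<tau>) / (ee (of_real X) * F m h \<tau>))"
  have det1: "1 * 1 - 0 * 0 = (1::int)" by simp
  obtain A1 where A1: "nice A1 (\<lambda>\<tau>. F m h (moebius a b (int N * c) d \<tau>))" using nice_F_moebius[OF m h det] by blast
  obtain A2 where A2: "nice A2 (\<lambda>\<tau>. F m h (moebius 1 0 0 1 \<tau>))" using nice_F_moebius[OF m h det1] by blast
  have nz: "ee (of_real X) * F m h \<tau> \<noteq> 0" if "Im \<tau> > 0" for \<tau> using F_nonzero[OF m h that] by simp
  have "r holomorphic_on uhp"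
    unfolding r_def using nice_holomorphic[OF A1] nice_holomorphic[OF A2] nz
    by (intro holomorphic_intros) (auto simp: moebius_def)
  moreover have r2: "r \<tau> \<in> {1, -1}" if "Im \<tau> > 0" for \<tau>
  proof -
    have "(r \<tau>)\<^sup>2 = 1" unfolding r_def power_divide sq[OF that] using nz[OF that] by simp
    then show ?thesis by (simp add: power2_eq_1_iff)
  qed
  then have "finite (r ` uhp)" by (intro finite_subset[of "r ` uhp" "{1, -1}"]) auto
  ultimately obtain s where s: "\<And>t. Im t > 0 \<Longrightarrow> r t = s"
    using continuous_finite_range_constant[OF connected_uhp holomorphic_on_imp_continuous_on]
    by (auto simp: constant_on_def)
  have "s \<in> {1, -1}" using r2[of \<i>] s[of \<i>] by simp
  then obtain s' :: int where s': "s' = 1 \<or> s' = -1" "s = of_int s'"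
    by (metis insert_iff of_int_1 of_int_minus singletonD)
  show ?thesis
    unfolding X_def[symmetric]
  proof (intro exI[of _ s'] conjI s'(1) allI impI)
    show "s' = theta_sign (nn m) a d" if "nn m \<noteq> 2" using that True by simp
    fix \<tau> assume \<tau>: "Im \<tau> > 0"
    show "F m h (moebius a b (int N * c) d \<tau>) = ee (of_real X) * of_int s' * F m h \<tau>"
      using s[OF \<tau>] nz[OF \<tau>] unfolding s'(2) r_def by (simp add: field_simps)
  qed
qed

lemma
  assumes m: "m \<in> Dv"
  shows lin_1: "lin m 1 1 = 0" and theta_sign_1: "theta_sign (nn m) 1 1 = 1"
proof -
  show "lin m 1 1 = 0" unfolding lin_sum_def
  proof (rule sum.neutral, intro ballI)
    fix \<alpha> assume "\<alpha> \<in> S1 (nn m)"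
    from unit_repsD[OF S1[OF m] this] have "\<alpha> div int (nn m) = 0" by simp
    then show "inv_mod (nn m) \<alpha> * (1 - 1) - 2 * (1 * \<alpha> div int (nn m)) * 1 * inv_mod (nn m) \<alpha> = 0" by simp
  qed
  have fs: "floor_sum (nn m) (S1 (nn m)) 1 = 0"
  proof (rule sum.neutral, intro ballI)
    fix \<alpha> assume "\<alpha> \<in> S1 (nn m)"
    from unit_repsD[OF S1[OF m] this] show "(1 * \<alpha>) div int (nn m) = 0" by simp
  qed
  show "theta_sign (nn m) 1 1 = 1"
  proof (cases "even (nn m)")
    case False
    then have "S1 (nn m) = even_units (nn m)" by (simp add: S1_def)
    then show ?thesis using fs by (simp add: theta_sign_def)
  qed (simp add: theta_sign_def)
qed

text \<open>For m'' = 2 the lemma \<open>F_multiplier\<close> leaves a sign open, so the product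
  expansion is used instead. This exact value is what lets integrality at infinity decide the parity
  of the exponent.\<close>

lemma F_T:
  assumes m: "m \<in> Dv" and h: "h < ll m" and \<tau>: "Im \<tau> > 0"
  shows "F m h (\<tau> + 1) = ee (of_real (oi m)) * F m h \<tau>"
proof (cases "nn m = 2")
  case False
  have det: "1 * 1 - 1 * (int N * 0) = 1" by simp
  have "moebius 1 1 (int N * 0) 1 \<tau> = \<tau> + 1" by (simp add: moebius_def)
  then show ?thesis using F_multiplier[OF m h det] False theta_sign_1[OF m] lin_1[OF m] \<tau> by fastforce
next
  case True
  have S: "S1 (nn m) = {1}" using S1[OF m] reps_2 True by simp
  have o: "oi m = - real m / 24" unfolding oi_def S bernoulli_sum_def using True by simp
  have "ee (of_nat m * (\<tau> + 1)) = ee (of_nat m * \<tau>)" "ee (of_nat (2 * m) * (\<tau> + 1)) = ee (of_nat (2 * m) * \<tau>)"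
    by (rule ee_cong, simp add: algebra_simps)+
  moreover have "ee (- (of_nat m * (\<tau> + 1) / 24)) = ee (of_real (oi m)) * ee (- (of_nat m * \<tau> / 24))"
    unfolding o ee_add[symmetric] by (intro arg_cong[of _ _ ee]) (simp add: field_simps)
  ultimately show ?thesis unfolding F_2_qp[OF m True h] by simp
qed

end

section \<open>The multiplier of the whole product\<close>

lemma powi_prod_sum:
  fixes c :: complex
  assumes "finite I" "c \<noteq> 0"
  shows "(\<Prod>i\<in>I. c powi k i) = c powi (\<Sum>i\<in>I. k i)"
  using assms(1) by (induction I rule: finite_induct) (auto simp: power_int_add assms(2))

lemma prod_powi_distrib:
  fixes f g :: "'a \<Rightarrow> complex"
  shows "(\<Prod>i\<in>I. (f i * g i) powi k i) = (\<Prod>i\<in>I. f i powi k i) * (\<Prod>i\<in>I. g i powi k i)"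
  by (simp add: power_int_mult_distrib prod.distrib)

lemma sign_powi_even:
  fixes s :: int assumes "s = 1 \<or> s = -1" "even k"
  shows "of_int s powi k = (1 :: complex)"
  using assms by (auto simp: power_int_minus_left)

context level
begin

definition f_prod :: "complex \<Rightarrow> complex" where
  "f_prod \<tau> = (\<Prod>m\<in>Dv. \<Prod>h\<in>{0..<ll m}. F m h \<tau> powi e m h)"

definition order_inf :: real where "order_inf = (\<Sum>m\<in>Dv. \<Sum>h\<in>{0..<ll m}. of_int (e m h) * oi m)"
definition order_zero :: real where "order_zero = (\<Sum>m\<in>Dv. \<Sum>h\<in>{0..<ll m}. of_int (e m h) * oz m)"

text \<open>The factor L div l(m) brings the fractions with denominators l(m) to the common
  denominator L, here and in \<open>lin_total\<close>.\<close>

definition quad_total :: int where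
  "quad_total = (\<Sum>m\<in>Dv. \<Sum>h\<in>{0..<ll m}. e m h * (kk m h)\<^sup>2 * isq m * int (L div ll m))"

definition lin_total :: "int \<Rightarrow> int \<Rightarrow> int" where
  "lin_total a d = (\<Sum>m\<in>Dv. \<Sum>h\<in>{0..<ll m}. e m h * kk m h * lin m a d * int (L div ll m))"

definition sgn_tot :: "int \<Rightarrow> int \<Rightarrow> complex" where
  "sgn_tot a d = (\<Prod>m\<in>Dv. of_int (theta_sign (nn m) a d) powi (\<Sum>h\<in>{0..<ll m}. e m h))"

lemma f_prod_nice:
  assumes det: "a * d - b * c = 1"
  shows "\<exists>A. nice A (\<lambda>\<tau>. f_prod (moebius a b c d \<tau>))"
proof -
  have "\<exists>A. nice A (\<lambda>\<tau>. F m h (moebius a b c d \<tau>))" if "m \<in> Dv" "h \<in> {0..<ll m}" for m h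
    using nice_F_moebius[OF _ _ det] that by simp
  then obtain A where A: "\<And>m h. m \<in> Dv \<Longrightarrow> h \<in> {0..<ll m} \<Longrightarrow> nice (A m h) (\<lambda>\<tau>. F m h (moebius a b c d \<tau>))"
    by metis
  have "nice (\<Sum>m\<in>Dv. \<Sum>h\<in>{0..<ll m}. of_int (e m h) * A m h) (\<lambda>\<tau>. f_prod (moebius a b c d \<tau>))"
    unfolding f_prod_def
    by (rule nice_prod[OF finite_Dv], rule nice_prod, simp, rule nice_powi, rule A)
  then show ?thesis by blast
qed

lemma f_prod_nonzero: "Im \<tau> > 0 \<Longrightarrow> f_prod \<tau> \<noteq> 0"
  unfolding f_prod_def using F_nonzero finite_Dv by (auto simp: prod_zero_iff)

lemma f_prod_T:
  assumes \<tau>: "Im \<tau> > 0"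
  shows "f_prod (\<tau> + 1) = ee (of_real order_inf) * f_prod \<tau>"
proof -
  have "f_prod (\<tau> + 1) = (\<Prod>m\<in>Dv. \<Prod>h\<in>{0..<ll m}. (ee (of_real (oi m)) * F m h \<tau>) powi e m h)"
    unfolding f_prod_def using F_T \<tau> by (intro prod.cong refl) simp
  also have "\<dots> = (\<Prod>m\<in>Dv. \<Prod>h\<in>{0..<ll m}. ee (of_real (of_int (e m h) * oi m))) * f_prod \<tau>"
    unfolding f_prod_def prod_powi_distrib prod.distrib ee_powi by simp
  also have "(\<Prod>m\<in>Dv. \<Prod>h\<in>{0..<ll m}. ee (of_real (of_int (e m h) * oi m))) = ee (of_real order_inf)"
    unfolding order_inf_def of_real_sum ee_sum[OF finite_Dv] ee_sum[OF finite_atLeastLessThan] ..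
  finally show ?thesis .
qed

text \<open>The product of the multipliers of all factors. The assumption \<open>even2\<close> makes
  the sign left open for m'' = 2 disappear.\<close>

lemma f_prod_multiplier:
  assumes det: "a * d - b * (int N * c) = 1" and d: "odd d"
    and even2: "\<And>m. m \<in> Dv \<Longrightarrow> nn m = 2 \<Longrightarrow> even (e m 0)" and \<tau>: "Im \<tau> > 0"
  shows "f_prod (moebius a b (int N * c) d \<tau>) =
    ee (of_real (of_int (b * d) * order_inf + of_int (c * (a - 2 * d - b * d * (int N * c))) * order_zero
      + of_int (lin_total a d) / of_nat L - of_int (2 * c * d * quad_total) / of_nat L)) * sgn_tot a d * f_prod \<tau>"
proof -
  define X where "X = (\<lambda>m h. of_int (b * d) * oi m + of_int (c * (a - 2 * d - b * d * (int N * c))) * oz m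
        + of_int (kk m h * lin m a d - 2 * c * d * (kk m h)\<^sup>2 * isq m) / of_nat (ll m))"
  have "\<exists>s::int. (s = 1 \<or> s = -1) \<and> (nn m \<noteq> 2 \<longrightarrow> s = theta_sign (nn m) a d) \<and>
    (\<forall>\<tau>. Im \<tau> > 0 \<longrightarrow> F m h (moebius a b (int N * c) d \<tau>) = ee (of_real (X m h)) * of_int s * F m h \<tau>)"
    if "m \<in> Dv" "h \<in> {0..<ll m}" for m h
    unfolding X_def using F_multiplier[OF that(1) _ det d, of h] that(2) by simp
  then obtain s :: "nat \<Rightarrow> nat \<Rightarrow> int" where s:
    "\<And>m h. m \<in> Dv \<Longrightarrow> h \<in> {0..<ll m} \<Longrightarrow> s m h = 1 \<or> s m h = -1"
    "\<And>m h. m \<in> Dv \<Longrightarrow> h \<in> {0..<ll m} \<Longrightarrow> nn m \<noteq> 2 \<Longrightarrow> s m h = theta_sign (nn m) a d"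
    "\<And>m h. m \<in> Dv \<Longrightarrow> h \<in> {0..<ll m} \<Longrightarrow> F m h (moebius a b (int N * c) d \<tau>) = ee (of_real (X m h)) * of_int (s m h) * F m h \<tau>"
    using \<tau> by metis
  have "f_prod (moebius a b (int N * c) d \<tau>) =
      (\<Prod>m\<in>Dv. \<Prod>h\<in>{0..<ll m}. (ee (of_real (X m h)) * of_int (s m h) * F m h \<tau>) powi e m h)"
    unfolding f_prod_def using s(3) by (intro prod.cong refl) simp
  also have "\<dots> = (\<Prod>m\<in>Dv. \<Prod>h\<in>{0..<ll m}. ee (of_real (of_int (e m h) * X m h))) *
      (\<Prod>m\<in>Dv. \<Prod>h\<in>{0..<ll m}. of_int (s m h) powi e m h) * f_prod \<tau>"
    unfolding f_prod_def prod_powi_distrib prod.distrib ee_powi by simp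
  also have "(\<Prod>m\<in>Dv. \<Prod>h\<in>{0..<ll m}. of_int (s m h) powi e m h) = sgn_tot a d"
    unfolding sgn_tot_def
  proof (rule prod.cong[OF refl])
    fix m assume m: "m \<in> Dv"
    have ts: "of_int (theta_sign (nn m) a d) \<noteq> (0 :: complex)" using theta_sign_abs[of "nn m" a d] by auto
    show "(\<Prod>h\<in>{0..<ll m}. of_int (s m h) powi e m h) = (of_int (theta_sign (nn m) a d) powi (\<Sum>h\<in>{0..<ll m}. e m h) :: complex)"
    proof (cases "nn m = 2")
      case False
      then show ?thesis using s(2)[OF m] by (simp flip: powi_prod_sum[OF _ ts])
    next
      case True
      have "ll m = 1" by (rule mpp_eq_2(1)[OF m True])
      then show ?thesis using s(1)[OF m, of 0] even2[OF m True] sign_powi_even theta_sign_abs by simp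
    qed
  qed
  also have "(\<Prod>m\<in>Dv. \<Prod>h\<in>{0..<ll m}. ee (of_real (of_int (e m h) * X m h))) =
      ee (of_real (\<Sum>m\<in>Dv. \<Sum>h\<in>{0..<ll m}. of_int (e m h) * X m h))"
    unfolding of_real_sum ee_sum[OF finite_Dv] ee_sum[OF finite_atLeastLessThan] ..
  also have "(\<Sum>m\<in>Dv. \<Sum>h\<in>{0..<ll m}. of_int (e m h) * X m h) =
      of_int (b * d) * order_inf + of_int (c * (a - 2 * d - b * d * (int N * c))) * order_zero
      + of_int (lin_total a d) / of_nat L - of_int (2 * c * d * quad_total) / of_nat L"
  proof -
    define y where "y = real_of_int (c * (a - 2 * d - b * d * (int N * c)))"
    have "of_int (e m h) * X m h = of_int (b * d) * (of_int (e m h) * oi m) + y * (of_int (e m h) * oz m)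
      + of_int (e m h * kk m h * lin m a d * int (L div ll m)) / of_nat L
      - of_int (2 * c * d) * (of_int (e m h * (kk m h)\<^sup>2 * isq m * int (L div ll m)) / of_nat L)" if m: "m \<in> Dv" for m h
    proof -
      obtain k where k: "L = ll m * k" using ell_dvd_L[OF m] by auto
      have k0: "k > 0" "ll m > 0" using k L_pos by (auto intro: gr0I)
      have Lk: "L div ll m = k" using k k0 by simp
      show ?thesis unfolding X_def Lk y_def[symmetric] using k0
        by (simp add: k field_simps)
    qed
    then have "(\<Sum>m\<in>Dv. \<Sum>h\<in>{0..<ll m}. of_int (e m h) * X m h) = (\<Sum>m\<in>Dv. \<Sum>h\<in>{0..<ll m}.
       of_int (b * d) * (of_int (e m h) * oi m) + y * (of_int (e m h) * oz m)
      + of_int (e m h * kk m h * lin m a d * int (L div ll m)) / of_nat L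
      - of_int (2 * c * d) * (of_int (e m h * (kk m h)\<^sup>2 * isq m * int (L div ll m)) / of_nat L))"
      by (intro sum.cong refl) simp
    also have "\<dots> = of_int (b * d) * order_inf + y * order_zero + of_int (lin_total a d) / of_nat L - of_int (2 * c * d) * (of_int quad_total / of_nat L)"
      unfolding sum.distrib sum_subtractf sum_distrib_left[symmetric] sum_divide_distrib[symmetric]
        order_inf_def order_zero_def lin_total_def quad_total_def of_int_sum ..
    finally show ?thesis by (simp add: y_def)
  qed
  finally show ?thesis by simp
qed

lemma lin_total_1: "lin_total 1 1 = 0"
  unfolding lin_total_def using lin_1 by simp

lemma sgn_tot_1: "sgn_tot 1 1 = 1"
  unfolding sgn_tot_def using theta_sign_1 by simp

text \<open>Modulo m'' only 6 times the sum of squares survives. Hence 12 times \<open>oi m\<close>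
  is an integer unless m'' = 2.\<close>

lemma bernoulli_sum_dvd:
  assumes m: "m \<in> Dv"
  shows "int (nn m) dvd bernoulli_sum (nn m) (S1 (nn m))"
proof -
  have "bernoulli_sum (nn m) (S1 (nn m)) = (\<Sum>\<alpha>\<in>S1 (nn m). 6 * \<alpha>\<^sup>2) + (\<Sum>\<alpha>\<in>S1 (nn m). int (nn m) * (int (nn m) - 6 * \<alpha>))"
    unfolding bernoulli_sum_def sum.distrib[symmetric] by (rule sum.cong) (auto simp: algebra_simps power2_eq_square)
  moreover have "int (nn m) dvd (\<Sum>\<alpha>\<in>S1 (nn m). 6 * \<alpha>\<^sup>2)"
    using unit_reps_six_square_sum[OF S1[OF m] squarefree_mpp[OF m] mpp_pos[OF m]] by (simp add: sum_distrib_left)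
  moreover have "int (nn m) dvd (\<Sum>\<alpha>\<in>S1 (nn m). int (nn m) * (int (nn m) - 6 * \<alpha>))"
    by (rule dvd_sum) simp
  ultimately show ?thesis by simp
qed

text \<open>Multiply \<open>order_inf\<close> by 24: every m with m'' \<noteq> 2 contributes an even
  number, while m0 contributes -m0 times its exponent, with m0 odd. The total is a multiple of
  24.\<close>

lemma even_exponent:
  assumes order_inf: "ee (of_real order_inf) = 1" and m0: "m0 \<in> Dv" and n2: "nn m0 = 2"
  shows "even (e m0 0)"
proof -
  have l: "ll m0 = 1" by (rule mpp_eq_2(1)[OF m0 n2])
  have N2: "N = 2 * m0" by (rule mpp_eq_2(2)[OF m0 n2])
  define x where "x = (\<lambda>m. if m = m0 then - int m0 else 2 * int m * (bernoulli_sum (nn m) (S1 (nn m)) div int (nn m)))"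
  have x: "24 * oi m = of_int (x m)" if m: "m \<in> Dv" for m
  proof (cases "m = m0")
    case True
    have "S1 2 = {1}" using S1[OF m0] reps_2 n2 by simp
    then show ?thesis unfolding True x_def oi_def n2 by (simp add: bernoulli_sum_def)
  next
    case False
    have "nn m \<noteq> 2"
    proof
      assume "nn m = 2"
      then have "N = 2 * m" by (rule mpp_eq_2(2)[OF m])
      then show False using N2 False by simp
    qed
    moreover obtain z where "bernoulli_sum (nn m) (S1 (nn m)) = int (nn m) * z" using bernoulli_sum_dvd[OF m] by auto
    ultimately show ?thesis using False mpp_pos[OF m] by (simp add: x_def oi_def)
  qed
  define A where "A = (\<lambda>m. \<Sum>h\<in>{0..<ll m}. e m h)"
  obtain j :: int where "complex_of_real order_inf = of_int j" using order_inf unfolding ee_eq_1_iff by (auto simp: Ints_def)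
  then have j: "order_inf = of_int j" by (metis of_real_eq_iff of_real_of_int_eq)
  have "24 * order_inf = (\<Sum>m\<in>Dv. of_int (A m) * (24 * oi m))"
    unfolding order_inf_def A_def sum_distrib_left by (intro sum.cong refl) (simp add: sum_distrib_left sum_distrib_right mult_ac)
  also have "\<dots> = of_int (\<Sum>m\<in>Dv. A m * x m)"
    unfolding of_int_sum by (intro sum.cong refl) (simp add: x)
  finally have "24 * j = (\<Sum>m\<in>Dv. A m * x m)" unfolding j by linarith
  also have "\<dots> = A m0 * x m0 + (\<Sum>m\<in>Dv - {m0}. A m * x m)"
    by (rule sum.remove[OF finite_Dv m0])
  finally have "A m0 * x m0 = 24 * j - (\<Sum>m\<in>Dv - {m0}. A m * x m)" by simp
  moreover have "even (\<Sum>m\<in>Dv - {m0}. A m * x m)" by (rule dvd_sum) (simp add: x_def)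
  ultimately have "even (A m0 * x m0)" by simp
  moreover have "odd (x m0)" using mpp_eq_2(3)[OF m0 n2] by (simp add: x_def)
  ultimately show ?thesis by (simp add: A_def l)
qed

lemma prime_dvd_L_cases:
  assumes p: "prime p" "p dvd L"
  obtains N2 L' where "N = p\<^sup>2 * N2" "\<not> p dvd N2" "L = p * L'" "\<not> p dvd L'" "odd p"
proof -
  obtain N2 where N2: "N = p\<^sup>2 * N2" using p prime_dvd_max_square_root_iff[OF N p(1)] by auto
  obtain L' where L': "L = p * L'" using p by auto
  have "\<not> p dvd N2"
  proof
    assume "p dvd N2"
    then have "p\<^sup>2 * p dvd p\<^sup>2 * N2" by (rule mult_dvd_mono[OF dvd_refl])
    then have "p ^ 3 dvd p\<^sup>2 * N2" by (simp add: power3_eq_cube power2_eq_square mult.assoc)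
    then show False using not_cube_dvd[OF p(1)] N2 by metis
  qed
  moreover have "\<not> p dvd L'"
  proof
    assume "p dvd L'"
    then have "p * p dvd p * L'" by (rule mult_dvd_mono[OF dvd_refl])
    then have "p\<^sup>2 dvd L" unfolding L' power2_eq_square .
    then show False using sqf_L p by (metis not_prime_unit squarefreeD)
  qed
  moreover have "odd p" using p(2) odd_L by (meson dvd_trans)
  ultimately show ?thesis using that N2 L' by blast
qed

text \<open>A prime p \<ge> 5 dividing L divides L/l(m) or l(m); in the second case it divides m''
  and hence the sum of inverse squares. The prime 3 is left to
  \<open>quad_total_cancel\<close>.\<close>

lemma quad_total_dvd:
  assumes p: "prime p" "p dvd L" "p \<noteq> 3"
  shows "int p dvd quad_total"
  unfolding quad_total_def
proof (intro dvd_sum)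
  fix m h assume m: "m \<in> Dv"
  have p2: "p \<noteq> 2" using p odd_L by auto
  show "int p dvd e m h * (kk m h)\<^sup>2 * isq m * int (L div ll m)"
  proof (cases "p dvd ll m")
    case True
    then have "p dvd nn m" using ell_dvd_mpp[OF m] dvd_trans by blast
    then have "int p dvd isq m"
      unfolding inv_square_sum_def
      by (intro unit_reps_dvd_sums(2)[OF S1[OF m] p(1) _ p2 p(3) squarefree_mpp[OF m] mpp_pos[OF m]])
    then show ?thesis by simp
  next
    case False
    have "L = ll m * (L div ll m)" using ell_dvd_L[OF m] by simp
    then have "p dvd ll m * (L div ll m)" using p(2) by simp
    then have "p dvd L div ll m" using False p(1) prime_dvd_mult_iff by blast
    then show ?thesis by simp
  qed
qed

text \<open>The quadratic term enters with factor -2 c d, whereas the order at 0 carries it with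
  factor 2 Y, where Y = c (a - 2d - b d N c). For these to match one needs Y + c d to kill
  \<open>quad_total\<close> modulo L. Only p = 3 is in question, and there Y + c d \<equiv> c (a -
  d), which vanishes since a d \<equiv> 1 modulo 3 forces a \<equiv> d.\<close>

lemma quad_total_cancel:
  assumes det: "a * d - b * (int N * c) = 1"
  shows "int L dvd (c * (a - 2 * d - b * d * (int N * c)) + c * d) * quad_total"
proof (rule squarefree_dvdI[OF sqf_L L_pos])
  fix p assume p: "prime p" "p dvd L"
  show "int p dvd (c * (a - 2 * d - b * d * (int N * c)) + c * d) * quad_total"
  proof (cases "p = 3")
    case False
    then show ?thesis using quad_total_dvd[OF p False] by simp
  next
    case True
    have "(3::nat) dvd N"
      using prime_dvd_max_square_root_iff[OF N p(1)] p(2) unfolding True power2_eq_square by (metis dvd_mult_left)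
    then obtain N3 where N3: "int N = 3 * N3" by (metis dvd_def int_dvd_int_iff of_nat_numeral)
    have ad: "(a * d) mod 3 = 1"
    proof -
      have "a * d = 1 + 3 * (b * (N3 * c))" using det unfolding N3 by simp
      then show ?thesis by simp
    qed
    have "3 dvd a - d"
    proof -
      have "a mod 3 \<in> {0, 1, 2}" "d mod 3 \<in> {0, 1, 2}" by auto
      moreover have "(a mod 3 * (d mod 3)) mod 3 = 1" using ad by (simp add: mod_mult_eq)
      ultimately have "a mod 3 = d mod 3" by auto
      then show ?thesis by (simp add: mod_eq_dvd_iff)
    qed
    then have "3 dvd c * (a - d) - 3 * (c * b * d * N3 * c)" by (intro dvd_diff) auto
    also have "c * (a - d) - 3 * (c * b * d * N3 * c) = c * (a - 2 * d - b * d * (int N * c)) + c * d"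
      unfolding N3 by (simp add: algebra_simps)
    finally show ?thesis unfolding True by simp
  qed
qed

lemma f_prod_core:
  assumes order_inf: "ee (of_real order_inf) = 1" and order_zero: "ee (of_real (order_zero + 2 * of_int quad_total / of_nat L)) = 1"
    and det: "a * d - b * (int N * c) = 1" and d: "odd d" and \<tau>: "Im \<tau> > 0"
  shows "f_prod (moebius a b (int N * c) d \<tau>) = ee (of_real (of_int (lin_total a d) / of_nat L)) * sgn_tot a d * f_prod \<tau>"
proof -
  define Y where "Y = c * (a - 2 * d - b * d * (int N * c))"
  obtain z where z: "(Y + c * d) * quad_total = int L * z" using quad_total_cancel[OF det] unfolding Y_def by auto
  have L0: "real L > 0" using L_pos by simp
  have zr: "of_int (Y + c * d) * of_int quad_total = (real L * of_int z)"
    using arg_cong[OF z, of real_of_int] by simp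
  have "of_int (b * d) * order_inf + of_int Y * order_zero + of_int (lin_total a d) / of_nat L - of_int (2 * c * d * quad_total) / of_nat L =
     of_int (b * d) * order_inf + of_int Y * (order_zero + 2 * of_int quad_total / of_nat L) + of_int (lin_total a d) / of_nat L + of_int (- 2 * z)"
  proof -
    have "of_int (2 * c * d * quad_total) / real L = 2 * (real L * of_int z) / real L - of_int Y * (2 * of_int quad_total / of_nat L)"
      unfolding zr[symmetric] by (simp add: field_simps add_divide_distrib)
    then show ?thesis using L0 by (simp add: algebra_simps)
  qed
  moreover have "ee (of_real (of_int (b * d) * order_inf)) = 1" using ee_powi[of "of_real order_inf" "b * d"] order_inf by simp
  moreover have "ee (of_real (of_int Y * (order_zero + 2 * of_int quad_total / of_nat L))) = 1"
    using ee_powi[of "of_real (order_zero + 2 * of_int quad_total / of_nat L)" Y] order_zero by simp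
  moreover have "ee (of_real (of_int (- 2 * z))) = 1" using ee_int[of "- 2 * z"] by simp
  ultimately have "ee (of_real (of_int (b * d) * order_inf + of_int Y * order_zero + of_int (lin_total a d) / of_nat L - of_int (2 * c * d * quad_total) / of_nat L))
     = ee (of_real (of_int (lin_total a d) / of_nat L))"
    by (simp only: of_real_add ee_add) simp
  then show ?thesis
    using f_prod_multiplier[OF det d even_exponent[OF order_inf] \<tau>] unfolding Y_def by simp
qed

text \<open>The matrix (1, 0; -N, 1) fixes the cusp 0 and plays the role of the translation there,
  so its exponent is the order of f at 0 modulo integers. The quadratic term accounts for the
  factors with h \<noteq> 0, which \<open>oz\<close> does not describe.\<close>

lemma f_prod_T':
  assumes order_inf: "ee (of_real order_inf) = 1" and \<tau>: "Im \<tau> > 0"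
  shows "f_prod (moebius 1 0 (- int N) 1 \<tau>) = ee (of_real (order_zero + 2 * of_int quad_total / of_nat L)) * f_prod \<tau>"
proof -
  have det: "1 * 1 - 0 * (int N * (- 1)) = 1" by simp
  have "f_prod (moebius 1 0 (int N * (- 1)) 1 \<tau>) =
    ee (of_real (of_int (0 * 1) * order_inf + of_int (- 1 * (1 - 2 * 1 - 0 * 1 * (int N * (- 1)))) * order_zero
      + of_int (lin_total 1 1) / of_nat L - of_int (2 * (- 1) * 1 * quad_total) / of_nat L)) * sgn_tot 1 1 * f_prod \<tau>"
    by (rule f_prod_multiplier[OF det _ _ \<tau>]) (simp, rule even_exponent[OF order_inf])
  moreover have "of_int (0 * 1) * order_inf + of_int (- 1 * (1 - 2 * 1 - 0 * 1 * (int N * (- 1)))) * order_zero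
      + of_int (lin_total 1 1) / of_nat L - of_int (2 * (- 1) * 1 * quad_total) / of_nat L = order_zero + 2 * of_int quad_total / of_nat L"
    by (simp add: lin_total_1)
  ultimately show ?thesis by (simp only: sgn_tot_1 mult_1_right mult_minus1_right)
qed

definition weighted_sum :: int where
  "weighted_sum = (\<Sum>m\<in>Dv. int m * int (totient (nn m)) * (\<Sum>h\<in>{1..<ll m}. int h * e m h))"

text \<open>Terms with l(m) prime to p vanish on both sides, as p divides m and L/l(m). In the
  others \<open>fermat_quotient_sum\<close>, divided by p, replaces m''/p times \<open>lin\<close>
  by the totient of m'' times Q. The factor 2 N2 turns 2 k into h and, since N2 = m (m''/p) (l/p),
  clears the denominators.\<close>

lemma lin_total_cong:
  assumes p: "prime p" "p dvd L" and a: "coprime a (int N)" and ad: "[a * d = 1] (mod int N)"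
    and N2: "N = p\<^sup>2 * N2" and L': "L = p * L'" and Q: "a ^ (p - 1) - 1 = int p * Q"
  shows "[2 * int N2 * lin_total a d = int L' * Q * weighted_sum] (mod int p)"
proof -
  have p0: "p > 0" using p(1) prime_gt_0_nat by blast
  have podd: "odd p" using p(2) odd_L by (meson dvd_trans)
  have pointwise: "[2 * int N2 * (e m h * kk m h * lin m a d * int (L div ll m)) =
      int L' * Q * (int m * int (totient (nn m)) * (int h * e m h))] (mod int p)" if m: "m \<in> Dv" for m h
  proof (cases "p dvd ll m")
    case False
    have "L = ll m * (L div ll m)" using ell_dvd_L[OF m] by simp
    then have "p dvd ll m * (L div ll m)" using p(2) by simp
    then have "p dvd L div ll m" using False p(1) prime_dvd_mult_iff by blast
    moreover have "p dvd m" by (rule prime_not_dvd_ell[OF m p False])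
    ultimately have "int p dvd 2 * int N2 * (e m h * kk m h * lin m a d * int (L div ll m))"
      "int p dvd int L' * Q * (int m * int (totient (nn m)) * (int h * e m h))" by simp_all
    then show ?thesis by (simp add: cong_iff_dvd_diff)
  next
    case True
    have pn: "p dvd nn m" using True ell_dvd_mpp[OF m] dvd_trans by blast
    then obtain n1 where n1: "nn m = p * n1" by auto
    obtain l1 where l1: "ll m = p * l1" using True by auto
    obtain w0 where w0: "L = ll m * w0" using ell_dvd_L[OF m] by auto
    have l0: "ll m > 0" by (rule ell_pos[OF m])
    have w0': "L div ll m = w0" unfolding w0 using l0 by simp
    have L'l: "L' = l1 * w0" using L' w0 l1 p0 by (metis mult.assoc mult_cancel1 less_numeral_extra(3))
    have "p\<^sup>2 * N2 = p\<^sup>2 * (m * n1 * l1)"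
      using N2 N_eq[OF m] n1 l1 by (simp add: power2_eq_square mult_ac)
    then have N2': "N2 = m * n1 * l1" using p0 by simp
    have n2: "nn m > 2"
    proof -
      have "p > 2" using p(1) podd prime_ge_2_nat[of p] by (cases "p = 2") auto
      moreover have "p \<le> nn m" using pn mpp_pos[OF m] by (rule dvd_imp_le)
      ultimately show ?thesis by simp
    qed
    have can: "coprime a (int (nn m))"
    proof -
      have "int (nn m) dvd int N" using mpp_dvd[OF m] by simp
      then show ?thesis using a coprime_divisors dvd_refl by blast
    qed
    have adp: "[a * d = 1] (mod int p)"
      using ad cong_dvd_modulus[of "a * d" 1 "int N" "int p"] by (simp add: N2)
    have "[int (nn m) * lin m a d = 2 * int (card (S1 (nn m))) * (a ^ (p - 1) - 1)] (mod (int p)\<^sup>2)"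
      unfolding lin_sum_def
      by (rule fermat_quotient_sum[OF S1[OF m] mpp_gt_1[OF m] p(1) podd pn can adp])
    also have "2 * int (card (S1 (nn m))) = int (totient (nn m))"
      using unit_reps_card[OF S1[OF m] n2] by simp
    finally have "(int p)\<^sup>2 dvd int (nn m) * lin m a d - int (totient (nn m)) * (a ^ (p - 1) - 1)"
      by (simp add: cong_iff_dvd_diff)
    also have "int (nn m) * lin m a d - int (totient (nn m)) * (a ^ (p - 1) - 1) =
        int p * (int n1 * lin m a d - int (totient (nn m)) * Q)"
      unfolding Q by (simp add: n1 algebra_simps)
    finally have 1: "int p dvd int n1 * lin m a d - int (totient (nn m)) * Q"
      using p0 by (simp add: power2_eq_square)
    have "int (ll m) dvd 2 * kk m h - int h" using half_rep[OF odd_ell[OF m]] by (simp add: cong_iff_dvd_diff)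
    then have 2: "int p dvd 2 * kk m h - int h" using True by (metis dvd_trans int_dvd_int_iff)
    have "int p dvd int m * int L' * e m h * (2 * kk m h) * (int n1 * lin m a d - int (totient (nn m)) * Q)
       + int m * int L' * e m h * int (totient (nn m)) * Q * (2 * kk m h - int h)"
      using 1 2 by (intro dvd_add) (auto simp: dvd_mult)
    also have "\<dots> = 2 * int N2 * (e m h * kk m h * lin m a d * int (L div ll m)) -
       int L' * Q * (int m * int (totient (nn m)) * (int h * e m h))"
      unfolding w0' N2' L'l by (simp add: algebra_simps)
    finally show ?thesis by (simp add: cong_iff_dvd_diff)
  qed
  have e1: "2 * int N2 * lin_total a d = (\<Sum>m\<in>Dv. \<Sum>h\<in>{0..<ll m}. 2 * int N2 * (e m h * kk m h * lin m a d * int (L div ll m)))"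
    unfolding lin_total_def sum_distrib_left ..
  have e2: "[(\<Sum>m\<in>Dv. \<Sum>h\<in>{0..<ll m}. 2 * int N2 * (e m h * kk m h * lin m a d * int (L div ll m))) =
      (\<Sum>m\<in>Dv. \<Sum>h\<in>{0..<ll m}. int L' * Q * (int m * int (totient (nn m)) * (int h * e m h)))] (mod int p)"
    by (intro cong_sum pointwise)
  have e3: "(\<Sum>m\<in>Dv. \<Sum>h\<in>{0..<ll m}. int L' * Q * (int m * int (totient (nn m)) * (int h * e m h))) = int L' * Q * weighted_sum"
    unfolding weighted_sum_def sum_distrib_left
  proof (rule sum.cong[OF refl])
    fix m assume m: "m \<in> Dv"
    show "(\<Sum>h\<in>{0..<ll m}. int L' * Q * (int m * int (totient (nn m)) * (int h * e m h))) =
      (\<Sum>h\<in>{1..<ll m}. int L' * Q * (int m * int (totient (nn m)) * (int h * e m h)))"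
      using ell_pos[OF m] by (simp add: sum.atLeast_Suc_lessThan)
  qed
  show ?thesis using e2 unfolding e1[symmetric] e3 .
qed

end

section \<open>The criterion\<close>

text \<open>The translation by w conjugated with (1, 0; c, 1): a parabolic matrix fixing the cusp
  1/c.\<close>

lemma moebius_parabolic:
  assumes "Im \<tau> > 0"
  shows "moebius 1 0 c 1 (\<tau> + of_int w) = moebius (1 - c * w) w (- (c\<^sup>2 * w)) (1 + c * w) (moebius 1 0 c 1 \<tau>)"
proof -
  have "1 * 1 - 0 * c = (1::int)" by simp
  from moebius_compose[OF this assms, of "1 - c * w" w "- (c\<^sup>2 * w)" "1 + c * w"]
  show ?thesis using moebius_add_int[of 1 0 c 1 \<tau> w] by (simp add: algebra_simps power2_eq_square)
qed

text \<open>With d \<equiv> 1 modulo 4 the first part of the exponent of \<open>theta_sign\<close>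
  is even. Gauss's lemma then decides the parity of the floor sum, because 1 and -1 differ modulo an
  odd n > 1. The next lemma is the opposite case of a nonresidue.\<close>

lemma theta_sign_eq_1:
  assumes n: "odd n" "n > 1" and a: "[a = 1] (mod int n)" and d: "[d = 1] (mod 4)"
  shows "theta_sign n a d = 1"
proof -
  let ?S = "even_units n"
  have ca: "coprime a (int n)" using a cong_imp_coprime cong_sym by (metis coprime_1_left)
  have "[a ^ card ?S = 1 ^ card ?S] (mod int n)" using a by (rule cong_pow)
  then have "[eps (floor_sum n ?S a) * a ^ card ?S = eps (floor_sum n ?S a) * 1] (mod int n)"
    by (intro cong_scalar_left) simp
  then have 1: "[eps (floor_sum n ?S a) = 1] (mod int n)"
    using cong_trans[OF cong_sym gauss_floor_sum[OF n ca]] by simp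
  have "even (floor_sum n ?S a)"
  proof (rule ccontr)
    assume "odd (floor_sum n ?S a)"
    then have "[- 1 = 1] (mod int n)" using 1 by simp
    then have "int n dvd 2" by (simp add: cong_iff_dvd_diff)
    then have "int n dvd int 2" by simp
    then have "n dvd 2" by (simp only: int_dvd_int_iff)
    then have "n = 2" using n(2) dvd_imp_le[of n 2] by simp
    then show False using n(1) by simp
  qed
  moreover obtain k where "d - 1 = 4 * k" using d by (auto simp: cong_iff_dvd_diff)
  ultimately show ?thesis by (simp add: theta_sign_def)
qed

lemma theta_sign_eq_minus_1:
  assumes p: "prime p" "odd p" and a: "[a ^ ((p - 1) div 2) = - 1] (mod int p)" "coprime a (int p)" and d: "[d = 1] (mod 4)"
  shows "theta_sign p a d = - 1"
proof -
  let ?S = "even_units p"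
  have p1: "p > 1" using p(1) by (rule prime_gt_1_nat)
  have p2: "p > 2" using p p1 by (cases "p = 2") auto
  have "2 * card ?S = p - 1" using unit_reps_card[OF even_units_reps[OF p(2) p1] p2] p(1) by (simp add: totient_prime)
  then have K: "card ?S = (p - 1) div 2" by simp
  have "[eps (floor_sum p ?S a) * a ^ card ?S = eps (floor_sum p ?S a) * (- 1)] (mod int p)"
    unfolding K by (rule cong_scalar_left[OF a(1)])
  then have 1: "[eps (floor_sum p ?S a) * (- 1) = 1] (mod int p)"
    using cong_trans[OF cong_sym gauss_floor_sum[OF p(2) p1 a(2)]] by simp
  have "odd (floor_sum p ?S a)"
  proof (rule ccontr)
    assume "\<not> odd (floor_sum p ?S a)"
    then have "[- 1 = 1] (mod int p)" using 1 by simp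
    then have "int p dvd 2" by (simp add: cong_iff_dvd_diff)
    then have "int p dvd int 2" by simp
    then have "p dvd 2" by (simp only: int_dvd_int_iff)
    then show False using p2 by (auto dest: dvd_imp_le)
  qed
  moreover obtain k where "d - 1 = 4 * k" using d by (auto simp: cong_iff_dvd_diff)
  ultimately show ?thesis using p(2) by (simp add: theta_sign_def)
qed

text \<open>For a primitive root g the power with exponent (p - 1)/2 has square 1 but is not 1, so
  it is -1 modulo the prime p.\<close>

lemma ex_nonresidue:
  assumes p: "prime p" "odd p"
  obtains g :: int where "[g ^ ((p - 1) div 2) = - 1] (mod int p)" "coprime g (int p)"
proof -
  obtain g where "\<forall>k>0. residue_primroot (p ^ k) g"
    using residue_primroot_odd_prime_power_exists[OF p] by blast
  then have "residue_primroot (p ^ 1) g" by (simp only: zero_less_one)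
  then have pr: "residue_primroot p g" by (simp only: power_one_right)
  have g: "coprime p g" "ord p g = p - 1"
    using pr[unfolded residue_primroot_def] unfolding totient_prime[OF p(1)] by simp_all
  define j where "j = (p - 1) div 2"
  have p1: "p > 1" using p(1) by (rule prime_gt_1_nat)
  have j: "2 * j = p - 1" using p(2) by (auto simp: j_def)
  have j0: "0 < j" "j < p - 1" using j p1 by auto
  have cg: "coprime (int g) (int p)" using g(1) by (simp add: coprime_commute)
  have "\<not> [g ^ j = 1] (mod p)" 
    using j0 g(2) dvd_imp_le[of "p - 1" j] unfolding ord_divides by auto
  then have n1: "\<not> int p dvd int g ^ j - 1"
    using cong_int_iff[of "g ^ j" 1 p] by (simp add: cong_iff_dvd_diff)
  have "[g ^ (p - 1) = 1] (mod p)" using ord[of g p] g(2) by simp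
  then have "int p dvd int g ^ (2 * j) - 1"
    using cong_int_iff[of "g ^ (p - 1)" 1 p] unfolding j by (simp add: cong_iff_dvd_diff)
  also have "int g ^ (2 * j) - 1 = (int g ^ j - 1) * (int g ^ j + 1)"
    by (simp add: algebra_simps power_mult power2_eq_square mult_2 power_add)
  finally have "int p dvd int g ^ j + 1" using n1 p(1) prime_dvd_multD[of "int p"] by auto
  then have "[int g ^ j = - 1] (mod int p)" by (simp add: cong_iff_dvd_diff)
  then show ?thesis using that cg unfolding j_def by blast
qed

section \<open>Orders at the cusps and multipliers of stabilisers\<close>

context level
begin

text \<open>The order at infinity is computed with the matrix (1, 0; N, 1), before the parity of the
  exponent at m'' = 2 is known. At that stage a constant multiplier of unspecified value is enough
  to compare the two expansions.\<close>

lemma f_prod_multiplier_ex: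
  assumes det: "a * d - b * (int N * c) = 1" and d: "odd d"
  shows "\<exists>\<kappa>. \<kappa> \<noteq> 0 \<and> (\<forall>\<tau>. Im \<tau> > 0 \<longrightarrow> f_prod (moebius a b (int N * c) d \<tau>) = \<kappa> * f_prod \<tau>)"
proof -
  have "\<exists>\<kappa>. \<kappa> \<noteq> 0 \<and> (\<forall>\<tau>. Im \<tau> > 0 \<longrightarrow> F m h (moebius a b (int N * c) d \<tau>) = \<kappa> * F m h \<tau>)"
    if mh: "m \<in> Dv" "h \<in> {0..<ll m}" for m h
  proof -
    define X where "X = of_int (b * d) * oi m + of_int (c * (a - 2 * d - b * d * (int N * c))) * oz m
        + of_int (kk m h * lin m a d - 2 * c * d * (kk m h)\<^sup>2 * isq m) / of_nat (ll m)"
    obtain s :: int where s: "s = 1 \<or> s = -1"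
      "\<And>\<tau>. Im \<tau> > 0 \<Longrightarrow> F m h (moebius a b (int N * c) d \<tau>) = ee (of_real X) * of_int s * F m h \<tau>"
      using F_multiplier[OF mh(1) _ det d, of h] mh(2) unfolding X_def by auto
    then show ?thesis by (intro exI[of _ "ee (of_real X) * of_int s"]) auto
  qed
  then obtain \<kappa> where \<kappa>: "\<And>m h. m \<in> Dv \<Longrightarrow> h \<in> {0..<ll m} \<Longrightarrow> \<kappa> m h \<noteq> 0"
    "\<And>m h \<tau>. m \<in> Dv \<Longrightarrow> h \<in> {0..<ll m} \<Longrightarrow> Im \<tau> > 0 \<Longrightarrow> F m h (moebius a b (int N * c) d \<tau>) = \<kappa> m h * F m h \<tau>"
    by metis
  have "(\<Prod>m\<in>Dv. \<Prod>h\<in>{0..<ll m}. \<kappa> m h powi e m h) \<noteq> 0"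
    using \<kappa>(1) finite_Dv by (auto simp: prod_zero_iff)
  moreover have "f_prod (moebius a b (int N * c) d \<tau>) = (\<Prod>m\<in>Dv. \<Prod>h\<in>{0..<ll m}. \<kappa> m h powi e m h) * f_prod \<tau>" if "Im \<tau> > 0" for \<tau>
  proof -
    have "f_prod (moebius a b (int N * c) d \<tau>) = (\<Prod>m\<in>Dv. \<Prod>h\<in>{0..<ll m}. (\<kappa> m h * F m h \<tau>) powi e m h)"
      unfolding f_prod_def using \<kappa>(2) that by (intro prod.cong refl) simp
    then show ?thesis unfolding f_prod_def prod_powi_distrib prod.distrib .
  qed
  ultimately show ?thesis by blast
qed

lemma ee_eq_1_real: "ee (of_real x) = 1 \<longleftrightarrow> x \<in> \<int>"
  unfolding ee_eq_1_iff by (metis Ints_cases Ints_of_int of_real_eq_iff of_real_of_int_eq)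

lemma cusp_infinity:
  assumes "cusp_order N f_prod 1 N \<in> \<int>"
  shows "ee (of_real order_inf) = 1"
proof -
  have det: "1 * 1 - 0 * (int N * 1) = 1" by simp
  obtain A where A: "nice A (\<lambda>\<tau>. f_prod (moebius 1 0 (int N * 1) 1 \<tau>))" using f_prod_nice[OF det] by blast
  obtain \<kappa> where \<kappa>: "\<kappa> \<noteq> 0" "\<And>\<tau>. Im \<tau> > 0 \<Longrightarrow> f_prod (moebius 1 0 (int N * 1) 1 \<tau>) = \<kappa> * f_prod \<tau>"
    using f_prod_multiplier_ex[OF det] by auto
  have "ee (of_real (A * 1)) = ee (of_real order_inf)"
  proof (rule nice_multiplier[OF A])
    fix \<tau> assume \<tau>: "Im \<tau> > 0"
    then have "Im (\<tau> + of_real 1) > 0" by simp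
    then show "f_prod (moebius 1 0 (int N * 1) 1 (\<tau> + of_real 1)) = ee (of_real order_inf) * f_prod (moebius 1 0 (int N * 1) 1 \<tau>)"
      using \<kappa>(2) \<tau> f_prod_T[OF \<tau>] by simp
  qed
  moreover have "cusp_order N f_prod 1 N = A"
  proof -
    have "gcd (N\<^sup>2) N = N" by (simp add: power2_eq_square)
    then show ?thesis using cusp_order_eq[of A f_prod N N] A N by simp
  qed
  ultimately show ?thesis using assms ee_eq_1_real[of A] by simp
qed

text \<open>The matrix (1, 0; 1, 1) sends \<tau> to 1 - 1/(\<tau> + 1), and f has period 1 by
  integrality at infinity. Translating \<tau> by the width N then acts on z = -1/(\<tau> + 1) as (1,
  0; -N, 1).\<close>

lemma cusp_zero:
  assumes order_inf: "ee (of_real order_inf) = 1" and "cusp_order N f_prod 1 1 \<in> \<int>"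
  shows "ee (of_real (order_zero + 2 * of_int quad_total / of_nat L)) = 1"
proof -
  have det: "1 * 1 - 0 * 1 = (1::int)" by simp
  obtain A where A: "nice A (\<lambda>\<tau>. f_prod (moebius 1 0 1 1 \<tau>))" using f_prod_nice[OF det] by blast
  have g: "f_prod (moebius 1 0 1 1 \<tau>) = f_prod (- 1 / (\<tau> + 1))" if \<tau>: "Im \<tau> > 0" for \<tau>
  proof -
    have nz: "\<tau> + 1 \<noteq> 0"
    proof
      assume "\<tau> + 1 = 0"
      then have "Im (\<tau> + 1) = 0" by simp
      then show False using \<tau> by simp
    qed
    then have "moebius 1 0 1 1 \<tau> = - 1 / (\<tau> + 1) + 1" by (simp add: moebius_def field_simps)
    moreover have "Im (- 1 / (\<tau> + 1)) > 0" by (rule Im_uminus_inverse) (use \<tau> in simp)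
    ultimately show ?thesis using f_prod_T[of "- 1 / (\<tau> + 1)"] by (simp only: order_inf mult_1)
  qed
  have "ee (of_real (A * real N)) = ee (of_real (order_zero + 2 * of_int quad_total / of_nat L))"
  proof (rule nice_multiplier[OF A])
    fix \<tau> assume \<tau>: "Im \<tau> > 0"
    define z where "z = - 1 / (\<tau> + 1)"
    have z: "Im z > 0" unfolding z_def by (rule Im_uminus_inverse) (use \<tau> in simp)
    have nz: "\<tau> + 1 \<noteq> 0" "\<tau> + 1 + of_nat N \<noteq> 0"
    proof -
      have "Im (\<tau> + 1) \<noteq> 0" "Im (\<tau> + 1 + of_nat N) \<noteq> 0" using \<tau> by simp_all
      then show "\<tau> + 1 \<noteq> 0" "\<tau> + 1 + of_nat N \<noteq> 0" by (metis zero_complex.sel(2))+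
    qed
    have "moebius 1 0 (- int N) 1 z = z / (1 - of_nat N * z)" by (simp add: moebius_def algebra_simps)
    also have "\<dots> = - 1 / (\<tau> + 1 + of_nat N)"
    proof -
      have "1 - of_nat N * z = (\<tau> + 1 + of_nat N) / (\<tau> + 1)" using nz by (simp add: z_def field_simps)
      then show ?thesis using nz by (simp add: z_def field_simps)
    qed
    finally have m: "- 1 / (\<tau> + of_real (real N) + 1) = moebius 1 0 (- int N) 1 z" by (simp add: add_ac)
    have "Im (\<tau> + of_real (real N)) > 0" using \<tau> by simp
    from g[OF this] have "f_prod (moebius 1 0 1 1 (\<tau> + of_real (real N))) = f_prod (moebius 1 0 (- int N) 1 z)" unfolding m .
    also have "\<dots> = ee (of_real (order_zero + 2 * of_int quad_total / of_nat L)) * f_prod z" by (rule f_prod_T'[OF order_inf z])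
    also have "f_prod z = f_prod (moebius 1 0 1 1 \<tau>)" unfolding z_def g[OF \<tau>] ..
    finally show "f_prod (moebius 1 0 1 1 (\<tau> + of_real (real N))) =
      ee (of_real (order_zero + 2 * of_int quad_total / of_nat L)) * f_prod (moebius 1 0 1 1 \<tau>)" .
  qed
  moreover have "cusp_order N f_prod 1 1 = A * real N"
    using cusp_order_eq[of A f_prod 1 N] A by simp
  ultimately show ?thesis using assms(2) ee_eq_1_real[of "A * real N"] by simp
qed

text \<open>For the width w the product c^2 w is divisible by N, so the matrix of
  \<open>moebius_parabolic\<close> lies in \<Gamma>0(N) and the expansion at the cusp is invariant
  under translation by w. This covers the three cusps of the criterion at once.\<close>

lemma cusp_integral:
  assumes inv: "\<And>a b c d \<tau>. a * d - b * c = 1 \<Longrightarrow> int N dvd c \<Longrightarrow> Im \<tau> > 0 \<Longrightarrow> f_prod (moebius a b c d \<tau>) = f_prod \<tau>"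
  shows "cusp_order N f_prod 1 c \<in> \<int>"
proof -
  define g where "g = gcd (c\<^sup>2) N"
  define w where "w = N div g"
  have g0: "g > 0" using N by (simp add: g_def)
  have gN: "N = g * w" by (simp add: w_def g_def)
  obtain k where k: "c\<^sup>2 = g * k" by (metis dvd_def g_def gcd_dvd1)
  have det: "1 * 1 - 0 * int c = 1" by simp
  obtain A where A: "nice A (\<lambda>\<tau>. f_prod (moebius 1 0 (int c) 1 \<tau>))" using f_prod_nice[OF det] by blast
  have "ee (of_real (A * real w)) = 1"
  proof (rule nice_multiplier[OF A])
    fix \<tau> assume \<tau>: "Im \<tau> > 0"
    have "(int c)\<^sup>2 * int w = int N * int k" using k gN by (simp flip: of_nat_power of_nat_mult)
    then have "int N dvd - ((int c)\<^sup>2 * int w)" by simp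
    moreover have "(1 - int c * int w) * (1 + int c * int w) - int w * (- ((int c)\<^sup>2 * int w)) = 1"
      by (simp add: algebra_simps power2_eq_square)
    moreover have "\<tau> + of_real (real w) = \<tau> + of_int (int w)" by simp
    ultimately show "f_prod (moebius 1 0 (int c) 1 (\<tau> + of_real (real w))) = 1 * f_prod (moebius 1 0 (int c) 1 \<tau>)"
      using inv[OF _ _ Im_moebius_pos[OF det \<tau>]] moebius_parabolic[OF \<tau>, of "int c" "int w"] by simp
  qed
  then have "A * real w \<in> \<int>" by (simp only: ee_eq_1_real)
  moreover have "real N / real g = real w" unfolding gN using g0 by simp
  ultimately show ?thesis unfolding cusp_order_eq[of A f_prod c N, OF A] g_def[symmetric] by (simp add: mult.commute)
qed

text \<open>For given a and d the sign depends on m'' only; grouping the divisors by m'' makes the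
  exponents of condition (5) appear.\<close>

lemma sgn_tot_group:
  "sgn_tot a d = (\<Prod>v\<in>(\<lambda>m. nn m) ` Dv. of_int (theta_sign v a d) powi (\<Sum>m\<in>{m \<in> Dv. nn m = v}. \<Sum>h\<in>{0..<ll m}. e m h))"
proof -
  have "(\<Prod>m\<in>{m \<in> Dv. nn m = v}. of_int (theta_sign (nn m) a d) powi (\<Sum>h\<in>{0..<ll m}. e m h)) =
      (of_int (theta_sign v a d) powi (\<Sum>m\<in>{m \<in> Dv. nn m = v}. \<Sum>h\<in>{0..<ll m}. e m h) :: complex)" for v
  proof -
    have nz: "of_int (theta_sign v a d) \<noteq> (0 :: complex)" using theta_sign_abs[of v a d] by auto
    have "finite {m \<in> Dv. nn m = v}" using finite_Dv by simp
    from powi_prod_sum[OF this nz, symmetric] show ?thesis by simp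
  qed
  then show ?thesis unfolding sgn_tot_def by (subst prod.image_gen[OF finite_Dv, of _ "\<lambda>m. nn m"]) simp
qed

lemma sgn_tot_pm: "sgn_tot a d = 1 \<or> sgn_tot a d = -1"
proof -
  have s: "of_int (theta_sign v a d) powi k = (1::complex) \<or> of_int (theta_sign v a d) powi k = (-1::complex)" for v k
    using theta_sign_abs[of v a d] by (cases "even k") (auto simp: power_int_minus_left)
  have "(\<Prod>m\<in>X. of_int (theta_sign (nn m) a d) powi (\<Sum>h\<in>{0..<ll m}. e m h)) = (1::complex) \<or>
    (\<Prod>m\<in>X. of_int (theta_sign (nn m) a d) powi (\<Sum>h\<in>{0..<ll m}. e m h)) = (-1::complex)" if "finite X" for X
    using that
  proof (induction X rule: finite_induct)
    case (insert x X)
    then show ?case using s[of "nn x" "\<Sum>h\<in>{0..<ll x}. e x h"] by auto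
  qed simp
  from this[OF finite_Dv] show ?thesis unfolding sgn_tot_def .
qed

text \<open>A squarefree number greater than 1 that is a power of p is p itself.\<close>

lemma mpp_prime_power_iff:
  assumes p: "prime p" and m: "m \<in> Dv"
  shows "(\<exists>r. nn m = p ^ r) \<longleftrightarrow> nn m = p"
proof
  assume "\<exists>r. nn m = p ^ r"
  then obtain r where r: "nn m = p ^ r" by blast
  have "r \<noteq> 0" using r mpp_gt_1[OF m] by (intro notI) simp
  moreover have "\<not> r \<ge> 2"
  proof
    assume "r \<ge> 2"
    then have "p\<^sup>2 dvd nn m" unfolding r by (rule le_imp_power_dvd)
    then show False using squarefree_mpp[OF m] p by (metis not_prime_unit squarefreeD)
  qed
  ultimately have "r = 1" by simp
  then show "nn m = p" using r by simp
qed (auto intro: exI[of _ 1])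

abbreviation "prime_exponent_sum p \<equiv> (\<Sum>m\<in>{m \<in> Dv. nn m = p}. \<Sum>h\<in>{0..<ll m}. e m h)"

lemma theta_sign_trivial:
  assumes v: "v \<in> (\<lambda>m. nn m) ` Dv" and a: "coprime a (int N)" and np: "\<not> (prime v \<and> odd v)"
  shows "theta_sign v a d = 1"
proof (cases "even v")
  case False
  obtain m where m: "m \<in> Dv" "v = nn m" using v by blast
  have "int v dvd int N" using mpp_dvd[OF m(1)] m(2) by simp
  then have "coprime a (int v)" using a coprime_divisors dvd_refl by blast
  then show ?thesis using theta_sign_composite[of v a d] squarefree_mpp[OF m(1)] mpp_gt_1[OF m(1)] m(2) np False by simp
qed (simp add: theta_sign_def)

lemma coprime_of_level_det: "a * d - b * (int N * c) = 1 \<Longrightarrow> coprime a (int N)"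
  using coprime_of_det[of a d b 1 "int N" 1 c] by simp

lemma sufficient:
  assumes order_inf: "ee (of_real order_inf) = 1" and order_zero: "ee (of_real (order_zero + 2 * of_int quad_total / of_nat L)) = 1"
    and weighted_sum: "int L dvd weighted_sum" and prime_exponent_sum: "\<And>p. prime p \<Longrightarrow> odd p \<Longrightarrow> p dvd N \<Longrightarrow> even (prime_exponent_sum p)"
    and det: "a * d - b * c = 1" and c: "int N dvd c" and \<tau>: "Im \<tau> > 0"
  shows "f_prod (moebius a b c d \<tau>) = f_prod \<tau>"
proof -
  have main: "f_prod (moebius a b (int N * c) d \<tau>) = f_prod \<tau>"
    if det: "a * d - b * (int N * c) = 1" and d: "odd d" and \<tau>: "Im \<tau> > 0" for a b c d \<tau>
  proof -
    have ca: "coprime a (int N)" by (rule coprime_of_level_det[OF det])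
    have ad: "[a * d = 1] (mod int N)"
    proof -
      have "a * d - 1 = int N * (b * c)" using det by (simp add: algebra_simps)
      then show ?thesis by (simp add: cong_iff_dvd_diff)
    qed
    have "int L dvd lin_total a d"
    proof (rule squarefree_dvdI[OF sqf_L L_pos])
      fix p assume p: "prime p" "p dvd L"
      obtain N2 L' where 1: "N = p\<^sup>2 * N2" "\<not> p dvd N2" "L = p * L'" "\<not> p dvd L'" "odd p"
        by (rule prime_dvd_L_cases[OF p]) (rule that)
      have pN: "p dvd N" unfolding 1(1) by simp
      have "\<not> int p dvd a"
      proof
        assume "int p dvd a"
        moreover have "int p dvd int N" using pN by simp
        ultimately have "is_unit (int p)" using ca coprime_common_divisor by blast
        then show False using p(1) by simp
      qed
      from fermat_theorem_of_int[OF p(1) this] obtain Q where Q: "a ^ (p - 1) - 1 = int p * Q"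
        by (auto simp: cong_iff_dvd_diff)
      have "int p dvd weighted_sum" using weighted_sum p(2) by (meson dvd_trans int_dvd_int_iff)
      then have "int p dvd int L' * Q * weighted_sum" by simp
      then have "int p dvd 2 * int N2 * lin_total a d"
        using lin_total_cong[OF p ca ad 1(1,3) Q] cong_dvd_iff[of "2 * int N2 * lin_total a d"] cong_dvd_modulus
        by (meson cong_dvd_iff)
      moreover have "\<not> int p dvd 2"
      proof
        assume "int p dvd 2"
        then have "int p dvd int 2" by simp
    then have "p dvd 2" by (simp only: int_dvd_int_iff)
        then show False using p(1) 1(5) by (metis primes_dvd_imp_eq two_is_prime_nat dvd_refl)
      qed
      moreover have "\<not> int p dvd int N2" using 1(2) by simp
      moreover have "prime (int p)" using p(1) by simp
      ultimately show "int p dvd lin_total a d" by (simp add: prime_dvd_mult_iff)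
    qed
    then obtain z where z: "lin_total a d = int L * z" by auto
    have "of_int (lin_total a d) / real L = of_int z" using L_pos by (simp add: z)
    then have 1: "ee (of_real (of_int (lin_total a d) / of_nat L)) = 1" by simp
    have "sgn_tot a d = 1"
      unfolding sgn_tot_group
    proof (rule prod.neutral, intro ballI)
      fix v assume v: "v \<in> (\<lambda>m. nn m) ` Dv"
      show "of_int (theta_sign v a d) powi (prime_exponent_sum v) = (1 :: complex)"
      proof (cases "prime v \<and> odd v")
        case True
        have "v dvd N" using v mpp_dvd by auto
        then show ?thesis using sign_powi_even[OF theta_sign_abs prime_exponent_sum] True by blast
      next
        case False
        then show ?thesis using theta_sign_trivial[OF v ca] by simp
      qed
    qed
    then show ?thesis using f_prod_core[OF order_inf order_zero det d \<tau>] 1 by simp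
  qed
  obtain c' where c': "c = int N * c'" using c by auto
  show ?thesis
  proof (cases "odd d")
    case True
    then show ?thesis using main[of a d b c' \<tau>] det \<tau> unfolding c' by simp
  next
    case False
    \<comment> \<open>Since d is even, c must be odd, and multiplying the matrix by the translation
      gives the odd lower right entry c + d. By integrality at infinity f is invariant under the
      translation.\<close>
    have "odd (b * c)"
    proof
      assume "even (b * c)"
      then have "even (a * d - b * c)" using False by simp
      then show False using det by simp
    qed
    then have "odd (c + d)" using False by simp
    moreover have "a * (c + d) - (a + b) * c = 1" using det by (simp add: algebra_simps)
    moreover have \<tau>': "Im (\<tau> - 1) > 0" using \<tau> by simp
    ultimately have "f_prod (moebius a (a + b) c (c + d) (\<tau> - 1)) = f_prod (\<tau> - 1)"
      using main[of a "c + d" "a + b" c' "\<tau> - 1"] unfolding c' by simp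
    moreover have "moebius a (a + b) c (c + d) (\<tau> - 1) = moebius a b c d \<tau>"
      using moebius_add_int[of a b c d "\<tau> - 1" 1] by (simp add: add.commute)
    moreover have "f_prod \<tau> = f_prod (\<tau> - 1)" using f_prod_T[OF \<tau>'] order_inf by simp
    ultimately show ?thesis by simp
  qed
qed

lemma modular_if_invariant:
  assumes inv: "\<And>a b c d \<tau>. a * d - b * c = 1 \<Longrightarrow> int N dvd c \<Longrightarrow> Im \<tau> > 0 \<Longrightarrow> f_prod (moebius a b c d \<tau>) = f_prod \<tau>"
  shows "modular_function_X0 N f_prod"
  unfolding modular_function_X0_def
proof (intro conjI allI impI)
  obtain A where "nice A (\<lambda>\<tau>. f_prod (moebius 1 0 0 1 \<tau>))" using f_prod_nice[of 1 1 0 0] by auto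
  then have "f_prod holomorphic_on uhp" using nice_holomorphic by (fastforce simp: moebius_def)
  then show "f_prod nicely_meromorphic_on uhp"
    by (intro analytic_on_imp_nicely_meromorphic_on) (simp add: analytic_on_open open_uhp)
next
  fix a b c d :: int and \<tau> :: complex assume "a * d - b * c = 1" "int N dvd c" "Im \<tau> > 0"
  then show "f_prod (moebius a b c d \<tau>) = f_prod \<tau>" by (rule inv)
next
  fix a b c d :: int assume det: "a * d - b * c = 1"
  obtain A where A: "nice A (\<lambda>\<tau>. f_prod (moebius a b c d \<tau>))" using f_prod_nice[OF det] by blast
  have "f_prod (moebius a b c d (\<tau> + of_nat N)) = f_prod (moebius a b c d \<tau>)" if \<tau>: "Im \<tau> > 0" for \<tau>
  proof -
    \<comment> \<open>The conjugate of the translation by N with the given matrix. It is the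
      identity modulo N, so the expansion at this cusp has period N.\<close>
    define a' b' c' d' where "a' = 1 - int N * (a * c)" and "b' = int N * a\<^sup>2" and "c' = - (int N * c\<^sup>2)"
      and "d' = 1 + int N * (a * c)"
    have det': "a' * d' - b' * c' = 1" by (simp add: a'_def b'_def c'_def d'_def algebra_simps power2_eq_square)
    have "moebius a' b' c' d' (moebius a b c d \<tau>) = moebius (a' * a + b' * c) (a' * b + b' * d) (c' * a + d' * c) (c' * b + d' * d) \<tau>"
      by (rule moebius_compose[OF det \<tau>])
    also have "a' * a + b' * c = a" by (simp add: a'_def b'_def algebra_simps power2_eq_square)
    also have "c' * a + d' * c = c" by (simp add: c'_def d'_def algebra_simps power2_eq_square)
    also have "a' * b + b' * d = b + int N * a * (a * d - b * c)"
      by (simp add: a'_def b'_def algebra_simps power2_eq_square)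
    also have "c' * b + d' * d = d + int N * c * (a * d - b * c)"
      by (simp add: c'_def d'_def algebra_simps power2_eq_square)
    also have "a * d - b * c = 1" by (rule det)
    also have "moebius a (b + int N * a * 1) c (d + int N * c * 1) \<tau> = moebius a (b + int N * a) c (d + int N * c) \<tau>"
      by simp
    also have "moebius a (b + int N * a) c (d + int N * c) \<tau> = moebius a b c d (\<tau> + of_nat N)"
      using moebius_add_int[of a b c d \<tau> "int N"] by simp
    finally have "moebius a b c d (\<tau> + of_nat N) = moebius a' b' c' d' (moebius a b c d \<tau>)" ..
    then show ?thesis using inv[OF det' _ Im_moebius_pos[OF det \<tau>]] by (simp add: c'_def)
  qed
  from nice_periodic[OF A N this]
  show "\<exists>G B. G meromorphic_on {0} \<and> (\<forall>\<tau>. Im \<tau> > 0 \<longrightarrow> Im \<tau> > B \<longrightarrow> f_prod (moebius a b c d \<tau>) = G (qpow \<tau> (1 / real N)))"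
    by blast
qed

lemma necessary:
  assumes inv: "\<And>a b c d \<tau>. a * d - b * c = 1 \<Longrightarrow> int N dvd c \<Longrightarrow> Im \<tau> > 0 \<Longrightarrow> f_prod (moebius a b c d \<tau>) = f_prod \<tau>"
    and order_inf: "ee (of_real order_inf) = 1" and order_zero: "ee (of_real (order_zero + 2 * of_int quad_total / of_nat L)) = 1"
    and ad: "[a * d = 1] (mod int N)" and d: "odd d"
  shows "int L dvd lin_total a d" "sgn_tot a d = 1"
proof -
  \<comment> \<open>Any a and d inverse to each other modulo N are the diagonal of a matrix with b =
    1.\<close>
  obtain c where "a * d - 1 = int N * c" using ad by (auto simp: cong_iff_dvd_diff)
  then have det: "a * d - 1 * (int N * c) = 1" by simp
  have i: "Im \<i> > 0" by simp
  define x where "x = (of_int (lin_total a d) / of_nat L :: real)"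
  have "f_prod \<i> = ee (of_real x) * sgn_tot a d * f_prod \<i>"
    using f_prod_core[OF order_inf order_zero det d i] inv[OF det _ i] unfolding x_def by simp
  then have eq: "ee (of_real x) * sgn_tot a d = 1" using f_prod_nonzero[OF i] by simp
  have "ee (of_real x) ^ L = 1"
  proof -
    have "ee (of_real x) ^ L = ee (of_real (real L * x))" by (simp add: ee_power)
    also have "real L * x = of_int (lin_total a d)" using L_pos by (simp add: x_def)
    finally show ?thesis by simp
  qed
  \<comment> \<open>The L-th power kills the root of unity and, L being odd, keeps the sign. So both
    factors are 1 separately.\<close>
  then have "sgn_tot a d ^ L = 1" using arg_cong[OF eq, of "\<lambda>z. z ^ L"] by (simp add: power_mult_distrib)
  then show s: "sgn_tot a d = 1" using sgn_tot_pm[of a d] odd_L by auto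
  have "ee (of_real x) = 1" using eq s by simp
  then obtain z :: int where "x = of_int z" unfolding ee_eq_1_real by (auto simp: Ints_def)
  then have "real_of_int (lin_total a d) = of_int (int L * z)" using L_pos by (simp add: x_def field_simps)
  then have "lin_total a d = int L * z" by (simp only: of_int_eq_iff)
  then show "int L dvd lin_total a d" by simp
qed

lemma necessary_weighted_sum:
  assumes inv: "\<And>a b c d \<tau>. a * d - b * c = 1 \<Longrightarrow> int N dvd c \<Longrightarrow> Im \<tau> > 0 \<Longrightarrow> f_prod (moebius a b c d \<tau>) = f_prod \<tau>"
    and order_inf: "ee (of_real order_inf) = 1" and order_zero: "ee (of_real (order_zero + 2 * of_int quad_total / of_nat L)) = 1"
  shows "int L dvd weighted_sum"
proof (rule squarefree_dvdI[OF sqf_L L_pos])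
  fix p assume p: "prime p" "p dvd L"
  obtain N2 L' where 1: "N = p\<^sup>2 * N2" "\<not> p dvd N2" "L = p * L'" "\<not> p dvd L'" "odd p"
    by (rule prime_dvd_L_cases[OF p]) (rule that)
  define P where "P = int p"
  have "coprime p (2 * N2)" using p(1) 1 prime_imp_coprime_nat[of p "2 * N2"] prime_dvd_mult_iff
    by (metis primes_dvd_imp_eq two_is_prime_nat dvd_refl)
  then have "coprime (int (p\<^sup>2)) (int (2 * N2))" by (simp only: coprime_int_iff coprime_power_left_iff) simp
  then have cop: "coprime (P\<^sup>2) (2 * int N2)" by (simp add: P_def)
  \<comment> \<open>The Fermat quotient of 1 + p is -1 modulo p, so this a detects
    \<open>weighted_sum\<close> modulo p through \<open>lin_total_cong\<close>. The second
    congruence makes a odd and prime to N2.\<close>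
  obtain a where a: "[a = 1 + P] (mod P\<^sup>2)" "[a = 1] (mod 2 * int N2)"
    using binary_chinese_remainder_int[OF cop] by blast
  have "coprime (1 + P) (P\<^sup>2)"
  proof -
    have "coprime (1 + P) P" by (metis coprime_1_left coprime_iff_gcd_eq_1 gcd_add1 gcd.commute add.commute)
    then show ?thesis by simp
  qed
  then have "coprime a (P\<^sup>2)" using a(1) cong_imp_coprime cong_sym by blast
  moreover have "coprime a (2 * int N2)" using a(2) cong_imp_coprime cong_sym by (metis coprime_1_left)
  ultimately have ca2: "coprime a (2 * int N)" by (simp add: 1(1) P_def)
  then have ca: "coprime a (int N)" by simp
  \<comment> \<open>The inverse is taken modulo 2 N so that d is odd also when N is odd.\<close>
  obtain d where d: "[a * d = 1] (mod 2 * int N)" using cong_solve_coprime_int[OF ca2] by auto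
  have ad: "[a * d = 1] (mod int N)" using cong_dvd_modulus[OF d, of "int N"] by simp
  have "odd d"
  proof
    assume "even d"
    have "[a * d = 1] (mod 2)" using cong_dvd_modulus[OF d, of 2] by simp
    then have "2 dvd a * d - 1" by (simp add: cong_iff_dvd_diff)
    then show False using \<open>even d\<close> by simp
  qed
  from necessary(1)[OF inv order_inf order_zero ad this] have "int L dvd lin_total a d" .
  then have "int p dvd lin_total a d" using p(2) by (meson dvd_trans int_dvd_int_iff)
  have p1: "p > 1" by (rule prime_gt_1_nat[OF p(1)])
  have "P\<^sup>2 dvd (1 + P) ^ (p - 1) - 1 ^ (p - 1) - of_nat (p - 1) * P * 1 ^ (p - 1 - 1)"
    by (rule binomial_cong_square)
  moreover have "P\<^sup>2 dvd a ^ (p - 1) - (1 + P) ^ (p - 1)"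
    using cong_pow[OF a(1), of "p - 1"] by (simp add: cong_iff_dvd_diff)
  ultimately have "P\<^sup>2 dvd (a ^ (p - 1) - (1 + P) ^ (p - 1)) +
      ((1 + P) ^ (p - 1) - 1 ^ (p - 1) - of_nat (p - 1) * P * 1 ^ (p - 1 - 1)) + P\<^sup>2"
    by (intro dvd_add) auto
  also have "\<dots> = a ^ (p - 1) - 1 + P"
    using p1 by (simp add: P_def of_nat_diff algebra_simps power2_eq_square)
  finally have 2: "P\<^sup>2 dvd a ^ (p - 1) - 1 + P" .
  have "P dvd a ^ (p - 1) - 1 + P" using 2 by (metis dvd_mult_left power2_eq_square)
  then have "P dvd a ^ (p - 1) - 1" by simp
  then obtain Q where Q: "a ^ (p - 1) - 1 = int p * Q" by (auto simp: P_def)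
  have "P * P dvd P * (Q + 1)" using 2 unfolding Q by (simp add: P_def algebra_simps power2_eq_square)
  then have PQ: "P dvd Q + 1" using p1 by (simp add: P_def)
  have nQ: "\<not> int p dvd Q"
  proof
    assume "int p dvd Q"
    then have "P dvd (Q + 1) - Q" using PQ unfolding P_def by (rule dvd_diff[rotated])
    then show False using p(1) by (simp add: P_def)
  qed
  have "int p dvd int L' * Q * weighted_sum"
    using lin_total_cong[OF p ca ad 1(1,3) Q] \<open>int p dvd lin_total a d\<close> by (meson cong_dvd_iff dvd_mult)
  moreover have "prime (int p)" "\<not> int p dvd int L'" using p(1) 1(4) by simp_all
  ultimately show "int p dvd weighted_sum" using nQ by (simp add: prime_dvd_mult_iff)
qed

lemma necessary_prime_exponent_sum:
  assumes inv: "\<And>a b c d \<tau>. a * d - b * c = 1 \<Longrightarrow> int N dvd c \<Longrightarrow> Im \<tau> > 0 \<Longrightarrow> f_prod (moebius a b c d \<tau>) = f_prod \<tau>"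
    and order_inf: "ee (of_real order_inf) = 1" and order_zero: "ee (of_real (order_zero + 2 * of_int quad_total / of_nat L)) = 1"
    and p: "prime p" "odd p" "p dvd N"
  shows "even (prime_exponent_sum p)"
proof (cases "p \<in> (\<lambda>m. nn m) ` Dv")
  case False
  then have empty: "{m \<in> Dv. nn m = p} = {}" by auto
  show ?thesis unfolding empty by simp
next
  case True
  obtain N3 k where N3: "N = p ^ k * N3" "\<not> p dvd N3"
    using multiplicity_decompose'[of N p] N p(1) by (metis not_prime_unit less_numeral_extra(3))
  have p1: "p > 1" by (rule prime_gt_1_nat[OF p(1)])
  have "\<not> p dvd 4 * N3"
  proof
    assume "p dvd 4 * N3"
    then have "p dvd 2 * 2" using p(1) N3(2) prime_dvd_mult_iff by auto
    then have "p dvd 2" using p(1) prime_dvd_mult_iff by blast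
    then show False using p by (metis primes_dvd_imp_eq two_is_prime_nat dvd_refl)
  qed
  then have "coprime p (4 * N3)" using p(1) prime_imp_coprime_nat by blast
  then have "coprime (int p) (int (4 * N3))" by (simp only: coprime_int_iff)
  then have cop: "coprime (int p) (4 * int N3)" by simp
  obtain g :: int where g: "[g ^ ((p - 1) div 2) = - 1] (mod int p)" "coprime g (int p)"
    by (rule ex_nonresidue[OF p(1,2)]) (rule that)
  \<comment> \<open>Only the character at p is to be nontrivial: a is a nonresidue modulo p and 1
    modulo the part of N prime to p. The factor 4 makes d congruent to 1 modulo 4, which removes the
    dependence of the signs on (d - 1)/2.\<close>
  obtain a where a: "[a = g] (mod int p)" "[a = 1] (mod 4 * int N3)"
    using binary_chinese_remainder_int[OF cop] by blast
  have cap: "coprime a (int p)" using a(1) g(2) cong_imp_coprime cong_sym by blast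
  moreover have "coprime a (4 * int N3)" using a(2) cong_imp_coprime cong_sym by (metis coprime_1_left)
  ultimately have ca4: "coprime a (4 * int N)" by (simp add: N3(1))
  then have ca: "coprime a (int N)" by simp
  obtain d where d: "[a * d = 1] (mod 4 * int N)" using cong_solve_coprime_int[OF ca4] by auto
  have ad: "[a * d = 1] (mod int N)" using cong_dvd_modulus[OF d, of "int N"] by simp
  have "[a * d = 1] (mod 4)" using cong_dvd_modulus[OF d, of 4] by simp
  moreover have "[a = 1] (mod 4)" using cong_dvd_modulus[OF a(2), of 4] by simp
  then have "[a * d = 1 * d] (mod 4)" by (rule cong_scalar_right)
  ultimately have d4: "[d = 1] (mod 4)" by (metis cong_sym cong_trans mult_1)
  have od: "odd d"
  proof -
    have "4 dvd d - 1" using d4 by (simp add: cong_iff_dvd_diff)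
    then show ?thesis by presburger
  qed
  have "[a ^ ((p - 1) div 2) = - 1] (mod int p)" using cong_pow[OF a(1)] g(1) cong_trans by blast
  then have sp: "theta_sign p a d = - 1" using theta_sign_eq_minus_1[OF p(1,2) _ cap d4] by blast
  have so: "theta_sign v a d = 1" if v: "v \<in> (\<lambda>m. nn m) ` Dv" "v \<noteq> p" for v
  proof (cases "prime v \<and> odd v")
    case False
    then show ?thesis by (rule theta_sign_trivial[OF v(1) ca])
  next
    case True
    have "v dvd N" using v(1) mpp_dvd by auto
    moreover have "\<not> v dvd p ^ k" using True p(1) v(2) by (metis prime_dvd_power primes_dvd_imp_eq)
    ultimately have "v dvd N3" using True unfolding N3(1) by (simp add: prime_dvd_mult_iff)
    then have "int v dvd 4 * int N3" by simp
    then have "[a = 1] (mod int v)" by (rule cong_dvd_modulus[OF a(2)])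
    then show ?thesis using True d4 prime_gt_1_nat by (intro theta_sign_eq_1) auto
  qed
  have "sgn_tot a d = 1" by (rule necessary(2)[OF inv order_inf order_zero ad od])
  also have "sgn_tot a d = of_int (theta_sign p a d) powi prime_exponent_sum p *
     (\<Prod>v\<in>(\<lambda>m. nn m) ` Dv - {p}. of_int (theta_sign v a d) powi prime_exponent_sum v)"
    unfolding sgn_tot_group by (rule prod.remove) (use True finite_Dv in auto)
  also have "(\<Prod>v\<in>(\<lambda>m. nn m) ` Dv - {p}. of_int (theta_sign v a d) powi prime_exponent_sum v) = (1::complex)"
    by (rule prod.neutral) (use so in auto)
  finally have "(- 1) powi prime_exponent_sum p = (1::complex)" unfolding sp by simp
  then show ?thesis by (auto simp: power_int_minus_left split: if_splits)
qed

theorem criterion: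
  "modular_function_X0 N f_prod \<longleftrightarrow>
    cusp_order N f_prod 1 N \<in> \<int> \<and> cusp_order N f_prod 1 1 \<in> \<int> \<and> cusp_order N f_prod 1 (odd_part N) \<in> \<int> \<and>
    [weighted_sum = 0] (mod int L) \<and>
    (\<forall>p. prime p \<and> odd p \<and> p dvd N \<longrightarrow>
       [(\<Sum>m\<in>{m \<in> Dv. \<exists>r. nn m = p ^ r}. \<Sum>h\<in>{0..<ll m}. e m h) = 0] (mod 2))"
proof -
  have prime_exponent_sum: "[(\<Sum>m\<in>{m \<in> Dv. \<exists>r. nn m = p ^ r}. \<Sum>h\<in>{0..<ll m}. e m h) = 0] (mod 2) \<longleftrightarrow> even (prime_exponent_sum p)"
    if "prime p" for p
  proof -
    have "{m \<in> Dv. \<exists>r. nn m = p ^ r} = {m \<in> Dv. nn m = p}" using mpp_prime_power_iff[OF that] by blast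
    then show ?thesis by (simp add: cong_0_iff)
  qed
  have weighted_sum: "[weighted_sum = 0] (mod int L) \<longleftrightarrow> int L dvd weighted_sum" by (rule cong_0_iff)
  show ?thesis
  proof
    assume "modular_function_X0 N f_prod"
    then have inv: "f_prod (moebius a b c d \<tau>) = f_prod \<tau>" if "a * d - b * c = 1" "int N dvd c" "Im \<tau> > 0" for a b c d \<tau>
      using that unfolding modular_function_X0_def by blast
    note cusp = cusp_integral[OF inv]
    have order_inf: "ee (of_real order_inf) = 1" by (rule cusp_infinity[OF cusp])
    have order_zero: "ee (of_real (order_zero + 2 * of_int quad_total / of_nat L)) = 1" by (rule cusp_zero[OF order_inf cusp])
    show "cusp_order N f_prod 1 N \<in> \<int> \<and> cusp_order N f_prod 1 1 \<in> \<int> \<and> cusp_order N f_prod 1 (odd_part N) \<in> \<int> \<and>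
      [weighted_sum = 0] (mod int L) \<and>
      (\<forall>p. prime p \<and> odd p \<and> p dvd N \<longrightarrow>
         [(\<Sum>m\<in>{m \<in> Dv. \<exists>r. nn m = p ^ r}. \<Sum>h\<in>{0..<ll m}. e m h) = 0] (mod 2))"
      using cusp necessary_weighted_sum[OF inv order_inf order_zero] necessary_prime_exponent_sum[OF inv order_inf order_zero] weighted_sum prime_exponent_sum by simp
  next
    assume *: "cusp_order N f_prod 1 N \<in> \<int> \<and> cusp_order N f_prod 1 1 \<in> \<int> \<and> cusp_order N f_prod 1 (odd_part N) \<in> \<int> \<and>
      [weighted_sum = 0] (mod int L) \<and>
      (\<forall>p. prime p \<and> odd p \<and> p dvd N \<longrightarrow>
         [(\<Sum>m\<in>{m \<in> Dv. \<exists>r. nn m = p ^ r}. \<Sum>h\<in>{0..<ll m}. e m h) = 0] (mod 2))"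
    have order_inf: "ee (of_real order_inf) = 1" using * cusp_infinity by blast
    have order_zero: "ee (of_real (order_zero + 2 * of_int quad_total / of_nat L)) = 1" using * cusp_zero[OF order_inf] by blast
    have 4: "int L dvd weighted_sum" using * weighted_sum by blast
    have 5: "even (prime_exponent_sum p)" if "prime p" "odd p" "p dvd N" for p using * prime_exponent_sum[OF that(1)] that by blast
    show "modular_function_X0 N f_prod"
      by (rule modular_if_invariant) (rule sufficient[OF order_inf order_zero 4 5])
  qed
qed

end

theorem theorem1p10:
  fixes N :: nat and S :: "nat \<Rightarrow> int set" and e :: "nat \<Rightarrow> nat \<Rightarrow> int"
  defines "L \<equiv> max_square_root N"
  defines "f \<equiv> \<lambda>\<tau>. \<Prod>m\<in>proper_divisors N. \<Prod>h\<in>{0..<ell N m}.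
                  F_fun N (S (mpp N m)) m (int h) \<tau> powi e m h"
  assumes "N > 0"
  assumes "odd L" and "squarefree L" and "coprime L (totient (N div L))"
  assumes "\<And>m. m \<in> proper_divisors N \<Longrightarrow> unit_reps_mod_pm1 (mpp N m) (S (mpp N m))"
  shows "modular_function_X0 N f \<longleftrightarrow>
    cusp_order N f 1 N \<in> \<int> \<and>
    cusp_order N f 1 1 \<in> \<int> \<and>
    cusp_order N f 1 (odd_part N) \<in> \<int> \<and>
    [(\<Sum>m\<in>proper_divisors N. int m * int (totient (mpp N m)) *
        (\<Sum>h\<in>{1..<ell N m}. int h * e m h)) = 0] (mod int L) \<and>
    (\<forall>p. prime p \<and> odd p \<and> p dvd N \<longrightarrow>
       [(\<Sum>m\<in>{m \<in> proper_divisors N. \<exists>r. mpp N m = p ^ r}. \<Sum>h\<in>{0..<ell N m}. e m h) = 0]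
         (mod 2))"
proof -
  interpret level N S e
    by unfold_locales (use assms in \<open>simp_all add: L_def\<close>)
  have f: "f = f_prod" by (simp add: fun_eq_iff f_def f_prod_def)
  show ?thesis using criterion unfolding f weighted_sum_def L_def .
qed

end
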